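(* Let $k\ge 2$ be an integer, and let $t\ge 4$ be an integer with $t\ne 2k$. Then, as $n\to\infty$, $$g(n,C_t,C_{2k})=\begin{cases}\Theta_{t,k}\bigl(n^{t/2}\bigr), & \text{if } k=2,\\ \Theta_{t,k}\bigl(n^{\lfloor t/2\rfloor}\bigr), & \text{if } k\ge 3,\end{cases}$$ where the implied constants depend only on $t$ and $k$.
   Context: Constructor--Blocker game: given graphs $H$ and $F$, two players, Constructor and Blocker, alternately claim one previously unclaimed edge of the complete graph $K_n$, with Constructor moving first. The graph formed by Constructor's edges must remain $F$-free (contain no subgraph isomorphic to $F$, not necessarily induced) throughout the game, so Constructor may not claim an edge that would create a copy of $F$; Blocker plays without restriction. The game ends when all edges are claimed or Constructor has no legal move. Constructor aims to maximize the number of copies of $H$ (subgraphs isomorphic to $H$) in her final graph and Blocker aims to minimize it; $g(n,H,F)$ denotes this number under optimal play by both players. $C_\ell$ is the cycle of length $\ell$. *)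

theory Defs
  imports "HOL-Library.Ramsey" "HOL-Library.Landau_Symbols"
begin

type_synonym 'a graph = "'a set \<times> 'a set set"

abbreviation verts :: "'a graph \<Rightarrow> 'a set" where "verts \<equiv> fst"
abbreviation edges :: "'a graph \<Rightarrow> 'a set set" where "edges \<equiv> snd"

text \<open>\<open>[A]\<^bsup>2\<^esup>\<close> is the set of two-element subsets of \<open>A\<close>.\<close>

definition simple_graph :: "'a graph \<Rightarrow> bool" where
  "simple_graph G \<longleftrightarrow> edges G \<subseteq> [verts G]\<^bsup>2\<^esup>"

definition subgraph_of :: "'a graph \<Rightarrow> 'a graph \<Rightarrow> bool" where
  "subgraph_of S G \<longleftrightarrow> simple_graph S \<and> verts S \<subseteq> verts G \<and> edges S \<subseteq> edges G"

definition isomorphic :: "'a graph \<Rightarrow> 'b graph \<Rightarrow> bool" where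
  "isomorphic G H \<longleftrightarrow>
     (\<exists>f. bij_betw f (verts G) (verts H) \<and> edges H = (\<lambda>e. f ` e) ` edges G)"

definition copies :: "'b graph \<Rightarrow> 'a graph \<Rightarrow> 'a graph set" where
  "copies H G = {S. subgraph_of S G \<and> isomorphic H S}"

definition free_of :: "'b graph \<Rightarrow> 'a graph \<Rightarrow> bool" where
  "free_of F G \<longleftrightarrow> copies F G = {}"

text \<open>Intended for \<open>l \<ge> 3\<close>.\<close>

definition cycle_graph :: "nat \<Rightarrow> nat graph" where
  "cycle_graph l = ({..<l}, {{i, Suc i mod l} | i. i < l})"

lemma simple_graph_cycle_graph: "l \<ge> 3 \<Longrightarrow> simple_graph (cycle_graph l)"
  by (auto simp: simple_graph_def cycle_graph_def nsets_def card_insert_if mod_Suc)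

text \<open>
  The board is \<open>K\<^sub>n\<close> on the vertex set \<open>{..<n}\<close>. In a position, \<open>C\<close> is the set of Constructor's
  edges and \<open>B\<close> the set of Blocker's edges.
\<close>

definition unclaimed :: "nat \<Rightarrow> nat set set \<Rightarrow> nat set set \<Rightarrow> nat set set" where
  "unclaimed n C B = [{..<n}]\<^bsup>2\<^esup> - (C \<union> B)"

definition constructor_moves ::
    "nat \<Rightarrow> 'b graph \<Rightarrow> nat set set \<Rightarrow> nat set set \<Rightarrow> nat set set" where
  "constructor_moves n F C B = {e \<in> unclaimed n C B. free_of F ({..<n}, insert e C)}"

definition game_over :: "nat \<Rightarrow> 'b graph \<Rightarrow> nat set set \<Rightarrow> nat set set \<Rightarrow> bool" where
  "game_over n F C B \<longleftrightarrow> unclaimed n C B = {} \<or> constructor_moves n F C B = {}"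

datatype player = Constructor | Blocker

lemma finite_unclaimed: "finite (unclaimed n C B)"
  by (simp add: unclaimed_def finite_imp_finite_nsets)

lemma card_unclaimed_less:
  assumes "e \<in> unclaimed n C B"
  shows "card (unclaimed n (insert e C) B) < card (unclaimed n C B)"
    and "card (unclaimed n C (insert e B)) < card (unclaimed n C B)"
proof -
  have "unclaimed n (insert e C) B = unclaimed n C B - {e}"
       "unclaimed n C (insert e B) = unclaimed n C B - {e}"
    by (auto simp: unclaimed_def)
  then show "card (unclaimed n (insert e C) B) < card (unclaimed n C B)"
    and "card (unclaimed n C (insert e B)) < card (unclaimed n C B)"
    using card_Diff1_less[OF finite_unclaimed assms] by auto
qed

text \<open>
  The value of a position, with the given player to move: the number of copies of \<open>H\<close> in
  Constructor's final graph when both players play optimally from there on.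
\<close>

function game_value ::
    "nat \<Rightarrow> 'b graph \<Rightarrow> 'c graph \<Rightarrow> player \<Rightarrow> nat set set \<Rightarrow> nat set set \<Rightarrow> nat" where
  "game_value n H F p C B =
     (if game_over n F C B then card (copies H ({..<n}, C))
      else case p of
        Constructor \<Rightarrow>
          Max ((\<lambda>e. game_value n H F Blocker (insert e C) B) ` constructor_moves n F C B)
      | Blocker \<Rightarrow>
          Min ((\<lambda>e. game_value n H F Constructor C (insert e B)) ` unclaimed n C B))"
  by pat_completeness auto
termination
  by (relation "measure (\<lambda>(n, H, F, p, C, B). card (unclaimed n C B))")
     (auto intro: card_unclaimed_less simp: constructor_moves_def)

declare game_value.simps [simp del]

definition game_number :: "nat \<Rightarrow> 'b graph \<Rightarrow> 'c graph \<Rightarrow> nat" where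
  "game_number n H F = game_value n H F Constructor {} {}"

end

theory Submission
  imports Defs "HOL-Analysis.Convex" "HOL-Algebra.Algebraic_Closure_Type" "HOL-Library.Z2"
begin

text \<open>
  Constructor's final graph contains no cycle of length 2k, so the upper bounds hold for every such
  graph on n vertices. Fix a vertex x. The pairs (y, z) such that xyz is a path form a relation in
  which no nonempty subrelation has all degrees above 2k: otherwise a greedy path that starts and ends
  in the neighbourhood of x would close up through x to a cycle of length 2k. Such a relation is the
  union of one with bounded columns and one with bounded rows (\<open>split_low_degree\<close>). Two things
  follow. Only O(n) paths of length 2 start at x, so that a walk costs a factor O(n) for every two new
  vertices. And each path xyz is either \<^emph>\<open>pinned\<close>, meaning that x and z leave boundedly many
  choices for y, or x and y leave boundedly many choices for z, and y and z for x.

  Let t = 2s. A cycle with a pinned vertex is rotated so that this vertex comes last; the first vertex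
  costs n, the next 2s - 2 vertices cost O(n) per pair, and the last one is free. A cycle without
  pinned vertices is determined by two vertices up to boundedly many choices. Both counts are
  O(n^s) (\<open>card_even_cycles\<close>).

  Let t = 2s + 1 and k \<ge> 3. Steps of length 2 run through the whole cycle, which has odd length, so some
  two vertices at distance 2 are either both pinned or both not (\<open>odd_cycle_repeats\<close>). If both
  are pinned, let x be the vertex between them: there are only O(n) edges with an end at distance 2 from
  x (\<open>card_second_edges\<close>, where k \<ge> 3 enters), so four vertices cost n^2 and one more is free
  at the end. If neither is pinned, a path of length 2 around the vertex between them determines five
  consecutive vertices. Again the count is O(n^s) (\<open>card_odd_cycles\<close>). For k = 2 the count
  starts from one of the O(n^(3/2)) edges instead, which gives O(n^(t/2))
  (\<open>card_odd_cycles_no_C4\<close>).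

  For the lower bound with k = 2, take a field of order q = 2^m with q^2 of size about n, and join (a, b)
  and (a', b') if b + b' + a a' is a prescribed constant and a, a' lie in consecutive classes of a
  partition of the field into t classes. This graph has no 4-cycles, at most q^3 edges, and of the order of
  q^t cycles that pass once through each class, of which at most q^(t-4) contain two given edges.
  Constructor plays only in this graph and follows the potential in which a cycle that Blocker has not
  touched has weight 2 to the number of its edges that she owns. A round decreases the potential by at
  most 2^t q^(t-4), hence the game by O(q^(t-1)), and a constant fraction of the q^t cycles is hers at the
  end (\<open>game_value_ge_potential\<close>, \<open>game_number_lower_C4\<close>).

  For the lower bound with k \<ge> 3, Constructor builds a blow-up of the cycle of length t in which
  every second vertex is replaced by linearly many vertices. All its cycles of length at least 6 have
  length t (\<open>blowup_cycle_length\<close>), and it has of the order of n^(t div 2) cycles of length t. If the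
  vertices that are not blown up, the \<^emph>\<open>hubs\<close>, were fixed in advance, Blocker could answer
  every edge va with vb, where a and b are the hubs next to the class of v. Therefore each hub is chosen only when it is needed, among
  the vertices that Blocker has not touched yet, and is then joined to large parts of the two adjacent
  classes (\<open>stage_step\<close>).
\<close>

abbreviation board :: "nat \<Rightarrow> nat set set" where
  "board n \<equiv> [{..<n}]\<^bsup>2\<^esup>"

abbreviation at_most :: "'a set \<Rightarrow> nat \<Rightarrow> bool" where
  "at_most S b \<equiv> finite S \<and> card S \<le> b"

section \<open>Copies of cycles\<close>

definition cyc :: "'a set set \<Rightarrow> nat \<Rightarrow> (nat \<Rightarrow> 'a) \<Rightarrow> bool" where
  "cyc E t g \<longleftrightarrow> inj_on g {..<t} \<and> (\<forall>i<t. {g i, g (Suc i mod t)} \<in> E)"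

definition cycle_edges :: "nat \<Rightarrow> (nat \<Rightarrow> 'a) \<Rightarrow> 'a set set" where
  "cycle_edges t g = (\<lambda>i. {g i, g (Suc i mod t)}) ` {..<t}"

definition cycle_copy :: "nat \<Rightarrow> (nat \<Rightarrow> 'a) \<Rightarrow> 'a graph" where
  "cycle_copy t g = (g ` {..<t}, cycle_edges t g)"

lemma cyc_iff: "cyc E t g \<longleftrightarrow> inj_on g {..<t} \<and> cycle_edges t g \<subseteq> E"
  by (auto simp: cyc_def cycle_edges_def)

lemma Suc_mod_neq:
  assumes "(t::nat) \<ge> 2" "i < t" shows "Suc i mod t \<noteq> i" "Suc i mod t < t"
  using assms by (auto simp: mod_Suc)

lemma copies_cycle_graph:
  assumes "t \<ge> 3" "E \<subseteq> [V]\<^bsup>2\<^esup>"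
  shows "copies (cycle_graph t) (V, E) = cycle_copy t ` {g. cyc E t g}"
proof -
  have img: "(\<lambda>e. g ` e) ` {{i, Suc i mod t} | i. i < t} = cycle_edges t g" for g :: "nat \<Rightarrow> 'a"
  proof -
    have "{{i, Suc i mod t} | i. i < t} = (\<lambda>i. {i, Suc i mod t}) ` {..<t}" by auto
    then show ?thesis by (simp add: cycle_edges_def image_image)
  qed
  have sub: "g ` {..<t} \<subseteq> V" if "cyc E t g" for g
  proof
    fix x assume "x \<in> g ` {..<t}"
    then obtain i where "i < t" "x = g i" by auto
    then have "{x, g (Suc i mod t)} \<in> E" using that by (auto simp: cyc_def)
    then have "{x, g (Suc i mod t)} \<in> [V]\<^bsup>2\<^esup>" using assms(2) by blast
    then show "x \<in> V" by (auto simp: nsets_def)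
  qed
  have sim: "simple_graph (cycle_copy t g)" if "inj_on g {..<t}" for g :: "nat \<Rightarrow> 'a"
  proof -
    have "g i \<noteq> g (Suc i mod t)" if "i < t" for i
      using \<open>inj_on g {..<t}\<close> that Suc_mod_neq[of t i] assms(1)
      by (metis One_nat_def Suc_leD inj_on_eq_iff lessThan_iff numeral_2_eq_2 numeral_3_eq_3)
    then show ?thesis using assms(1)
      by (auto simp: simple_graph_def cycle_copy_def cycle_edges_def)
  qed
  show ?thesis
  proof (intro equalityI subsetI)
    fix S assume "S \<in> copies (cycle_graph t) (V, E)"
    then obtain g where g: "bij_betw g {..<t} (verts S)" "edges S = cycle_edges t g"
      "edges S \<subseteq> E"
      by (auto simp: copies_def subgraph_of_def isomorphic_def cycle_graph_def img)
    then have "S = cycle_copy t g"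
      by (auto simp: cycle_copy_def bij_betw_def prod_eq_iff)
    with g show "S \<in> cycle_copy t ` {g. cyc E t g}"
      by (auto simp: cyc_iff bij_betw_def)
  next
    fix S assume "S \<in> cycle_copy t ` {g. cyc E t g}"
    then obtain g where g: "S = cycle_copy t g" "cyc E t g" by auto
    have "bij_betw g {..<t} (verts S)" "edges S = cycle_edges t g"
      using g by (auto simp: bij_betw_def cyc_iff cycle_copy_def)
    then have "isomorphic (cycle_graph t) S"
      by (auto simp: isomorphic_def cycle_graph_def img)
    moreover have "subgraph_of S (V, E)"
      using g sub[of g] sim[of g] by (auto simp: subgraph_of_def cyc_iff cycle_copy_def)
    ultimately show "S \<in> copies (cycle_graph t) (V, E)" by (simp add: copies_def)
  qed
qed

lemma finite_copies:
  assumes "finite V" "E \<subseteq> [V]\<^bsup>2\<^esup>" shows "finite (copies H (V, E))"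
proof (rule finite_subset)
  show "copies H (V, E) \<subseteq> Pow V \<times> Pow E" by (auto simp: copies_def subgraph_of_def)
  show "finite (Pow V \<times> Pow E)"
    using assms finite_subset[OF assms(2)] by (simp add: finite_imp_finite_nsets)
qed

lemma copies_mono: "E \<subseteq> E' \<Longrightarrow> copies H (V, E) \<subseteq> copies H (V, E')"
  by (auto simp: copies_def subgraph_of_def)

lemma free_of_mono: "free_of F (V, E') \<Longrightarrow> E \<subseteq> E' \<Longrightarrow> free_of F (V, E)"
  using copies_mono[of E E' F V] by (auto simp: free_of_def)

lemma free_of_cycle_iff:
  assumes "t \<ge> 3" "E \<subseteq> [V]\<^bsup>2\<^esup>"
  shows "free_of (cycle_graph t) (V, E) \<longleftrightarrow> (\<nexists>g. cyc E t g)"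
  by (simp add: free_of_def copies_cycle_graph[OF assms])

text \<open>
  If the vertices know their position, then a cycle can be recovered from its vertex set, so distinct
  labelled cycles are distinct subgraphs and no automorphisms have to be divided out.
\<close>

lemma cycle_copy_inj_on:
  assumes "\<And>g. g \<in> Fam \<Longrightarrow> g \<in> extensional {..<t}"
    and "\<And>g i. g \<in> Fam \<Longrightarrow> i < t \<Longrightarrow> layer (g i) = i"
  shows "inj_on (cycle_copy t) Fam"
proof (rule inj_onI)
  fix g h assume gh: "g \<in> Fam" "h \<in> Fam" "cycle_copy t g = cycle_copy t h"
  have "g i = h i" if "i < t" for i
  proof -
    have "g i \<in> h ` {..<t}" using gh(3) that by (auto simp: cycle_copy_def)
    then obtain j where "j < t" "g i = h j" by auto
    then show ?thesis using assms(2)[of g i] assms(2)[of h j] gh that by auto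
  qed
  then show "g = h"
    by (intro extensionalityI[OF assms(1) assms(1)]) (use gh in auto)
qed

lemma card_layered_cycles_le_copies:
  assumes "t \<ge> 3" "finite V" "E \<subseteq> [V]\<^bsup>2\<^esup>"
    and "\<And>g. g \<in> Fam \<Longrightarrow> g \<in> extensional {..<t}"
    and "\<And>g i. g \<in> Fam \<Longrightarrow> i < t \<Longrightarrow> layer (g i) = i"
    and "\<And>g. g \<in> Fam \<Longrightarrow> cycle_edges t g \<subseteq> E"
  shows "card Fam \<le> card (copies (cycle_graph t) (V, E))"
proof (rule card_inj_on_le)
  show "inj_on (cycle_copy t) Fam" by (rule cycle_copy_inj_on[OF assms(4,5)])
  have "inj_on g {..<t}" if "g \<in> Fam" for g
    by (rule inj_on_inverseI[of _ layer]) (use assms(5) that in auto)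
  then show "cycle_copy t ` Fam \<subseteq> copies (cycle_graph t) (V, E)"
    using assms(6) by (auto simp: copies_cycle_graph[OF assms(1,3)] cyc_iff)
  show "finite (copies (cycle_graph t) (V, E))" by (rule finite_copies[OF assms(2,3)])
qed

section \<open>Bounds for the value of the game\<close>

lemma finite_constructor_moves: "finite (constructor_moves n F C B)"
  by (rule finite_subset[OF _ finite_unclaimed[of n C B]]) (auto simp: constructor_moves_def)

lemma game_value_over: "game_over n F C B \<Longrightarrow> game_value n H F p C B = card (copies H ({..<n}, C))"
  by (simp add: game_value.simps)

lemma game_value_Constructor_ge:
  assumes "e \<in> constructor_moves n F C B" "v \<le> game_value n H F Blocker (insert e C) B"
  shows "v \<le> game_value n H F Constructor C B"
proof -
  have "\<not> game_over n F C B" using assms(1) by (auto simp: game_over_def constructor_moves_def)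
  then have eq: "game_value n H F Constructor C B
      = Max ((\<lambda>e. game_value n H F Blocker (insert e C) B) ` constructor_moves n F C B)"
    by (subst game_value.simps) simp
  show ?thesis unfolding eq using assms finite_constructor_moves[of n F C B]
    by (intro order_trans[OF assms(2)] Max_ge) auto
qed

lemma game_value_Blocker_ge:
  assumes "\<not> game_over n F C B"
    "\<And>e. e \<in> unclaimed n C B \<Longrightarrow> v \<le> game_value n H F Constructor C (insert e B)"
  shows "v \<le> game_value n H F Blocker C B"
proof -
  have "game_value n H F Blocker C B
      = Min ((\<lambda>e. game_value n H F Constructor C (insert e B)) ` unclaimed n C B)"
    using assms(1) by (subst game_value.simps) simp
  then show ?thesis using assms finite_unclaimed by (auto simp: game_over_def)
qed

lemma unclaimed_insert_lt:
  "e \<in> constructor_moves n F C B \<Longrightarrow> card (unclaimed n (insert e C) B) < card (unclaimed n C B)"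
  by (auto intro: card_unclaimed_less simp: constructor_moves_def)

text \<open>
  Constructor never loses edges, so what she has already built is a lower bound.
\<close>

lemma game_value_ge_copies:
  "C \<subseteq> board n \<Longrightarrow> card (copies H ({..<n}, C)) \<le> game_value n H F p C B"
proof (induction "card (unclaimed n C B)" arbitrary: p C B rule: less_induct)
  case less
  show ?case
  proof (cases "game_over n F C B")
    case True then show ?thesis by (simp add: game_value_over)
  next
    case False
    show ?thesis
    proof (cases p)
      case Constructor
      obtain e where e: "e \<in> constructor_moves n F C B" using False by (auto simp: game_over_def)
      then have C': "insert e C \<subseteq> board n"
        using less.prems by (auto simp: constructor_moves_def unclaimed_def)
      have "card (copies H ({..<n}, C)) \<le> card (copies H ({..<n}, insert e C))"
        by (intro card_mono finite_copies copies_mono) (use C' in auto)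
      also have "\<dots> \<le> game_value n H F Blocker (insert e C) B"
        by (rule less.hyps[OF unclaimed_insert_lt[OF e] C'])
      finally show ?thesis unfolding Constructor by (rule game_value_Constructor_ge[OF e])
    next
      case Blocker
      show ?thesis unfolding Blocker using False less
        by (intro game_value_Blocker_ge) (auto intro: card_unclaimed_less)
    qed
  qed
qed

lemma game_value_le:
  assumes bound: "\<And>C. C \<subseteq> board n \<Longrightarrow> free_of F ({..<n}, C) \<Longrightarrow> card (copies H ({..<n}, C)) \<le> u"
  shows "C \<subseteq> board n \<Longrightarrow> free_of F ({..<n}, C) \<Longrightarrow> game_value n H F p C B \<le> u"
proof (induction "card (unclaimed n C B)" arbitrary: p C B rule: less_induct)
  case less
  show ?case
  proof (cases "game_over n F C B")
    case True then show ?thesis using bound less.prems by (simp add: game_value_over)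
  next
    case False
    show ?thesis
    proof (cases p)
      case Constructor
      have ne: "constructor_moves n F C B \<noteq> {}" using False by (auto simp: game_over_def)
      have "game_value n H F p C B
        = Max ((\<lambda>e. game_value n H F Blocker (insert e C) B) ` constructor_moves n F C B)"
        using False by (subst game_value.simps) (simp add: Constructor)
      also have "\<dots> \<le> u"
      proof (subst Max_le_iff)
        show "\<forall>a\<in>(\<lambda>e. game_value n H F Blocker (insert e C) B) ` constructor_moves n F C B. a \<le> u"
        proof clarify
          fix e assume e: "e \<in> constructor_moves n F C B"
          show "game_value n H F Blocker (insert e C) B \<le> u"
            by (rule less.hyps[OF unclaimed_insert_lt[OF e]])
               (use e less.prems in \<open>auto simp: constructor_moves_def unclaimed_def\<close>)
        qed
      qed (use ne finite_constructor_moves[of n F C B] in auto)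
      finally show ?thesis .
    next
      case Blocker
      obtain e where e: "e \<in> unclaimed n C B" using False by (auto simp: game_over_def)
      have "game_value n H F p C B
        = Min ((\<lambda>e. game_value n H F Constructor C (insert e B)) ` unclaimed n C B)"
        using False by (subst game_value.simps) (simp add: Blocker)
      also have "\<dots> \<le> game_value n H F Constructor C (insert e B)"
        by (rule Min_le) (use e finite_unclaimed in auto)
      also have "\<dots> \<le> u" by (rule less.hyps[OF card_unclaimed_less(2)[OF e] less.prems])
      finally show ?thesis .
    qed
  qed
qed

section \<open>Alternating paths and relations of low degree\<close>

lemma card_le_fibres:
  assumes "finite S" "\<And>y. y \<in> f ` S \<Longrightarrow> card {x \<in> S. f x = y} \<le> b"
  shows "card S \<le> card (f ` S) * b"
proof -
  have "card S = (\<Sum>y\<in>f ` S. card {x \<in> S. f x = y})"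
    using sum.image_gen[OF assms(1), of "\<lambda>_. 1::nat" f] by simp
  also have "\<dots> \<le> (\<Sum>y\<in>f ` S. b)" by (intro sum_mono assms(2))
  finally show ?thesis by simp
qed

definition is_cycle :: "('a \<times> 'a) set \<Rightarrow> 'a list \<Rightarrow> bool" where
  "is_cycle R xs \<longleftrightarrow> xs \<noteq> [] \<and> distinct xs \<and> successively (\<lambda>u v. (u, v) \<in> R) xs \<and> (last xs, hd xs) \<in> R"

lemma successively_conv_nth:
  "successively P xs \<longleftrightarrow> (\<forall>i. Suc i < length xs \<longrightarrow> P (xs ! i) (xs ! Suc i))"
proof (induction xs)
  case (Cons x xs)
  show ?case
  proof (cases xs)
    case (Cons y ys)
    have "(\<forall>i. Suc i < length (x # xs) \<longrightarrow> P ((x # xs) ! i) ((x # xs) ! Suc i)) \<longleftrightarrow>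
      P x y \<and> (\<forall>i. Suc i < length xs \<longrightarrow> P (xs ! i) (xs ! Suc i))"
      unfolding Cons using less_Suc_eq_0_disj by auto
    then show ?thesis using Cons.IH by (simp add: Cons)
  qed simp
qed simp

lemma is_cycle_iff_nth:
  "is_cycle R xs \<longleftrightarrow> xs \<noteq> [] \<and> distinct xs \<and> (\<forall>i<length xs. (xs ! i, xs ! (Suc i mod length xs)) \<in> R)"
proof (cases "xs = []")
  case False
  then obtain l where l: "length xs = Suc l" by (cases xs) auto
  have "(\<forall>i<length xs. (xs ! i, xs ! (Suc i mod length xs)) \<in> R) \<longleftrightarrow>
    (\<forall>i<l. (xs ! i, xs ! Suc i) \<in> R) \<and> (xs ! l, xs ! 0) \<in> R"
    unfolding l by (auto simp: less_Suc_eq mod_Suc)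
  then show ?thesis using False
    by (simp add: is_cycle_def successively_conv_nth l last_conv_nth hd_conv_nth)
qed (simp add: is_cycle_def)

text \<open>
  The list walks from left to right along T, back along the converse, and so on. Only the positions
  alternate between the two sides: a vertex of the graph may occur on both sides of T.
\<close>

fun alternating :: "('a \<times> 'a) set \<Rightarrow> 'a list \<Rightarrow> bool" where
  "alternating T (u # v # xs) \<longleftrightarrow> (u, v) \<in> T \<and> alternating (T\<inverse>) (v # xs)"
| "alternating T _ \<longleftrightarrow> True"

definition high_degree :: "nat \<Rightarrow> ('a \<times> 'a) set \<Rightarrow> bool" where
  "high_degree D T \<longleftrightarrow> (\<forall>y\<in>Domain T. D < card (T `` {y})) \<and> (\<forall>z\<in>Range T. D < card (T\<inverse> `` {z}))"

lemma high_degree_converse: "high_degree D (T\<inverse>) \<longleftrightarrow> high_degree D T"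
  by (auto simp: high_degree_def)

text \<open>
  Greedy choice: a degree above D leaves a neighbour outside the forbidden set and the path so far.
\<close>

lemma alternating_path_exists:
  assumes "finite T" "high_degree D T" "y \<in> Domain T" "finite W" "card W + l \<le> D"
  shows "\<exists>xs. length xs = l \<and> alternating T (y # xs) \<and> distinct (y # xs) \<and> set xs \<inter> W = {}"
  using assms
proof (induction l arbitrary: T y W)
  case 0
  show ?case by (rule exI[of _ "[]"]) simp
next
  case (Suc l)
  have "D < card (T `` {y})" using Suc.prems by (auto simp: high_degree_def)
  moreover have "card (insert y W) \<le> D" using Suc.prems card_insert_le_m1[of "D" W y]
    by (simp add: card_insert_if)
  ultimately have "\<not> T `` {y} \<subseteq> insert y W"
    using card_mono[of "insert y W" "T `` {y}"] Suc.prems(4) by auto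
  then obtain z where z: "(y, z) \<in> T" "z \<notin> insert y W" by auto
  have "\<exists>xs. length xs = l \<and> alternating (T\<inverse>) (z # xs) \<and> distinct (z # xs) \<and> set xs \<inter> insert y W = {}"
    by (rule Suc.IH) (use Suc.prems z in \<open>auto simp: high_degree_converse card_insert_if\<close>)
  then obtain xs where "length xs = l" "alternating (T\<inverse>) (z # xs)" "distinct (z # xs)"
    "set xs \<inter> insert y W = {}" by blast
  then show ?case using z by (intro exI[of _ "z # xs"]) auto
qed

lemma alternating_successively:
  "alternating T xs \<Longrightarrow> T \<subseteq> R \<Longrightarrow> sym R \<Longrightarrow> successively (\<lambda>u v. (u, v) \<in> R) xs"
  by (induction T xs rule: alternating.induct) (auto simp: sym_conv_converse_eq)

lemma alternating_last:
  "alternating T (x # xs) \<Longrightarrow> x \<in> Domain T \<Longrightarrow>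
    (even (length xs) \<longrightarrow> last (x # xs) \<in> Domain T) \<and> (odd (length xs) \<longrightarrow> last (x # xs) \<in> Range T)"
  by (induction xs arbitrary: T x) (auto, (metis Domain_converse Range.intros Range_converse)+)

lemma alternating_set:
  "alternating T (x # xs) \<Longrightarrow> x \<in> Domain T \<Longrightarrow> set (x # xs) \<subseteq> Field T"
proof (induction xs arbitrary: T x)
  case Nil then show ?case by (auto simp: Field_def)
next
  case (Cons a xs)
  have "set (a # xs) \<subseteq> Field (T\<inverse>)" by (rule Cons.IH) (use Cons.prems in auto)
  then show ?case using Cons.prems by (auto simp: Field_def)
qed

text \<open>
  A vertex of degree at most D is removed together with its edges, which are charged to it: to the rows
  if it lies on the left, to the columns if it lies on the right. A vertex is charged at most once.
\<close>

lemma split_low_degree: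
  assumes "finite T" "\<And>T'. T' \<subseteq> T \<Longrightarrow> T' \<noteq> {} \<Longrightarrow> \<not> high_degree D T'"
  shows "\<exists>T1 T2. T = T1 \<union> T2 \<and> (\<forall>z. card (T1\<inverse> `` {z}) \<le> D) \<and> (\<forall>y. card (T2 `` {y}) \<le> D)"
  using assms
proof (induction "card T" arbitrary: T rule: less_induct)
  case less
  show ?case
  proof (cases "T = {}")
    case True then show ?thesis by auto
  next
    case False
    then have "\<not> high_degree D T" using less.prems by auto
    then consider y where "y \<in> Domain T" "card (T `` {y}) \<le> D"
      | z where "z \<in> Range T" "card (T\<inverse> `` {z}) \<le> D"
      by (auto simp: high_degree_def not_less)
    then show ?thesis
    proof cases
      case 1
      define S where "S = T - {y} \<times> UNIV"
      have "S \<subset> T" using 1(1) by (auto simp: S_def)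
      then have "\<exists>T1 T2. S = T1 \<union> T2 \<and> (\<forall>z. card (T1\<inverse> `` {z}) \<le> D) \<and> (\<forall>y. card (T2 `` {y}) \<le> D)"
        using less.prems by (intro less.hyps psubset_card_mono) (auto intro: finite_subset)
      then obtain T1 T2 where T: "S = T1 \<union> T2" "\<forall>z. card (T1\<inverse> `` {z}) \<le> D" "\<forall>y. card (T2 `` {y}) \<le> D"
        by blast
      define T2' where "T2' = T2 \<union> {y} \<times> T `` {y}"
      have "T2' `` {u} = (if u = y then T `` {y} else T2 `` {u})" for u
        using T(1) by (auto simp: T2'_def S_def)
      then have "\<forall>u. card (T2' `` {u}) \<le> D" using T 1 by auto
      moreover have "T = T1 \<union> T2'" using T(1) by (auto simp: T2'_def S_def)
      ultimately show ?thesis using T(2) by blast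
    next
      case 2
      define S where "S = T - UNIV \<times> {z}"
      have "S \<subset> T" using 2(1) by (auto simp: S_def)
      then have "\<exists>T1 T2. S = T1 \<union> T2 \<and> (\<forall>z. card (T1\<inverse> `` {z}) \<le> D) \<and> (\<forall>y. card (T2 `` {y}) \<le> D)"
        using less.prems by (intro less.hyps psubset_card_mono) (auto intro: finite_subset)
      then obtain T1 T2 where T: "S = T1 \<union> T2" "\<forall>z. card (T1\<inverse> `` {z}) \<le> D" "\<forall>y. card (T2 `` {y}) \<le> D"
        by blast
      define T1' where "T1' = T1 \<union> (T\<inverse> `` {z}) \<times> {z}"
      have "T1'\<inverse> `` {u} = (if u = z then T\<inverse> `` {z} else T1\<inverse> `` {u})" for u
        using T(1) by (auto simp: T1'_def S_def)
      then have "\<forall>u. card (T1'\<inverse> `` {u}) \<le> D" using T 2 by auto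
      moreover have "T = T1' \<union> T2" using T(1) by (auto simp: T1'_def S_def)
      ultimately show ?thesis using T(3) by blast
    qed
  qed
qed

lemma card_le_rows:
  assumes "finite A" "T \<subseteq> A \<times> UNIV" "finite T" "\<And>y. card (T `` {y}) \<le> D"
  shows "card T \<le> card A * D"
proof -
  have "card {p \<in> T. fst p = y} \<le> D" for y
  proof -
    have "{p \<in> T. fst p = y} = Pair y ` (T `` {y})" by auto
    then show ?thesis using assms(4)[of y] by (simp add: card_image inj_on_def)
  qed
  then have "card T \<le> card (fst ` T) * D" by (intro card_le_fibres assms)
  also have "\<dots> \<le> card A * D" using assms by (intro mult_right_mono card_mono) auto
  finally show ?thesis .
qed

lemma card_le_low_degree:
  assumes "finite A" "T \<subseteq> A \<times> A" "\<And>T'. T' \<subseteq> T \<Longrightarrow> T' \<noteq> {} \<Longrightarrow> \<not> high_degree D T'"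
  shows "card T \<le> card A * (2 * D)"
proof -
  have fin: "finite T" using assms by (auto intro: finite_subset)
  obtain T1 T2 where T: "T = T1 \<union> T2" "\<And>z. card (T1\<inverse> `` {z}) \<le> D" "\<And>y. card (T2 `` {y}) \<le> D"
    using split_low_degree[OF fin assms(3)] by blast
  have "card (T1\<inverse>) \<le> card A * D" by (rule card_le_rows) (use T fin assms in auto)
  moreover have "card T2 \<le> card A * D" by (rule card_le_rows) (use T fin assms in auto)
  moreover have "card T \<le> card T1 + card T2" unfolding T(1) by (rule card_Un_le)
  ultimately show ?thesis by (simp add: algebra_simps)
qed

lemma at_most_UN:
  assumes "at_most I c" "S \<subseteq> (\<Union>i\<in>I. A i)" "\<And>i. i \<in> I \<Longrightarrow> at_most (A i) b"
  shows "at_most S (c * b)"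
proof -
  have fin: "finite (\<Union>i\<in>I. A i)" using assms by auto
  have "card S \<le> card (\<Union>i\<in>I. A i)" by (rule card_mono[OF fin assms(2)])
  also have "\<dots> \<le> (\<Sum>i\<in>I. card (A i))" using assms(1) by (intro card_UN_le) simp
  also have "\<dots> \<le> (\<Sum>i\<in>I. b)" by (intro sum_mono) (use assms(3) in auto)
  also have "\<dots> \<le> c * b" using assms(1) by (simp add: mult_le_mono1)
  finally show ?thesis using fin assms(2) by (auto intro: finite_subset)
qed

lemma at_most_image: "at_most A b \<Longrightarrow> at_most (f ` A) b"
  using card_image_le[of A f] by auto

lemma is_cycle_rotate1: "is_cycle R xs \<Longrightarrow> is_cycle R (rotate1 xs)"
  by (cases xs) (auto simp: is_cycle_def successively_append_iff successively_Cons hd_append split: if_splits)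

lemma is_cycle_rotate: "is_cycle R xs \<Longrightarrow> is_cycle R (rotate r xs)"
  by (induction r) (auto simp: is_cycle_rotate1)

lemma card_le_rotations:
  assumes "finite E" "\<And>xs. xs \<in> S \<Longrightarrow> length xs = t \<and> (\<exists>r. rotate r xs \<in> E)"
  shows "at_most S (Suc t * card E)"
proof -
  have "S \<subseteq> (\<Union>j\<in>{..t}. rotate j ` E)"
  proof
    fix xs assume "xs \<in> S"
    then obtain r where r: "length xs = t" "rotate r xs \<in> E" using assms(2) by blast
    \<comment> \<open>completes the rotation by r to a full turn\<close>
    define j where "j = t - r mod t"
    have "rotate j (rotate r xs) = xs"
    proof (cases "t = 0")
      case True then show ?thesis using r(1) by simp
    next
      case False
      have "r mod t < t" using False by simp
      then have "j + r = t + r div t * t" using div_mult_mod_eq[of r t] unfolding j_def by linarith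
      then show ?thesis by (simp add: rotate_rotate rotate_id r)
    qed
    moreover have "j \<le> t" by (simp add: j_def)
    ultimately show "xs \<in> (\<Union>j\<in>{..t}. rotate j ` E)" using r(2) by (metis UN_I atMost_iff image_eqI)
  qed
  then have "at_most S (card {..t} * card E)"
    using assms(1) by (intro at_most_UN) (auto intro: card_image_le)
  then show ?thesis by simp
qed

section \<open>Paths in graphs without a cycle of length 2k\<close>

text \<open>
  A graph is given here by its symmetric adjacency relation, so that its subrelations can serve as
  bipartite graphs with two copies of the vertex set as sides.
\<close>

locale even_cycle_free =
  fixes V :: "'a set" and R :: "('a \<times> 'a) set" and k :: nat
  assumes finite_V: "finite V" and R_sub: "R \<subseteq> V \<times> V" and sym_R: "sym R" and irrefl_R: "irrefl R"
    and k_ge_2: "k \<ge> 2"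
    and no_cycle: "is_cycle R xs \<Longrightarrow> length xs \<noteq> 2 * k"
begin

definition two_paths :: "'a \<Rightarrow> ('a \<times> 'a) set" where
  "two_paths x = {(y, z). (x, y) \<in> R \<and> (y, z) \<in> R \<and> z \<noteq> x}"

lemma R_symD: "(u, v) \<in> R \<Longrightarrow> (v, u) \<in> R" using sym_R by (auto dest: symD)
lemma R_neq: "(u, v) \<in> R \<Longrightarrow> u \<noteq> v" using irrefl_R by (auto simp: irrefl_def)
lemma R_in: "(u, v) \<in> R \<Longrightarrow> u \<in> V \<and> v \<in> V" using R_sub by auto
lemma finite_R: "finite R" using R_sub finite_V by (auto intro: finite_subset)

lemma two_paths_sub: "two_paths x \<subseteq> V \<times> V" using R_in by (auto simp: two_paths_def)
lemma finite_two_paths: "finite (two_paths x)"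
  by (rule finite_subset[OF two_paths_sub]) (simp add: finite_V)

text \<open>
  A greedy path of length 2k - 2 that starts on the left side ends on the left side, which consists of
  neighbours of x. Together with x it forms a cycle of length 2k.
\<close>

lemma two_paths_low_degree:
  assumes "T \<subseteq> two_paths x" "T \<noteq> {}"
  shows "\<not> high_degree (2 * k) T"
proof
  assume hd: "high_degree (2 * k) T"
  obtain y where y: "y \<in> Domain T" using assms(2) by auto
  have le: "Suc (2 * k - 2) \<le> 2 * k" using k_ge_2 by linarith
  have "finite T" using assms(1) finite_two_paths by (rule finite_subset)
  then obtain xs where xs: "length xs = 2 * k - 2" "alternating T (y # xs)" "distinct (y # xs)"
    "set xs \<inter> {x} = {}"
    using alternating_path_exists[OF _ hd y, of "{x}" "2 * k - 2"] le by auto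
  have TR: "T \<subseteq> R" using assms(1) by (auto simp: two_paths_def)
  have dom: "(x, u) \<in> R" if "u \<in> Domain T" for u using that assms(1) by (auto simp: two_paths_def)
  have "last (y # xs) \<in> Domain T" using alternating_last[OF xs(2) y] xs(1) by auto
  then have "(last (y # xs), x) \<in> R" using dom R_symD by blast
  moreover have "successively (\<lambda>u v. (u, v) \<in> R) (y # xs)"
    by (rule alternating_successively[OF xs(2) TR sym_R])
  ultimately have "is_cycle R (x # y # xs)"
    using dom[OF y] R_neq xs by (auto simp: is_cycle_def)
  then show False using no_cycle[of "x # y # xs"] xs(1) k_ge_2 by simp
qed

abbreviation "N \<equiv> card V * (4 * k)"

lemma at_most_V: "at_most V (card V)" using finite_V by simp

lemma card_two_paths: "at_most (two_paths x) N"
  using finite_two_paths card_le_low_degree[OF finite_V two_paths_sub[of x] two_paths_low_degree[where x=x]] by simp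

text \<open>
  A fixed splitting of \<open>two_paths x\<close>; this is the part in which z leaves few choices for y.
\<close>

definition narrow :: "'a \<Rightarrow> ('a \<times> 'a) set" where
  "narrow x = (SOME T. T \<subseteq> two_paths x \<and> (\<forall>z. card (T\<inverse> `` {z}) \<le> 2 * k)
      \<and> (\<forall>y. card ((two_paths x - T) `` {y}) \<le> 2 * k))"

lemma narrow:
  "narrow x \<subseteq> two_paths x" "card ((narrow x)\<inverse> `` {z}) \<le> 2 * k"
  "card ((two_paths x - narrow x) `` {y}) \<le> 2 * k"
proof -
  obtain T1 T2 where T: "two_paths x = T1 \<union> T2" "\<forall>z. card (T1\<inverse> `` {z}) \<le> 2 * k"
    "\<forall>y. card (T2 `` {y}) \<le> 2 * k"
    using split_low_degree[OF finite_two_paths[of x] two_paths_low_degree[where x=x]] by blast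
  have "card ((two_paths x - T1) `` {y}) \<le> 2 * k" for y
  proof -
    have "finite T2" using T(1) finite_two_paths[of x] by simp
    then have "card ((two_paths x - T1) `` {y}) \<le> card (T2 `` {y})"
      by (intro card_mono finite_Image) (use T in auto)
    then show ?thesis using T(3) le_trans by blast
  qed
  then have "\<exists>T. T \<subseteq> two_paths x \<and> (\<forall>z. card (T\<inverse> `` {z}) \<le> 2 * k)
      \<and> (\<forall>y. card ((two_paths x - T) `` {y}) \<le> 2 * k)" using T by (intro exI[of _ T1]) auto
  from someI_ex[OF this, folded narrow_def]
  show "narrow x \<subseteq> two_paths x" "card ((narrow x)\<inverse> `` {z}) \<le> 2 * k"
    "card ((two_paths x - narrow x) `` {y}) \<le> 2 * k" by auto
qed

text \<open>
  The middle vertex of a path xyz is pinned if it is one of few choices once both ends are known. The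
  disjunction makes the notion independent of the direction in which the path is read.
\<close>

definition pinned :: "'a \<Rightarrow> 'a \<Rightarrow> 'a \<Rightarrow> bool" where
  "pinned x y z \<longleftrightarrow> (y, z) \<in> narrow x \<or> (y, x) \<in> narrow z"

lemma pinned_sym: "pinned x y z \<longleftrightarrow> pinned z y x" by (auto simp: pinned_def)

lemma card_pinned: "at_most {y. pinned x y z} (4 * k)"
proof -
  have eq: "{y. pinned x y z} = (narrow x)\<inverse> `` {z} \<union> (narrow z)\<inverse> `` {x}" by (auto simp: pinned_def)
  have fin: "finite ((narrow u)\<inverse> `` {v})" for u v
    using finite_subset[OF narrow(1) finite_two_paths] by (intro finite_Image) auto
  show ?thesis unfolding eq using fin narrow(2)[of x z] narrow(2)[of z x]
      card_Un_le[of "(narrow x)\<inverse> `` {z}" "(narrow z)\<inverse> `` {x}"] by auto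
qed

lemma card_not_pinned:
  "at_most {z. (y, z) \<in> two_paths x \<and> \<not> pinned x y z} (2 * k)"
proof -
  have fin: "finite ((two_paths x - narrow x) `` {y})" using finite_two_paths by auto
  have sub: "{z. (y, z) \<in> two_paths x \<and> \<not> pinned x y z} \<subseteq> (two_paths x - narrow x) `` {y}"
    by (auto simp: pinned_def)
  show ?thesis using card_mono[OF fin sub] narrow(3)[of x y] finite_subset[OF sub fin] by (meson le_trans)
qed

definition paths :: "'a \<Rightarrow> nat \<Rightarrow> 'a list set" where
  "paths x l = {xs. length xs = l \<and> distinct (x # xs) \<and> successively (\<lambda>u v. (u, v) \<in> R) (x # xs)}"

text \<open>
  Each further pair of vertices continues a path of length 2 from the current end.
\<close>

lemma card_paths: "at_most (paths x (2 * j)) (N ^ j)"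
proof (induction j arbitrary: x)
  case 0
  have "paths x (2 * 0) = {[]}" by (auto simp: paths_def)
  then show ?case by simp
next
  case (Suc j)
  have "paths x (2 * Suc j) \<subseteq> (\<Union>(y, z)\<in>two_paths x. (\<lambda>ys. y # z # ys) ` paths z (2 * j))"
  proof
    fix xs assume xs: "xs \<in> paths x (2 * Suc j)"
    then have "length xs = Suc (Suc (2 * j))" by (simp add: paths_def)
    then obtain y z ys where eq: "xs = y # z # ys" "length ys = 2 * j" by (metis length_Suc_conv)
    have "(y, z) \<in> two_paths x" "ys \<in> paths z (2 * j)"
      using xs eq by (auto simp: paths_def two_paths_def)
    then show "xs \<in> (\<Union>(y, z)\<in>two_paths x. (\<lambda>ys. y # z # ys) ` paths z (2 * j))"
      unfolding eq(1) by blast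
  qed
  then show ?case
    unfolding power_Suc
  proof (rule at_most_UN[OF card_two_paths])
    fix p
    show "at_most (case p of (y, z) \<Rightarrow> (\<lambda>ys. y # z # ys) ` paths z (2 * j)) (N ^ j)"
      unfolding case_prod_beta by (rule at_most_image[OF Suc.IH])
  qed
qed

definition distant_edges :: "'a \<Rightarrow> ('a \<times> 'a) set" where
  "distant_edges x = {(u, v) \<in> R. (x, u) \<notin> R \<and> (x, v) \<notin> R \<and> u \<noteq> x \<and> v \<noteq> x \<and> (\<exists>y. (x, y) \<in> R \<and> (y, u) \<in> R)}"

text \<open>
  Every left vertex u has a parent, a common neighbour with x. In a subrelation of high degree, a path
  of length 2k - 4 between left vertices with different parents closes up through both parents and x to a
  cycle of length 2k. If some right vertex z has neighbours with different parents, then such a path is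
  obtained by continuing a path of length 2k - 5 from z to whichever of the two neighbours has a parent
  different from that of the other end. Otherwise parents are constant along alternating paths, and a path of length
  2k - 2 closes up through the common parent alone. Edges that meet the neighbourhood of x are excluded
  so that parents never lie on the path.
\<close>

lemma distant_edges_low_degree:
  assumes k3: "k \<ge> 3" and T: "T \<subseteq> distant_edges x" "T \<noteq> {}"
  shows "\<not> high_degree (2 * k) T"
proof
  assume hd: "high_degree (2 * k) T"
  have TR: "T \<subseteq> R" using T(1) by (auto simp: distant_edges_def)
  have fin: "finite T" using TR finite_R by (rule finite_subset)
  define p where "p u = (SOME y. (x, y) \<in> R \<and> (y, u) \<in> R)" for u
  have p: "(x, p u) \<in> R" "(p u, u) \<in> R" if "u \<in> Domain T" for u
  proof -
    have "\<exists>y. (x, y) \<in> R \<and> (y, u) \<in> R" using that T(1) by (auto simp: distant_edges_def)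
    from someI_ex[OF this] show "(x, p u) \<in> R" "(p u, u) \<in> R" by (auto simp: p_def)
  qed
  have far: "(x, u) \<notin> R" "u \<noteq> x" if "u \<in> Field T" for u
    using that T(1) by (auto simp: distant_edges_def Field_def)
  have TRc: "T\<inverse> \<subseteq> R" using TR R_symD by auto
  show False
  proof (cases "\<exists>u u' z. (u, z) \<in> T \<and> (u', z) \<in> T \<and> p u \<noteq> p u'")
    case True
    then obtain u1 u2 z where uz: "(u1, z) \<in> T" "(u2, z) \<in> T" "p u1 \<noteq> p u2" by blast
    have zdom: "z \<in> Domain (T\<inverse>)" using uz by auto
    have "card {u1, u2} \<le> 2" by (simp add: card_insert_if)
    then have "\<exists>xs. length xs = 2 * k - 5 \<and> alternating (T\<inverse>) (z # xs) \<and> distinct (z # xs) \<and> set xs \<inter> {u1, u2} = {}"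
      by (intro alternating_path_exists[of _ "2 * k"]) (use fin hd zdom k3 in \<open>auto simp: high_degree_converse\<close>)
    then obtain xs where xs: "length xs = 2 * k - 5" "alternating (T\<inverse>) (z # xs)" "distinct (z # xs)"
      "set xs \<inter> {u1, u2} = {}" by blast
    define w where "w = last (z # xs)"
    have "odd (length xs)" using xs(1) k3 by auto
    then have w: "w \<in> Domain T" using alternating_last[OF xs(2) zdom] by (auto simp: w_def)
    have setF: "set (z # xs) \<subseteq> Field T" using alternating_set[OF xs(2) zdom] by simp
    have suc: "successively (\<lambda>u v. (u, v) \<in> R) (z # xs)"
      by (rule alternating_successively[OF xs(2) TRc sym_R])
    have *: False if u: "(u, z) \<in> T" "u \<in> {u1, u2}" "p u \<noteq> p w" for u
    proof -
      have ud: "u \<in> Domain T" using u by auto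
      have ns: "\<And>a. (x, a) \<in> R \<Longrightarrow> a \<notin> set (z # xs)" "x \<notin> set (z # xs)" using setF far by blast+
      have "u \<in> Field T" using u by (auto simp: Field_def)
      have uzR: "(u, z) \<in> R" using u TR by auto
      have "successively (\<lambda>u v. (u, v) \<in> R) ((z # xs) @ [p w])"
        using suc R_symD[OF p(2)[OF w]] by (simp add: successively_append_iff w_def del: append_Cons)
      then have "is_cycle R (x # p u # u # z # xs @ [p w])"
        using p[OF ud] p[OF w] uzR R_symD[OF p(1)[OF w]] xs(3,4) u(2,3) ns(1)[OF p(1)[OF ud]]
          ns(1)[OF p(1)[OF w]] ns(2) far[OF \<open>u \<in> Field T\<close>] R_neq[OF uzR] R_neq[OF p(1)[OF ud]]
          R_neq[OF p(1)[OF w]]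
        by (auto simp: is_cycle_def)
      then show False using no_cycle[of "x # p u # u # z # xs @ [p w]"] xs(1) k3 by simp
    qed
    show False using *[OF uz(1)] *[OF uz(2)] uz(3) by (metis insertCI)
  next
    case False
    have same: "alternating T (y # xs) \<Longrightarrow> even (length xs) \<Longrightarrow> p (last (y # xs)) = p y" for y xs
    proof (induction "length xs" arbitrary: xs y rule: less_induct)
      case less
      show ?case
      proof (cases "length xs < 2")
        case True then show ?thesis using less.prems by (cases xs) auto
      next
        case ge: False
        then obtain a b ys where xs: "xs = a # b # ys" by (cases xs; cases "tl xs") auto
        then have "p (last (b # ys)) = p b" using less.prems by (intro less.hyps) auto
        moreover have "p y = p b" using False less.prems xs by auto
        ultimately show ?thesis using xs by simp
      qed
    qed
    obtain y where y: "y \<in> Domain T" using T(2) by auto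
    obtain xs where xs: "length xs = 2 * k - 2" "alternating T (y # xs)" "distinct (y # xs)"
      using alternating_path_exists[OF fin hd y, of "{}" "2 * k - 2"] by auto
    have ev: "even (length xs)" using xs(1) by auto
    have lst: "last (y # xs) \<in> Domain T" using alternating_last[OF xs(2) y] ev by auto
    have setF: "set (y # xs) \<subseteq> Field T" by (rule alternating_set[OF xs(2) y])
    have "(last (y # xs), p y) \<in> R" using p(2)[OF lst] same[OF xs(2) ev] R_symD by metis
    moreover have "p y \<notin> set (y # xs)" using p(1)[OF y] setF far by blast
    moreover have "successively (\<lambda>u v. (u, v) \<in> R) (y # xs)"
      by (rule alternating_successively[OF xs(2) TR sym_R])
    ultimately have "is_cycle R (p y # y # xs)" using p[OF y] xs(3) by (auto simp: is_cycle_def)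
    then show False using no_cycle[of "p y # y # xs"] xs(1) k3 by simp
  qed
qed

definition second_edges :: "'a \<Rightarrow> ('a \<times> 'a) set" where
  "second_edges x = {(u, v) \<in> R. u \<noteq> x \<and> v \<noteq> x \<and> (\<exists>y. (x, y) \<in> R \<and> (y, u) \<in> R)}"

text \<open>
  An edge with an end in the neighbourhood of x is part of a path of length 2 from x; the remaining
  edges form a relation of low degree.
\<close>

lemma card_second_edges:
  assumes "k \<ge> 3" shows "at_most (second_edges x) (card V * (12 * k))"
proof -
  have "second_edges x \<subseteq> two_paths x \<union> (two_paths x)\<inverse> \<union> distant_edges x"
    using R_symD by (auto simp: second_edges_def two_paths_def distant_edges_def)
  moreover have "distant_edges x \<subseteq> V \<times> V" using R_in by (auto simp: distant_edges_def)
  moreover have fin: "finite (distant_edges x)"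
    using \<open>distant_edges x \<subseteq> V \<times> V\<close> finite_V by (auto intro: finite_subset)
  ultimately have "card (second_edges x) \<le> card (two_paths x \<union> (two_paths x)\<inverse> \<union> distant_edges x)"
    using finite_two_paths by (intro card_mono) auto
  also have "\<dots> \<le> card (two_paths x) + card ((two_paths x)\<inverse>) + card (distant_edges x)"
    using card_Un_le[of "two_paths x \<union> (two_paths x)\<inverse>" "distant_edges x"] card_Un_le[of "two_paths x" "(two_paths x)\<inverse>"]
    by linarith
  also have "\<dots> \<le> N + N + N"
    using card_two_paths[of x]
      card_le_low_degree[OF finite_V \<open>distant_edges x \<subseteq> V \<times> V\<close> distant_edges_low_degree[OF assms, where x=x]]
    by (intro add_mono) (simp_all add: card_inverse mult.assoc)
  also have "\<dots> = card V * (12 * k)" by simp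
  finally show ?thesis using finite_subset[OF _ finite_R, of "second_edges x"]
    by (auto simp: second_edges_def)
qed

section \<open>Counting even cycles\<close>

definition cycles :: "nat \<Rightarrow> 'a list set" where
  "cycles t = {xs. is_cycle R xs \<and> length xs = t}"

definition pinned_at :: "'a list \<Rightarrow> nat \<Rightarrow> bool" where
  "pinned_at xs i \<longleftrightarrow> pinned (xs ! (i mod length xs)) (xs ! (Suc i mod length xs)) (xs ! (Suc (Suc i) mod length xs))"

lemma pinned_at_rotate:
  assumes "xs \<noteq> []" shows "pinned_at (rotate r xs) i \<longleftrightarrow> pinned_at xs (r + i)"
proof -
  have "rotate r xs ! (j mod length xs) = xs ! ((r + j) mod length xs)" for j
    using assms by (simp add: nth_rotate mod_add_right_eq)
  from this[of i] this[of "Suc i"] this[of "Suc (Suc i)"] show ?thesis by (simp add: pinned_at_def)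
qed

lemma pinned_at_add_length: "pinned_at xs (i + length xs) \<longleftrightarrow> pinned_at xs i"
proof -
  have "(j + length xs) mod length xs = j mod length xs" for j by simp
  from this[of i] this[of "Suc i"] this[of "Suc (Suc i)"] show ?thesis by (simp add: pinned_at_def)
qed

lemma cycles_nth:
  assumes "xs \<in> cycles t" shows "xs ! (i mod t) \<in> V" "(xs ! (i mod t), xs ! (Suc i mod t)) \<in> R"
proof -
  have xs: "xs \<noteq> []" "length xs = t" "is_cycle R xs"
    using assms by (auto simp: cycles_def is_cycle_def)
  then have "i mod t < t" "Suc (i mod t) mod t = Suc i mod t" by (auto simp: mod_Suc_eq)
  then show *: "(xs ! (i mod t), xs ! (Suc i mod t)) \<in> R"
    using xs(2,3) unfolding is_cycle_iff_nth by metis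
  then show "xs ! (i mod t) \<in> V" using R_in by blast
qed

lemma rotate_cycles: "xs \<in> cycles t \<Longrightarrow> rotate r xs \<in> cycles t"
  by (auto simp: cycles_def is_cycle_rotate)

fun unpinned :: "'a \<Rightarrow> 'a \<Rightarrow> 'a list \<Rightarrow> bool" where
  "unpinned x y [] \<longleftrightarrow> True"
| "unpinned x y (z # zs) \<longleftrightarrow> (y, z) \<in> two_paths x \<and> \<not> pinned x y z \<and> unpinned y z zs"

lemma card_unpinned: "at_most {zs. length zs = l \<and> unpinned x y zs} ((2 * k) ^ l)"
proof (induction l arbitrary: x y)
  case 0
  have "{zs. length zs = 0 \<and> unpinned x y zs} = {[]}" by auto
  then show ?case by simp
next
  case (Suc l)
  let ?Z = "{z. (y, z) \<in> two_paths x \<and> \<not> pinned x y z}"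
  show ?case
    unfolding power_Suc
  proof (rule at_most_UN[OF card_not_pinned])
    show "{zs. length zs = Suc l \<and> unpinned x y zs} \<subseteq> (\<Union>z\<in>?Z. (#) z ` {zs. length zs = l \<and> unpinned y z zs})"
      by (auto simp: length_Suc_conv)
    show "at_most ((#) z ` {zs. length zs = l \<and> unpinned y z zs}) ((2 * k) ^ l)" for z
      by (rule at_most_image[OF Suc.IH])
  qed
qed

lemma unpinned_if_nth:
  "successively (\<lambda>u v. (u, v) \<in> R) (x # y # zs) \<Longrightarrow> distinct (x # y # zs) \<Longrightarrow>
    (\<And>i. i < length zs \<Longrightarrow> \<not> pinned ((x # y # zs) ! i) ((x # y # zs) ! Suc i) ((x # y # zs) ! Suc (Suc i))) \<Longrightarrow>
    unpinned x y zs"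
proof (induction zs arbitrary: x y)
  case (Cons z zs)
  have "unpinned y z zs"
    by (rule Cons.IH) (use Cons.prems(1,2) Cons.prems(3)[of "Suc i" for i] in auto)
  then show ?case using Cons.prems(1,2) Cons.prems(3)[of 0] by (auto simp: two_paths_def)
qed auto

text \<open>
  Without pinned vertices, two consecutive vertices leave few choices for the next one, all the way
  around.
\<close>

lemma card_unpinned_cycles:
  assumes "t \<ge> 2"
  shows "finite {xs \<in> cycles t. \<forall>i. \<not> pinned_at xs i} \<and>
    card {xs \<in> cycles t. \<forall>i. \<not> pinned_at xs i} \<le> card (V \<times> V) * (2 * k) ^ (t - 2)"
proof (rule at_most_UN)
  show "at_most (V \<times> V) (card (V \<times> V))" using finite_V by simp
  show "{xs \<in> cycles t. \<forall>i. \<not> pinned_at xs i} \<subseteq> (\<Union>p\<in>V \<times> V. (\<lambda>zs. fst p # snd p # zs) ` {zs. length zs = t - 2 \<and> unpinned (fst p) (snd p) zs})"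
  proof
    fix xs assume xs: "xs \<in> {xs \<in> cycles t. \<forall>i. \<not> pinned_at xs i}"
    then have len: "length xs = Suc (Suc (t - 2))" using assms by (auto simp: cycles_def)
    then obtain x y zs where eq: "xs = x # y # zs" "length zs = t - 2" by (metis length_Suc_conv)
    have c: "distinct xs" "successively (\<lambda>u v. (u, v) \<in> R) xs" using xs by (auto simp: cycles_def is_cycle_def)
    have "unpinned x y zs"
    proof (rule unpinned_if_nth)
      show "\<not> pinned ((x # y # zs) ! i) ((x # y # zs) ! Suc i) ((x # y # zs) ! Suc (Suc i))" if "i < length zs" for i
      proof -
        have "\<not> pinned_at xs i" using xs by auto
        moreover have "Suc (Suc i) < length xs" using that eq by simp
        ultimately show ?thesis by (simp add: pinned_at_def eq)
      qed
    qed (use c eq in auto)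
    moreover have "(x, y) \<in> V \<times> V" using R_in[of x y] c(2) eq by auto
    ultimately show "xs \<in> (\<Union>p\<in>V \<times> V. (\<lambda>zs. fst p # snd p # zs) ` {zs. length zs = t - 2 \<and> unpinned (fst p) (snd p) zs})"
      using eq by (intro UN_I[of "(x, y)"]) auto
  qed
  show "at_most ((\<lambda>zs. fst p # snd p # zs) ` {zs. length zs = t - 2 \<and> unpinned (fst p) (snd p) zs}) ((2 * k) ^ (t - 2))" for p
    by (rule at_most_image[OF card_unpinned])
qed

text \<open>
  The last vertex of a cycle is chosen when both of its neighbours are known: W maps the end of the path
  to the admissible last vertices.
\<close>

lemma card_closing_paths:
  assumes "\<And>w. at_most (W w) b"
  shows "at_most {ys @ [w] | ys w. ys \<in> paths v (2 * j) \<and> w \<in> W (last (v # ys))} (N ^ j * b)"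
proof (rule at_most_UN[OF card_paths])
  show "{ys @ [w] | ys w. ys \<in> paths v (2 * j) \<and> w \<in> W (last (v # ys))}
    \<subseteq> (\<Union>ys\<in>paths v (2 * j). (\<lambda>w. ys @ [w]) ` W (last (v # ys)))" by auto
qed (rule at_most_image[OF assms])

lemma card_pinned_cycles:
  assumes "s \<ge> 2"
  shows "finite {xs \<in> cycles (2 * s). pinned_at xs (2 * s - 2)} \<and>
    card {xs \<in> cycles (2 * s). pinned_at xs (2 * s - 2)} \<le> card V * (N ^ (s - 1) * (4 * k))"
proof (rule at_most_UN[OF at_most_V])
  let ?A = "\<lambda>x. {ys @ [w] | ys w. ys \<in> paths x (2 * (s - 1)) \<and> w \<in> {w. pinned (last (x # ys)) w x}}"
  show "{xs \<in> cycles (2 * s). pinned_at xs (2 * s - 2)} \<subseteq> (\<Union>x\<in>V. (#) x ` ?A x)"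
  proof
    fix xs assume xs: "xs \<in> {xs \<in> cycles (2 * s). pinned_at xs (2 * s - 2)}"
    then have len: "length xs = Suc (Suc (2 * (s - 1)))" using assms by (auto simp: cycles_def)
    then obtain x zs where 1: "xs = x # zs" "length zs = Suc (2 * (s - 1))" by (metis length_Suc_conv)
    then obtain ys w where 2: "zs = ys @ [w]" "length ys = 2 * (s - 1)" by (metis length_Suc_conv_rev)
    note eq = 1(1)[unfolded 2(1)]
    have c: "distinct xs" "successively (\<lambda>u v. (u, v) \<in> R) xs" using xs by (auto simp: cycles_def is_cycle_def)
    have "successively (\<lambda>u v. (u, v) \<in> R) ((x # ys) @ [w])" using c(2) eq by simp
    then have p: "ys \<in> paths x (2 * (s - 1))"
      using c(1) eq 2 by (auto simp: paths_def successively_append_iff simp del: append_Cons)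
    have ne: "ys \<noteq> []" using 2 assms by auto
    have i1: "(2 * s - 2) mod length xs = length ys" "Suc (2 * s - 2) mod length xs = Suc (length ys)"
      "Suc (Suc (2 * s - 2)) mod length xs = 0" using len 2 assms by (auto simp: mod_Suc)
    have "pinned (xs ! length ys) (xs ! Suc (length ys)) (xs ! 0)"
      using xs by (simp add: pinned_at_def i1)
    then have "pinned (last (x # ys)) w x" using ne
      by (auto simp: eq nth_append last_conv_nth nth_Cons')
    then have "zs \<in> ?A x" using p 2(1) by blast
    moreover have "x \<in> V" using cycles_nth(1)[of xs "2 * s" 0] xs eq by simp
    ultimately show "xs \<in> (\<Union>x\<in>V. (#) x ` ?A x)" using 1(1) by blast
  qed
  show "at_most ((#) x ` ?A x) (N ^ (s - 1) * (4 * k))" for x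
    by (rule at_most_image[OF card_closing_paths[OF card_pinned]])
qed

text \<open>
  Either no vertex is pinned, or a rotation moves a pinned vertex to the end.
\<close>

lemma card_even_cycles:
  assumes "s \<ge> 2"
  shows "at_most (cycles (2 * s)) (card V ^ 2 * (2 * k) ^ (2 * s - 2)
     + Suc (2 * s) * (card V * (N ^ (s - 1) * (4 * k))))"
proof -
  let ?N = "{xs \<in> cycles (2 * s). \<forall>i. \<not> pinned_at xs i}"
  let ?M = "{xs \<in> cycles (2 * s). pinned_at xs (2 * s - 2)}"
  have M: "at_most (cycles (2 * s) - ?N) (Suc (2 * s) * card ?M)"
  proof (rule card_le_rotations)
    show "finite ?M" using card_pinned_cycles[OF assms] by blast
    fix xs assume xs: "xs \<in> cycles (2 * s) - ?N"
    then obtain i where i: "pinned_at xs i" by auto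
    have len: "length xs = 2 * s" "xs \<noteq> []" using xs assms by (auto simp: cycles_def)
    have "i + 2 + (2 * s - 2) = i + length xs" using len assms by simp
    then have "pinned_at (rotate (i + 2) xs) (2 * s - 2) \<longleftrightarrow> pinned_at xs (i + length xs)"
      using pinned_at_rotate[OF len(2), of "i + 2" "2 * s - 2"] by metis
    then have "rotate (i + 2) xs \<in> ?M"
      using i xs rotate_cycles[of xs "2 * s" "i + 2"] by (simp only: pinned_at_add_length) simp
    then show "length xs = 2 * s \<and> (\<exists>r. rotate r xs \<in> ?M)" using len by blast
  qed
  have N: "at_most ?N (card (V \<times> V) * (2 * k) ^ (2 * s - 2))"
    using assms by (intro card_unpinned_cycles) simp
  have eq: "cycles (2 * s) = ?N \<union> (cycles (2 * s) - ?N)" by auto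
  have "card (cycles (2 * s)) \<le> card ?N + card (cycles (2 * s) - ?N)"
    by (subst eq) (rule card_Un_le)
  also have "\<dots> \<le> card (V \<times> V) * (2 * k) ^ (2 * s - 2) + Suc (2 * s) * (card V * (N ^ (s - 1) * (4 * k)))"
  proof (rule add_mono)
    show "card ?N \<le> card (V \<times> V) * (2 * k) ^ (2 * s - 2)" using N by blast
    have "Suc (2 * s) * card ?M \<le> Suc (2 * s) * (card V * (N ^ (s - 1) * (4 * k)))"
      by (rule mult_le_mono2) (use card_pinned_cycles[OF assms] in blast)
    then show "card (cycles (2 * s) - ?N) \<le> Suc (2 * s) * (card V * (N ^ (s - 1) * (4 * k)))"
      using M by (meson le_trans)
  qed
  finally have "card (cycles (2 * s)) \<le> card V ^ 2 * (2 * k) ^ (2 * s - 2)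
     + Suc (2 * s) * (card V * (N ^ (s - 1) * (4 * k)))"
    by (simp add: card_cartesian_product power2_eq_square)
  moreover have "finite (cycles (2 * s))" by (subst eq) (use M N in blast)
  ultimately show ?thesis by blast
qed

section \<open>Counting odd cycles for k at least 3\<close>

text \<open>
  With x first, the vertices in positions 1 and t - 1 are pinned. The edge in positions 2 and 3 costs
  O(n), position 1 is free, pairs follow up to position t - 2, and the last vertex is free.
\<close>

lemma card_pinned_pinned_cycles:
  assumes "s \<ge> 2" "k \<ge> 3"
  defines "t \<equiv> 2 * s + 1"
  defines "S \<equiv> {xs \<in> cycles t. pinned_at xs 0 \<and> pinned_at xs (t - 2)}"
  shows "at_most S (card V * (card V * (12 * k) * (4 * k * (N ^ (s - 2) * (4 * k)))))"
proof (rule at_most_UN[OF at_most_V])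
  define A where "A x v = {ys @ [w] | ys w. ys \<in> paths v (2 * (s - 2)) \<and> w \<in> {w. pinned (last (v # ys)) w x}}" for x v
  define B where "B x p = (\<Union>y\<in>{y. pinned x y (fst p)}. (\<lambda>zs. x # y # fst p # snd p # zs) ` A x (snd p))" for x p
  have A: "at_most (A x v) (N ^ (s - 2) * (4 * k))" for x v
    unfolding A_def by (rule card_closing_paths) (rule card_pinned)
  have B: "at_most (B x p) (4 * k * (N ^ (s - 2) * (4 * k)))" for x p
    unfolding B_def by (rule at_most_UN[OF card_pinned order_refl]) (rule at_most_image[OF A])
  show "at_most (\<Union>p\<in>second_edges x. B x p) (card V * (12 * k) * (4 * k * (N ^ (s - 2) * (4 * k))))" for x
    by (rule at_most_UN[OF card_second_edges[OF assms(2)] order_refl]) (rule B)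
  show "S \<subseteq> (\<Union>x\<in>V. \<Union>p\<in>second_edges x. B x p)"
  proof
    fix xs assume xs: "xs \<in> S"
    then have len: "length xs = Suc (Suc (Suc (Suc (Suc (2 * (s - 2))))))"
      using assms(1) by (auto simp: S_def t_def cycles_def)
    then obtain x y u v zs where 1: "xs = x # y # u # v # zs" "length zs = Suc (2 * (s - 2))"
      by (auto simp: length_Suc_conv)
    then obtain ys w where 2: "zs = ys @ [w]" "length ys = 2 * (s - 2)" by (metis length_Suc_conv_rev)
    have c: "distinct xs" "successively (\<lambda>u v. (u, v) \<in> R) xs"
      using xs by (auto simp: S_def cycles_def is_cycle_def)
    have "successively (\<lambda>u v. (u, v) \<in> R) ((x # y # u # v # ys) @ [w])" using c(2) 1 2 by simp
    then have sv: "successively (\<lambda>u v. (u, v) \<in> R) (x # y # u # v # ys)"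
      by (simp only: successively_append_iff)
    then have p: "ys \<in> paths v (2 * (s - 2))" using c(1) 1 2 by (auto simp: paths_def)
    have e: "(u, v) \<in> second_edges x" using sv c(1) 1 by (auto simp: second_edges_def)
    have lt: "length xs = t" using len assms(1) by (simp add: t_def)
    have "pinned_at xs 0" "pinned_at xs (t - 2)" using xs by (auto simp: S_def)
    moreover have i1: "(t - 2) mod length xs = Suc (Suc (Suc (length ys)))" "Suc (t - 2) mod length xs = Suc (Suc (Suc (Suc (length ys))))"
      "Suc (Suc (t - 2)) mod length xs = 0" using len lt 2 assms(1) by auto
    moreover have "xs ! Suc (Suc (Suc (length ys))) = last (v # ys)" "xs ! Suc (Suc (Suc (Suc (length ys)))) = w"
      by (cases ys rule: rev_cases; simp add: 1 2 nth_append)+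
    ultimately have "pinned x y u" "pinned (last (v # ys)) w x"
      by (auto simp: pinned_at_def 1)
    then have "zs \<in> A x v" using p 2(1) by (auto simp: A_def)
    then have "xs \<in> B x (u, v)" using \<open>pinned x y u\<close> 1(1) by (auto simp: B_def)
    moreover have "x \<in> V" using cycles_nth(1)[of xs t 0] xs 1 by (simp add: S_def)
    ultimately show "xs \<in> (\<Union>x\<in>V. \<Union>p\<in>second_edges x. B x p)" using e by blast
  qed
qed

text \<open>
  A path of length 2 in positions 1, 2, 3 costs n times O(n). Positions 0 and 4 are then free, because
  the vertices in positions 1 and 3 are not pinned, and the rest is covered by pairs.
\<close>

lemma card_not_pinned_not_pinned_cycles:
  assumes "s \<ge> 2"
  defines "t \<equiv> 2 * s + 1"
  defines "S \<equiv> {xs \<in> cycles t. \<not> pinned_at xs 0 \<and> \<not> pinned_at xs 2}"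
  shows "at_most S (card V * (N * (2 * k * (2 * k * N ^ (s - 2)))))"
proof (rule at_most_UN[OF at_most_V])
  define A where "A u v x a = (\<Union>b\<in>{b. (v, b) \<in> two_paths u \<and> \<not> pinned u v b}.
      (\<lambda>ys. a # x # u # v # b # ys) ` paths b (2 * (s - 2)))" for u v x a
  define B where "B x p = (\<Union>a\<in>{a. (x, a) \<in> two_paths (fst p) \<and> \<not> pinned (fst p) x a}. A (fst p) (snd p) x a)" for x p
  have A: "at_most (A u v x a) (2 * k * N ^ (s - 2))" for u v x a
    unfolding A_def by (rule at_most_UN[OF card_not_pinned order_refl]) (rule at_most_image[OF card_paths])
  have B: "at_most (B x p) (2 * k * (2 * k * N ^ (s - 2)))" for x p
    unfolding B_def by (rule at_most_UN[OF card_not_pinned order_refl]) (rule A)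
  show "at_most (\<Union>p\<in>two_paths x. B x p) (N * (2 * k * (2 * k * N ^ (s - 2))))" for x
    by (rule at_most_UN[OF card_two_paths order_refl]) (rule B)
  show "S \<subseteq> (\<Union>x\<in>V. \<Union>p\<in>two_paths x. B x p)"
  proof
    fix xs assume xs: "xs \<in> S"
    then have len: "length xs = Suc (Suc (Suc (Suc (Suc (2 * (s - 2))))))"
      using assms(1) by (auto simp: S_def t_def cycles_def)
    then obtain a x u v b ys where 1: "xs = a # x # u # v # b # ys" "length ys = 2 * (s - 2)"
      by (auto simp: length_Suc_conv)
    have c: "distinct xs" "successively (\<lambda>u v. (u, v) \<in> R) xs"
      using xs by (auto simp: S_def cycles_def is_cycle_def)
    then have p: "ys \<in> paths b (2 * (s - 2))" using 1 by (auto simp: paths_def)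
    have "\<not> pinned_at xs 0" "\<not> pinned_at xs 2" using xs by (auto simp: S_def)
    moreover have "2 mod length xs = Suc (Suc 0)" "Suc 2 mod length xs = Suc (Suc (Suc 0))"
      "Suc (Suc 2) mod length xs = Suc (Suc (Suc (Suc 0)))" unfolding len by simp_all
    moreover have "0 mod length xs = 0" "Suc 0 mod length xs = Suc 0" "Suc (Suc 0) mod length xs = Suc (Suc 0)"
      unfolding len by simp_all
    ultimately have "\<not> pinned a x u" "\<not> pinned u v b"
      unfolding pinned_at_def by (simp_all add: 1(1))
    then have "xs \<in> A u v x a" "(x, a) \<in> two_paths u" "\<not> pinned u x a" "(u, v) \<in> two_paths x"
      using p 1 c R_symD by (auto simp: A_def two_paths_def pinned_sym)
    then have "xs \<in> B x (u, v)" by (auto simp: B_def)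
    moreover have "x \<in> V" using R_in[of a x] c 1 by simp
    ultimately show "xs \<in> (\<Union>x\<in>V. \<Union>p\<in>two_paths x. B x p)" using \<open>(u, v) \<in> two_paths x\<close> by blast
  qed
qed

text \<open>
  If pinned and unpinned vertices alternated along steps of length 2, then twice around the cycle, an odd number
  of such steps, would lead back to the start with the opposite value.
\<close>

lemma odd_cycle_repeats:
  assumes "odd (length xs)"
  shows "\<exists>i. pinned_at xs i \<longleftrightarrow> pinned_at xs (i + 2)"
proof (rule ccontr)
  assume neg: "\<not> ?thesis"
  have "pinned_at xs (2 * j) \<longleftrightarrow> (pinned_at xs 0 \<longleftrightarrow> even j)" for j
  proof (induction j)
    case (Suc j)
    have "pinned_at xs (2 * Suc j) \<longleftrightarrow> \<not> pinned_at xs (2 * j)"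
      using neg by (metis add.commute mult_Suc_right)
    then show ?case using Suc.IH by simp
  qed simp
  from this[of "length xs"] have "pinned_at xs (0 + length xs + length xs) \<longleftrightarrow> \<not> pinned_at xs 0"
    using assms by (simp add: mult_2)
  then show False unfolding pinned_at_add_length by blast
qed

lemma card_odd_cycles:
  assumes s: "s \<ge> 2" and k: "k \<ge> 3"
  shows "at_most (cycles (2 * s + 1)) (Suc (2 * s + 1) *
    (card V * (card V * (12 * k) * (4 * k * (N ^ (s - 2) * (4 * k)))) +
     card V * (N * (2 * k * (2 * k * N ^ (s - 2))))))"
proof -
  define t where "t = 2 * s + 1"
  let ?M = "{xs \<in> cycles t. pinned_at xs 0 \<and> pinned_at xs (t - 2)}"
  let ?N = "{xs \<in> cycles t. \<not> pinned_at xs 0 \<and> \<not> pinned_at xs 2}"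
  note M = card_pinned_pinned_cycles[OF s k, folded t_def]
  note N = card_not_pinned_not_pinned_cycles[OF s, folded t_def]
  have *: "at_most (cycles t) (Suc t * card (?M \<union> ?N))"
  proof (rule card_le_rotations)
    show "finite (?M \<union> ?N)" using M N by blast
    fix xs assume xs: "xs \<in> cycles t"
    have len: "length xs = t" "xs \<noteq> []" using xs by (auto simp: cycles_def t_def)
    then obtain i where i: "pinned_at xs i \<longleftrightarrow> pinned_at xs (i + 2)"
      using odd_cycle_repeats[of xs] by (auto simp: t_def)
    have "\<exists>r. rotate r xs \<in> ?M \<union> ?N"
    proof (cases "pinned_at xs i")
      case True
      have "i + 2 + (t - 2) = i + length xs" using len s by (simp add: t_def)
      then have "pinned_at (rotate (i + 2) xs) (t - 2)"
        using pinned_at_rotate[OF len(2), of "i + 2" "t - 2"] True pinned_at_add_length by metis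
      moreover have "pinned_at (rotate (i + 2) xs) 0"
        using pinned_at_rotate[OF len(2), of "i + 2" 0] True i by simp
      ultimately show ?thesis using rotate_cycles[OF xs] by blast
    next
      case False
      then have "\<not> pinned_at (rotate i xs) 0" "\<not> pinned_at (rotate i xs) 2"
        using i pinned_at_rotate[OF len(2)] by auto
      then show ?thesis using rotate_cycles[OF xs] by blast
    qed
    then show "length xs = t \<and> (\<exists>r. rotate r xs \<in> ?M \<union> ?N)" using len by blast
  qed
  have "card (?M \<union> ?N) \<le> card ?M + card ?N" by (rule card_Un_le)
  also have "\<dots> \<le> card V * (card V * (12 * k) * (4 * k * (N ^ (s - 2) * (4 * k)))) +
     card V * (N * (2 * k * (2 * k * N ^ (s - 2))))"
    by (rule add_mono[OF conjunct2[OF M] conjunct2[OF N]])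
  finally have "Suc t * card (?M \<union> ?N) \<le> Suc t *
    (card V * (card V * (12 * k) * (4 * k * (N ^ (s - 2) * (4 * k)))) +
     card V * (N * (2 * k * (2 * k * N ^ (s - 2)))))"
    by (rule mult_le_mono2)
  from conjI[OF conjunct1[OF *] le_trans[OF conjunct2[OF *] this]] show ?thesis
    unfolding t_def .
qed

section \<open>Counting odd cycles in graphs without 4-cycles\<close>

text \<open>
  Cauchy-Schwarz for the degrees: the sum of their squares counts the paths of length 2, including those
  that return to their start.
\<close>

lemma card_R_square: "card R ^ 2 \<le> card V * (card V * (N + card V))"
proof -
  define W where "W = {(y, x, z). (y, x) \<in> R \<and> (y, z) \<in> R}"
  let ?A = "\<lambda>x. (\<lambda>p. (fst p, x, snd p)) ` (two_paths x \<union> (R `` {x}) \<times> {x})"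
  have finRx: "finite (R `` {x})" for x using finite_R by auto
  have cRx: "card (R `` {x}) \<le> card V" for x by (rule card_mono[OF finite_V]) (use R_in in auto)
  have W: "at_most W (card V * (N + card V))"
  proof (rule at_most_UN[OF at_most_V])
    show "W \<subseteq> (\<Union>x\<in>V. ?A x)"
    proof
      fix w assume "w \<in> W"
      then obtain y x z where w: "w = (y, x, z)" "(y, x) \<in> R" "(y, z) \<in> R" by (auto simp: W_def)
      then have "(y, z) \<in> two_paths x \<union> (R `` {x}) \<times> {x}" "x \<in> V"
        using R_symD R_in by (auto simp: two_paths_def)
      then show "w \<in> (\<Union>x\<in>V. ?A x)" using w by force
    qed
    fix x
    have "card (two_paths x \<union> (R `` {x}) \<times> {x}) \<le> card (two_paths x) + card ((R `` {x}) \<times> {x})"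
      by (rule card_Un_le)
    also have "\<dots> \<le> N + card V"
      using card_two_paths[of x] cRx by (simp add: card_cartesian_product add_mono)
    finally show "at_most (?A x) (N + card V)"
      using finite_two_paths finRx by (intro at_most_image) auto
  qed
  have R: "R = Sigma V (\<lambda>y. R `` {y})" using R_in by auto
  have cR: "card R = (\<Sum>y\<in>V. card (R `` {y}))"
    by (subst R) (simp add: card_SigmaI finite_V finRx)
  have cW: "card W = (\<Sum>y\<in>V. card (R `` {y}) ^ 2)"
  proof -
    have "W = Sigma V (\<lambda>y. R `` {y} \<times> R `` {y})" using R_in by (auto simp: W_def)
    then show ?thesis by (simp add: card_SigmaI finite_V finRx card_cartesian_product power2_eq_square)
  qed
  have "real (card R ^ 2) \<le> real (card V * card W)"
    unfolding cR cW of_nat_mult of_nat_power of_nat_sum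
    using sum_squared_le_sum_of_squares[of "\<lambda>y. real (card (R `` {y}))" V] by (simp only: mult.commute)
  then have "card R ^ 2 \<le> card V * card W" by (simp only: of_nat_le_iff)
  also have "\<dots> \<le> card V * (card V * (N + card V))" using W by (intro mult_le_mono2) blast
  finally show ?thesis .
qed

text \<open>
  One edge, pairs up to the last but one vertex, and a last vertex that is unique because two vertices
  without a 4-cycle have at most one common neighbour.
\<close>

lemma card_odd_cycles_no_C4:
  assumes k: "k = 2" and s: "s \<ge> 1"
  shows "at_most (cycles (2 * s + 1)) (card R * (card V * 8) ^ (s - 1))"
proof (rule at_most_UN[OF conjI[OF finite_R order_refl]])
  let ?W = "\<lambda>x u. {w. (u, w) \<in> R \<and> (w, x) \<in> R \<and> u \<noteq> x}"
  let ?A = "\<lambda>p. {ys @ [w] | ys w. ys \<in> paths (snd p) (2 * (s - 1)) \<and> w \<in> ?W (fst p) (last (snd p # ys))}"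
  have W: "at_most (?W x u) 1" for x u
  proof -
    have fin: "finite (?W x u)" by (rule finite_subset[OF _ finite_V]) (use R_in in auto)
    have "w = w'" if "w \<in> ?W x u" "w' \<in> ?W x u" for w w'
    proof (rule ccontr)
      assume "w \<noteq> w'"
      then have "is_cycle R [u, w, x, w']"
        using that R_symD R_neq[of u w] R_neq[of u w'] R_neq[of w x] R_neq[of w' x]
        by (auto simp: is_cycle_def)
      then show False using no_cycle[of "[u, w, x, w']"] k by simp
    qed
    then show ?thesis using fin by (auto simp: card_le_Suc0_iff_eq)
  qed
  show "cycles (2 * s + 1) \<subseteq> (\<Union>p\<in>R. (\<lambda>zs. fst p # snd p # zs) ` ?A p)"
  proof
    fix xs assume xs: "xs \<in> cycles (2 * s + 1)"
    then have "length xs = Suc (Suc (Suc (2 * (s - 1))))" using s by (auto simp: cycles_def)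
    then obtain x y zs where 1: "xs = x # y # zs" "length zs = Suc (2 * (s - 1))" by (metis length_Suc_conv)
    then obtain ys w where 2: "zs = ys @ [w]" "length ys = 2 * (s - 1)" by (metis length_Suc_conv_rev)
    have c: "distinct xs" "successively (\<lambda>u v. (u, v) \<in> R) xs" "(last xs, hd xs) \<in> R"
      using xs by (auto simp: cycles_def is_cycle_def)
    have sv: "successively (\<lambda>u v. (u, v) \<in> R) ((x # y # ys) @ [w])" using c(2) 1 2 by simp
    then have p: "ys \<in> paths y (2 * (s - 1))"
      using c(1) 1 2 by (auto simp: paths_def successively_append_iff simp del: append_Cons)
    have "last (y # ys) \<noteq> x" using c(1) 1 2 by auto
    then have "w \<in> ?W x (last (y # ys))"
      using sv c(3) 1 2 by (auto simp: successively_append_iff simp del: append_Cons)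
    then have "zs \<in> ?A (x, y)" using p 2(1) unfolding fst_conv snd_conv by blast
    moreover have "(x, y) \<in> R" using c 1 by simp
    ultimately show "xs \<in> (\<Union>p\<in>R. (\<lambda>zs. fst p # snd p # zs) ` ?A p)"
      using 1(1) by (intro UN_I[of "(x, y)"]) auto
  qed
  fix p
  have "at_most (?A p) (N ^ (s - 1) * 1)"
    by (rule card_closing_paths) (rule W)
  then show "at_most ((\<lambda>zs. fst p # snd p # zs) ` ?A p) ((card V * 8) ^ (s - 1))"
    using k by (intro at_most_image) auto
qed

end

section \<open>Upper bounds for the game\<close>

abbreviation cycle_game :: "nat \<Rightarrow> nat \<Rightarrow> nat \<Rightarrow> nat" where
  "cycle_game n t l \<equiv> game_number n (cycle_graph t) (cycle_graph l)"

lemma even_cycle_free_adjacency: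
  assumes "k \<ge> 2" "C \<subseteq> [V]\<^bsup>2\<^esup>" "finite V" "free_of (cycle_graph (2 * k)) (V, C)"
  shows "even_cycle_free V {(u, v). {u, v} \<in> C} k"
proof
  show "{(u, v). {u, v} \<in> C} \<subseteq> V \<times> V" "irrefl {(u, v). {u, v} \<in> C}"
    using assms(2) by (auto simp: irrefl_def nsets_def)
  show "sym {(u, v). {u, v} \<in> C}" by (auto simp: sym_def insert_commute)
  fix xs assume xs: "is_cycle {(u, v). {u, v} \<in> C} xs"
  show "length xs \<noteq> 2 * k"
  proof
    assume len: "length xs = 2 * k"
    have "cyc C (2 * k) ((!) xs)"
      using xs by (auto simp: cyc_def is_cycle_iff_nth len inj_on_nth)
    then show False using assms(1,2,4) free_of_cycle_iff[of "2 * k" C V] by auto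
  qed
qed (use assms in auto)

lemma card_copies_le_cycles:
  assumes "even_cycle_free V {(u, v). {u, v} \<in> C} k" "C \<subseteq> [V]\<^bsup>2\<^esup>" "t \<ge> 3"
    and "finite (even_cycle_free.cycles {(u, v). {u, v} \<in> C} t)"
  shows "card (copies (cycle_graph t) (V, C)) \<le> card (even_cycle_free.cycles {(u, v). {u, v} \<in> C} t)"
proof -
  note defn = even_cycle_free.cycles_def[OF assms(1)]
  have "copies (cycle_graph t) (V, C) \<subseteq> (\<lambda>xs. cycle_copy t ((!) xs)) ` even_cycle_free.cycles {(u, v). {u, v} \<in> C} t"
  proof
    fix S assume "S \<in> copies (cycle_graph t) (V, C)"
    then obtain g where g: "S = cycle_copy t g" "cyc C t g"
      unfolding copies_cycle_graph[OF assms(3,2)] by auto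
    let ?xs = "map g [0..<t]"
    have "cycle_edges t ((!) ?xs) = cycle_edges t g"
      unfolding cycle_edges_def using assms(3) by (intro image_cong) auto
    moreover have "(!) ?xs ` {..<t} = g ` {..<t}" by (intro image_cong) auto
    ultimately have "S = cycle_copy t ((!) ?xs)" by (simp add: g cycle_copy_def)
    moreover have "is_cycle {(u, v). {u, v} \<in> C} ?xs"
      using g(2) assms(3) by (auto simp: is_cycle_iff_nth cyc_def distinct_map atLeast0LessThan)
    ultimately show "S \<in> (\<lambda>xs. cycle_copy t ((!) xs)) ` even_cycle_free.cycles {(u, v). {u, v} \<in> C} t"
      by (auto simp: defn)
  qed
  then show ?thesis using assms(4) by (meson card_image_le card_mono finite_imageI le_trans)
qed

lemma game_number_le:
  assumes "k \<ge> 2" "t \<ge> 3"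
    and "\<And>R. even_cycle_free {..<n} R k \<Longrightarrow>
      at_most (even_cycle_free.cycles R t) u"
  shows "cycle_game n t (2 * k) \<le> u"
  unfolding game_number_def
proof (rule game_value_le)
  show "free_of (cycle_graph (2 * k)) ({..<n}, {})"
  proof -
    have "\<not> cyc {} (2 * k) g" for g :: "nat \<Rightarrow> nat" using assms(1) by (auto simp: cyc_def intro!: exI[of _ 0])
    then show ?thesis using assms(1) by (subst free_of_cycle_iff) auto
  qed
  fix C :: "nat set set" assume C: "C \<subseteq> board n" "free_of (cycle_graph (2 * k)) ({..<n}, C)"
  let ?R = "{(u, v). {u, v} \<in> C}"
  have R: "even_cycle_free {..<n} ?R k" by (rule even_cycle_free_adjacency[OF assms(1) C(1) _ C(2)]) simp
  show "card (copies (cycle_graph t) ({..<n}, C)) \<le> u"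
    using card_copies_le_cycles[OF R C(1) assms(2)] assms(3)[OF R] le_trans by blast
qed simp

lemma game_number_upper_even:
  assumes "k \<ge> 2" "s \<ge> 2"
  shows "\<exists>K. \<forall>n\<ge>1. cycle_game n (2 * s) (2 * k) \<le> K * n ^ s"
proof (intro exI allI impI)
  fix n :: nat assume n: "n \<ge> 1"
  let ?u = "n ^ 2 * (2 * k) ^ (2 * s - 2) + Suc (2 * s) * (n * ((n * (4 * k)) ^ (s - 1) * (4 * k)))"
  have "cycle_game n (2 * s) (2 * k) \<le> ?u"
    using assms even_cycle_free.card_even_cycles[of "{..<n}" _ k s] by (intro game_number_le) auto
  also have "\<dots> \<le> n ^ s * (2 * k) ^ (2 * s - 2) + Suc (2 * s) * (n * ((n * (4 * k)) ^ (s - 1) * (4 * k)))"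
    using n assms by (intro add_mono mult_mono power_increasing) auto
  also have "n * ((n * (4 * k)) ^ (s - 1) * (4 * k)) = n ^ s * (4 * k) ^ s"
  proof -
    have "s = Suc (s - 1)" using assms by simp
    then obtain r where "s = Suc r" by blast
    then show ?thesis by (simp add: power_mult_distrib)
  qed
  finally show "cycle_game n (2 * s) (2 * k) \<le> ((2 * k) ^ (2 * s - 2) + Suc (2 * s) * (4 * k) ^ s) * n ^ s"
    by (simp add: algebra_simps)
qed

lemma game_number_upper_odd:
  assumes "k \<ge> 3" "s \<ge> 2"
  shows "\<exists>K. \<forall>n\<ge>1. cycle_game n (2 * s + 1) (2 * k) \<le> K * n ^ s"
proof (intro exI allI impI)
  fix n :: nat assume n: "n \<ge> 1"
  let ?u = "Suc (2 * s + 1) *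
    (n * (n * (12 * k) * (4 * k * ((n * (4 * k)) ^ (s - 2) * (4 * k)))) +
     n * (n * (4 * k) * (2 * k * (2 * k * (n * (4 * k)) ^ (s - 2)))))"
  have "cycle_game n (2 * s + 1) (2 * k) \<le> ?u"
    using assms even_cycle_free.card_odd_cycles[of "{..<n}" _ k s] by (intro game_number_le) auto
  also have "\<dots> = (Suc (2 * s + 1) * (12 * k * (4 * k) * (4 * k) * (4 * k) ^ (s - 2) + 4 * k * (2 * k) * (2 * k) * (4 * k) ^ (s - 2))) * (n * n * n ^ (s - 2))"
  proof -
    have "n * (n * (12 * k) * (4 * k * ((N * Q) * (4 * k)))) = 12 * k * (4 * k) * (4 * k) * Q * (n * n * N)"
      "n * (n * (4 * k) * (2 * k * (2 * k * (N * Q)))) = 4 * k * (2 * k) * (2 * k) * Q * (n * n * N)" for N Q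
      by (simp_all only: mult_ac)
    then show ?thesis
      unfolding power_mult_distrib[of n "4 * k" "s - 2"] by (simp only: distrib_right mult.assoc)
  qed
  also have "n * n * n ^ (s - 2) = n ^ s"
  proof -
    obtain r where "s = Suc (Suc r)" using assms by (metis add_2_eq_Suc le_Suc_ex)
    then show ?thesis by simp
  qed
  finally show "cycle_game n (2 * s + 1) (2 * k) \<le> (Suc (2 * s + 1) * (12 * k * (4 * k) * (4 * k) * (4 * k) ^ (s - 2) + 4 * k * (2 * k) * (2 * k) * (4 * k) ^ (s - 2))) * n ^ s" .
qed

lemma game_number_upper_odd_C4:
  assumes "s \<ge> 1"
  shows "\<exists>K. \<forall>n\<ge>1. real (cycle_game n (2 * s + 1) 4) \<le> K * real n powr (real (2 * s + 1) / 2)"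
proof (intro exI allI impI)
  fix n :: nat assume n: "n \<ge> 1"
  define u where "u = nat \<lfloor>3 * real n powr (3/2)\<rfloor> * (n * 8) ^ (s - 1)"
  have "cycle_game n (2 * s + 1) (2 * 2) \<le> u"
  proof (rule game_number_le)
    fix R assume R: "even_cycle_free {..<n} R 2"
    have "card R ^ 2 \<le> 9 * n ^ 3"
    proof -
      have "card R ^ 2 \<le> n * (n * (n * (4 * 2) + n))"
        using even_cycle_free.card_R_square[OF R] unfolding card_lessThan .
      also have "n * (4 * 2) + n = 9 * n" by simp
      also have "n * (n * (9 * n)) = 9 * n ^ 3" by (simp only: power3_eq_cube mult_ac)
      finally show ?thesis .
    qed
    then have "real (card R ^ 2) \<le> real (9 * n ^ 3)" by (simp only: of_nat_le_iff)
    also have "\<dots> = (3 * real n powr (3/2)) ^ 2"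
    proof -
      have "(real n powr (3/2)) ^ 2 = real n powr real 3" using n by (simp add: powr_power)
      also have "\<dots> = real n ^ 3" using n by (subst powr_realpow) auto
      finally show ?thesis by (simp add: power_mult_distrib)
    qed
    finally have "real (card R) \<le> 3 * real n powr (3/2)"
      unfolding of_nat_power by (rule power2_le_imp_le) simp
    then have "card R \<le> nat \<lfloor>3 * real n powr (3/2)\<rfloor>" by linarith
    then have "card R * (n * 8) ^ (s - 1) \<le> u" unfolding u_def by (rule mult_le_mono1)
    then show "at_most (even_cycle_free.cycles R (2 * s + 1)) u"
      using even_cycle_free.card_odd_cycles_no_C4[OF R refl assms] by (simp only: card_lessThan) (meson le_trans)
  qed (use assms in auto)
  then have "real (cycle_game n (2 * s + 1) 4) \<le> real u" by simp
  also have "\<dots> \<le> (3 * real n powr (3/2)) * (real n * 8) ^ (s - 1)"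
    unfolding u_def of_nat_mult of_nat_power of_nat_numeral by (intro mult_right_mono) auto
  also have "\<dots> = 3 * 8 ^ (s - 1) * (real n powr (3/2) * real n powr (real (s - 1)))"
  proof -
    have "real n powr (real (s - 1)) = real n ^ (s - 1)" using n by (subst powr_realpow) auto
    then show ?thesis by (simp add: power_mult_distrib)
  qed
  also have "real n powr (3/2) * real n powr (real (s - 1)) = real n powr (real (2 * s + 1) / 2)"
  proof -
    have "3/2 + real (s - 1) = real (2 * s + 1) / 2"
      using assms by (cases s) (simp_all add: add_divide_distrib)
    then show ?thesis by (simp only: powr_add[symmetric])
  qed
  finally show "real (cycle_game n (2 * s + 1) 4) \<le> 3 * 8 ^ (s - 1) * real n powr (real (2 * s + 1) / 2)" .
qed

section \<open>Finite fields of characteristic 2\<close>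

text \<open>
  The two-element field is realised by the type \<open>bit\<close>; its algebraic closure contains a
  field of every order 2^m.
\<close>

lemma char_2: "(x :: bit alg_closure) + x = 0"
proof -
  have "to_ac (1 + 1 :: bit) = 0" by (simp del: to_ac_add)
  then have "(1 :: bit alg_closure) + 1 = 0" by (simp only: to_ac_add to_ac_1)
  then show ?thesis by (metis distrib_left mult.right_neutral mult_zero_right)
qed

lemma frobenius: "((x :: bit alg_closure) + y) ^ (2 ^ m) = x ^ (2 ^ m) + y ^ (2 ^ m)"
proof (induction m)
  case (Suc m)
  have sq: "(u + v)\<^sup>2 = u\<^sup>2 + v\<^sup>2" for u v :: "bit alg_closure"
    using char_2[of "u * v"] by (simp add: power2_sum mult.assoc)
  have pw: "z ^ 2 ^ Suc m = (z ^ 2 ^ m)\<^sup>2" for z :: "bit alg_closure"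
    by (simp only: power_Suc2 power_mult)
  show ?case unfolding pw Suc sq ..
qed simp

text \<open>
  The field consists of the roots of p = X^q + X for q = 2^m. The derivative of p is 1, so all q roots
  are simple, and they are closed under addition by the Frobenius identity. Powers of 2 suffice as orders
  because only the order of magnitude of q matters.
\<close>

lemma exists_field_of_order_power_2:
  assumes "m \<ge> 1"
  shows "\<exists>K :: bit alg_closure set. finite K \<and> card K = 2 ^ m \<and> 0 \<in> K \<and>
    (\<forall>x\<in>K. \<forall>y\<in>K. x + y \<in> K \<and> x * y \<in> K)"
proof -
  define K where "K = {x :: bit alg_closure. x ^ (2 ^ m) = x}"
  define p :: "bit alg_closure poly" where "p = monom 1 (2 ^ m) + [:0, 1:]"
  have m2: "(2::nat) ^ m > 1" using assms one_less_power[of "2::nat" m] by simp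
  have deg: "degree p = 2 ^ m"
    unfolding p_def using m2 by (subst degree_add_eq_left) (simp_all add: degree_monom_eq)
  have K: "K = {x. poly p x = 0}"
  proof -
    have "x ^ 2 ^ m + x = 0 \<longleftrightarrow> x ^ 2 ^ m = x" for x :: "bit alg_closure"
      using char_2[of x] by (metis add_right_cancel)
    then show ?thesis by (auto simp: K_def p_def poly_monom)
  qed
  have "of_nat (2 ^ m) = (0 :: bit alg_closure)"
  proof -
    have "(2 :: bit alg_closure) = 0" using char_2[of 1] by simp
    then show ?thesis using assms by (simp add: power_0_left)
  qed
  then have "pderiv p = 1"
    using assms by (simp add: p_def pderiv_add pderiv_monom pderiv_pCons power_0_left one_pCons)
  have p0: "p \<noteq> 0" using deg m2 by auto
  have "order a p \<le> 1" for a
  proof (rule ccontr)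
    assume "\<not> order a p \<le> 1"
    then have "2 \<le> order a p" by simp
    then have "[:- a, 1:] ^ 2 dvd p"
      by (rule dvd_trans[OF le_imp_power_dvd order_1])
    then obtain q where "p = [:- a, 1:] ^ 2 * q" by (elim dvdE)
    then have "p = [:- a, 1:] * ([:- a, 1:] * q)" by (simp only: power2_eq_square mult.assoc)
    then have "poly (pderiv p) a = 0" by (simp only: pderiv_mult poly_add poly_mult) simp
    then show False using \<open>pderiv p = 1\<close> by simp
  qed
  then have "rsquarefree p" using p0 by (auto simp: rsquarefree_def le_Suc_eq)
  have set: "set_mset (proots p) = K" unfolding K using p0 by (simp add: set_count_proots)
  obtain A where A: "size A = degree p" "p = smult (lead_coeff p) (\<Prod>x\<in>#A. [:-x, 1:])"
    using alg_closed_imp_factorization[OF p0] by blast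
  have "size (proots p) = 2 ^ m"
  proof -
    have "proots p = proots (\<Prod>x\<in>#A. [:-x, 1:])" by (subst A(2)) (use p0 in simp)
    also have "\<dots> = A"
    proof (induction A)
      case (add x A)
      have "(\<Prod>x\<in>#A. [:- x, 1:]) \<noteq> 0" by (auto simp: prod_mset_zero_iff)
      then have "proots ([:- x, 1:] * (\<Prod>x\<in>#A. [:- x, 1:])) = {#x#} + A"
        using add by (subst proots_mult) auto
      then show ?case by (simp del: mult_pCons_left mult_pCons_right)
    qed simp
    finally show ?thesis using A(1) deg by simp
  qed
  moreover have "size (proots p) = card K"
  proof -
    have "count (proots p) x = 1" if "x \<in> set_mset (proots p)" for x
      using that rsquarefree_root_order[OF \<open>rsquarefree p\<close> _ p0] p0 by simp
    then have "size (proots p) = (\<Sum>x\<in>set_mset (proots p). 1)"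
      unfolding size_multiset_overloaded_eq by (intro sum.cong) auto
    then show ?thesis by (simp add: set)
  qed
  moreover have "finite K" unfolding set[symmetric] by simp
  moreover have "0 \<in> K" "\<forall>x\<in>K. \<forall>y\<in>K. x + y \<in> K \<and> x * y \<in> K"
    by (auto simp: K_def frobenius power_mult_distrib)
  ultimately show ?thesis by (intro exI[of _ K]) auto
qed

section \<open>A potential for Constructor\<close>

text \<open>
  The potential of a position is the sum, over the sets S i that Blocker has not touched, of 2 to the
  number of edges of S i that Constructor owns. Constructor claims an edge e of maximal weight w e, which
  adds w e to the potential. Blocker's answer f removes the sets through f; they had total weight
  w f \<le> w e before Constructor's move, and only the sets through both e and f have become heavier since.
  Thus a round costs at most 2^t D. When all edges of E are claimed, a set of positive weight is owned
  entirely by Constructor, and it weighs at most 2^t.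
\<close>

lemma game_value_ge_potential:
  fixes S :: "'i \<Rightarrow> nat set set"
  assumes E: "E \<subseteq> board n" "free_of F ({..<n}, E)"
    and I: "finite I" "\<And>i. i \<in> I \<Longrightarrow> S i \<subseteq> E \<and> card (S i) \<le> t"
    and pair: "\<And>e f. e \<noteq> f \<Longrightarrow> card {i \<in> I. e \<in> S i \<and> f \<in> S i} \<le> D"
    and count: "\<And>C. C \<subseteq> E \<Longrightarrow> card {i \<in> I. S i \<subseteq> C} \<le> card (copies H ({..<n}, C))"
  shows "C \<subseteq> E \<Longrightarrow> C \<inter> B = {} \<Longrightarrow> (\<Sum>i | i \<in> I \<and> S i \<inter> B = {}. 2 ^ card (S i \<inter> C))
     \<le> 2 ^ t * game_value n H F Constructor C B + 2 ^ t * D * card (E - (C \<union> B))"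
proof (induction "card (E - (C \<union> B))" arbitrary: C B rule: less_induct)
  case less
  have finE: "finite E" using E(1) finite_subset finite_imp_finite_nsets by blast
  have finS: "finite (S i)" if "i \<in> I" for i using I(2)[OF that] finE finite_subset by blast
  define alive where "alive B = {i \<in> I. S i \<inter> B = {}}" for B
  define pot where "pot C B = (\<Sum>i\<in>alive B. (2::nat) ^ card (S i \<inter> C))" for C B
  have fin_alive: "finite (alive B)" for B using I(1) by (simp add: alive_def)
  have final: "pot C B \<le> 2 ^ t * game_value n H F p C B" if C: "C \<subseteq> E" and full: "E \<subseteq> C \<union> B" for C B p
  proof -
    have "pot C B \<le> (\<Sum>i\<in>alive B. 2 ^ t)"
      unfolding pot_def
    proof (rule sum_mono)
      fix i assume "i \<in> alive B"
      then have "card (S i \<inter> C) \<le> t"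
        using I(2)[of i] finS[of i] card_mono[of "S i" "S i \<inter> C"] by (auto simp: alive_def)
      then show "(2::nat) ^ card (S i \<inter> C) \<le> 2 ^ t" by simp
    qed
    also have "\<dots> = 2 ^ t * card (alive B)" by simp
    also have "card (alive B) \<le> card {i \<in> I. S i \<subseteq> C}"
      using I full by (intro card_mono) (auto simp: alive_def)
    also have "\<dots> \<le> card (copies H ({..<n}, C))" by (rule count[OF C])
    also have "\<dots> \<le> game_value n H F p C B" by (rule game_value_ge_copies) (use C E in auto)
    finally show ?thesis by simp
  qed
  show ?case
  proof (cases "E \<subseteq> C \<union> B")
    case True
    then show ?thesis using final[OF less.prems(1) True] by (simp add: pot_def alive_def trans_le_add1)
  next
    case False
    define U where "U = E - (C \<union> B)"
    define w where "w e = (\<Sum>i | i \<in> alive B \<and> e \<in> S i. (2::nat) ^ card (S i \<inter> C))" for e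
    have U: "finite U" "U \<noteq> {}" using False finE by (auto simp: U_def)
    then have "Max (w ` U) \<in> w ` U" by (intro Max_in) auto
    then obtain e where e: "e \<in> U" "w e = Max (w ` U)" by auto
    then have e_max: "w f \<le> w e" if "f \<in> U" for f using U that by simp
    define C' where "C' = insert e C"
    have eE: "e \<in> E" "e \<notin> C" "e \<notin> B" using e by (auto simp: U_def)
    have C': "C' \<subseteq> E" using less.prems eE by (auto simp: C'_def)
    have mv: "f \<in> constructor_moves n F Y Z" if "f \<in> E" "f \<notin> Y" "f \<notin> Z" "Y \<subseteq> E" for f Y Z
      using that E by (auto simp: constructor_moves_def unclaimed_def intro!: free_of_mono[OF E(2)])
    have gain: "pot C' B = pot C B + w e"
    proof -
      have "pot C' B = (\<Sum>i\<in>alive B. 2 ^ card (S i \<inter> C) + (if e \<in> S i then 2 ^ card (S i \<inter> C) else 0))"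
        unfolding pot_def
      proof (rule sum.cong[OF refl])
        fix i assume "i \<in> alive B"
        then have "finite (S i)" using finS by (simp add: alive_def)
        then show "(2::nat) ^ card (S i \<inter> C') = 2 ^ card (S i \<inter> C) + (if e \<in> S i then 2 ^ card (S i \<inter> C) else 0)"
          using eE by (simp add: C'_def Int_insert_right)
      qed
      then show ?thesis using fin_alive by (simp add: sum.distrib pot_def w_def sum.inter_filter)
    qed
    have lose: "pot C' B \<le> pot C' (insert f B) + w f + 2 ^ t * D" if f: "f \<noteq> e" "f \<notin> C" for f
    proof -
      have split: "alive B = alive (insert f B) \<union> {i \<in> alive B. f \<in> S i}"
        "alive (insert f B) \<inter> {i \<in> alive B. f \<in> S i} = {}" by (auto simp: alive_def)
      have "pot C' B = pot C' (insert f B) + (\<Sum>i | i \<in> alive B \<and> f \<in> S i. 2 ^ card (S i \<inter> C'))"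
        unfolding pot_def by (subst split(1), rule sum.union_disjoint) (use fin_alive split(2) in auto)
      also have "(\<Sum>i | i \<in> alive B \<and> f \<in> S i. (2::nat) ^ card (S i \<inter> C'))
        \<le> (\<Sum>i | i \<in> alive B \<and> f \<in> S i. 2 ^ card (S i \<inter> C) + (if e \<in> S i then 2 ^ t else 0))"
      proof (rule sum_mono)
        fix i assume i: "i \<in> {i \<in> alive B. f \<in> S i}"
        then have fi: "finite (S i)" "card (S i) \<le> t" using finS I(2) by (auto simp: alive_def)
        have "card (S i \<inter> C') \<le> t" using card_mono[of "S i" "S i \<inter> C'"] fi by auto
        then have "(2::nat) ^ card (S i \<inter> C') \<le> 2 ^ t" by simp
        then show "(2::nat) ^ card (S i \<inter> C') \<le> 2 ^ card (S i \<inter> C) + (if e \<in> S i then 2 ^ t else 0)"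
          by (cases "e \<in> S i") (simp_all add: C'_def Int_insert_right trans_le_add2)
      qed
      also have "\<dots> = w f + 2 ^ t * card {i \<in> alive B. f \<in> S i \<and> e \<in> S i}"
        using fin_alive[of B] by (simp add: sum.distrib w_def sum.If_cases Int_def conj_commute conj_left_commute)
      also have "card {i \<in> alive B. f \<in> S i \<and> e \<in> S i} \<le> D"
        using card_mono[of "{i \<in> I. f \<in> S i \<and> e \<in> S i}" "{i \<in> alive B. f \<in> S i \<and> e \<in> S i}"] pair[OF f(1)] I(1)
        by (force simp: alive_def)
      finally show ?thesis by (simp add: algebra_simps)
    qed
    have wB: "w f = 0" if "f \<notin> E \<or> f \<in> B" for f
    proof -
      have "{i \<in> alive B. f \<in> S i} = {}" using that I(2) by (auto simp: alive_def)
      then show ?thesis by (simp only: w_def sum.empty)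
    qed
    let ?N = "2 ^ t * D * card U"
    have cU: "card (U - {e}) < card U" using U e by (simp add: card_gt_0_iff)
    have goal: "pot C B \<le> 2 ^ t * game_value n H F Constructor C B + ?N"
    proof (cases "E \<subseteq> C' \<union> B")
      case True
      have "pot C B \<le> pot C' B" using gain by simp
      also have "\<dots> \<le> 2 ^ t * game_value n H F Blocker C' B" by (rule final[OF C' True])
      also have "game_value n H F Blocker C' B \<le> game_value n H F Constructor C B"
        unfolding C'_def by (rule game_value_Constructor_ge[OF mv order_refl]) (use eE less.prems in auto)
      finally show ?thesis by simp
    next
      case False
      define v where "v = game_value n H F Blocker C' B"
      have vle: "v \<le> game_value n H F Constructor C B"
        unfolding v_def C'_def by (rule game_value_Constructor_ge[OF mv order_refl]) (use eE less.prems in auto)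
      obtain g where g: "g \<in> E" "g \<notin> C'" "g \<notin> B" using False by auto
      then have no: "\<not> game_over n F C' B" using mv[OF g C']
        by (auto simp: game_over_def constructor_moves_def)
      let ?V = "(\<lambda>f. game_value n H F Constructor C' (insert f B)) ` unclaimed n C' B"
      have "v = Min ?V" using no unfolding v_def by (subst game_value.simps) simp
      moreover have "Min ?V \<in> ?V" using no finite_unclaimed by (intro Min_in) (auto simp: game_over_def)
      ultimately obtain f where f: "f \<in> unclaimed n C' B" "v = game_value n H F Constructor C' (insert f B)"
        by auto
      have fne: "f \<noteq> e" "f \<notin> C" "f \<notin> B" using f by (auto simp: unclaimed_def C'_def)
      have wf: "w f \<le> w e" using wB[of f] e_max[of f] fne by (cases "f \<in> E") (auto simp: U_def)
      have sub: "E - (C' \<union> insert f B) \<subseteq> U - {e}" by (auto simp: U_def C'_def)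
      have lt: "card (E - (C' \<union> insert f B)) < card U"
        using card_mono[OF _ sub] cU U(1) by simp
      have "pot C' (insert f B) \<le> 2 ^ t * v + 2 ^ t * D * card (E - (C' \<union> insert f B))"
        unfolding f(2) pot_def alive_def
        by (rule less.hyps) (use lt C' less.prems fne eE in \<open>auto simp: U_def C'_def\<close>)
      also have "\<dots> \<le> 2 ^ t * v + 2 ^ t * D * (card U - 1)" using lt by (intro add_left_mono mult_left_mono) auto
      finally have "pot C' B \<le> 2 ^ t * v + 2 ^ t * D * (card U - 1) + w f + 2 ^ t * D"
        using lose[OF fne(1,2)] by linarith
      also have "2 ^ t * D * (card U - 1) = 2 ^ t * D * card U - 2 ^ t * D" by (simp add: diff_mult_distrib2)
      finally have "pot C' B \<le> 2 ^ t * v + ?N + w f"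
        using cU by (cases "card U") auto
      then have "pot C B \<le> 2 ^ t * v + ?N" using gain wf by linarith
      also have "2 ^ t * v \<le> 2 ^ t * game_value n H F Constructor C B" using vle by simp
      finally show ?thesis by simp
    qed
    then show ?thesis by (simp only: pot_def alive_def U_def mem_Collect_eq)
  qed
qed

section \<open>A layered graph without 4-cycles\<close>

definition consecutive :: "nat \<Rightarrow> nat \<Rightarrow> nat \<Rightarrow> bool" where
  "consecutive t i j \<longleftrightarrow> j = Suc i mod t \<or> i = Suc j mod t"

lemma consecutive_sym: "consecutive t i j \<longleftrightarrow> consecutive t j i"
  by (auto simp: consecutive_def)

text \<open>
  A closed walk of length 4 on a cycle of length at least 5 cannot wind around it, so it turns back at
  one of two opposite vertices.
\<close>

lemma no_closed_walk_of_length_4: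
  assumes "t \<ge> 5" "i < t" "i' < t" "j < t" "j' < t"
    and "consecutive t i j" "consecutive t i' j" "consecutive t i j'" "consecutive t i' j'"
  shows "i = i' \<or> j = j'"
proof -
  have c: "consecutive t x y \<longleftrightarrow> y = Suc x \<or> (Suc x = t \<and> y = 0) \<or> x = Suc y \<or> (Suc y = t \<and> x = 0)"
    if "x < t" "y < t" for x y
    using that by (auto simp: consecutive_def mod_Suc)
  show ?thesis using assms(1) assms(6-9) unfolding c[OF assms(2,4)] c[OF assms(3,4)] c[OF assms(2,5)] c[OF assms(3,5)]
    by linarith
qed

text \<open>
  Cancellation takes place in the ambient field; inside K only sums and products occur.
\<close>

locale layered_host =
  fixes K :: "'a::field set" and t :: nat and lay :: "'a \<Rightarrow> nat" and lam :: 'a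
  assumes finite_K: "finite K" and zero_K: "0 \<in> K"
    and add_K: "x \<in> K \<Longrightarrow> y \<in> K \<Longrightarrow> x + y \<in> K" and mult_K: "x \<in> K \<Longrightarrow> y \<in> K \<Longrightarrow> x * y \<in> K"
    and t5: "t \<ge> 5" and lay: "a \<in> K \<Longrightarrow> lay a < t"
begin

text \<open>
  The constant on the edges between the last and the first layer is a parameter, so that it can be tuned
  to the most frequent value of \<open>closing_sum\<close>.
\<close>

definition shift :: "nat \<Rightarrow> nat \<Rightarrow> 'a" where
  "shift i j = (if {i, j} = {0, t - 1} then lam else 0)"

definition adj :: "'a \<times> 'a \<Rightarrow> 'a \<times> 'a \<Rightarrow> bool" where
  "adj u v \<longleftrightarrow> u \<in> K \<times> K \<and> v \<in> K \<times> K \<and> consecutive t (lay (fst u)) (lay (fst v)) \<and>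
     snd u + snd v + fst u * fst v = shift (lay (fst u)) (lay (fst v))"

lemma shift_sym: "shift i j = shift j i" by (simp add: shift_def insert_commute)

lemma adj_sym: "adj u v \<longleftrightarrow> adj v u"
  by (auto simp: adj_def consecutive_sym shift_sym add.commute mult.commute)

lemma adj_irrefl: "\<not> adj u u"
proof
  assume "adj u u"
  then have "lay (fst u) = Suc (lay (fst u)) mod t" "lay (fst u) < t"
    using lay by (auto simp: adj_def consecutive_def)
  then show False using t5 by (auto simp: mod_Suc split: if_splits)
qed

text \<open>
  Add the four edge equations with alternating signs. The second coordinates cancel, and so do the
  constants, because one of the two pairs of opposite vertices lies in a single layer. What remains is a
  product (a - a') (c - c') = 0, and equal first coordinates force equal second coordinates.
\<close>

lemma common_neighbour_unique:
  assumes "adj u x" "adj v x" "adj u y" "adj v y" "u \<noteq> v"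
  shows "x = y"
proof -
  obtain a b where u: "u = (a, b)" by fastforce
  obtain a' b' where v: "v = (a', b')" by fastforce
  obtain c d where x: "x = (c, d)" by fastforce
  obtain c' d' where y: "y = (c', d')" by fastforce
  have K: "a \<in> K" "a' \<in> K" "c \<in> K" "c' \<in> K" using assms by (auto simp: adj_def u v x y)
  have eq: "b + d + a * c = shift (lay a) (lay c)" "b' + d + a' * c = shift (lay a') (lay c)"
    "b + d' + a * c' = shift (lay a) (lay c')" "b' + d' + a' * c' = shift (lay a') (lay c')"
    using assms by (auto simp: adj_def u v x y)
  have "(a - a') * (c - c') = shift (lay a) (lay c) - shift (lay a') (lay c) - shift (lay a) (lay c') + shift (lay a') (lay c')"
    unfolding eq[symmetric] by (simp add: algebra_simps)
  moreover have "lay a = lay a' \<or> lay c = lay c'"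
    by (rule no_closed_walk_of_length_4[OF t5]) (use assms lay K in \<open>auto simp: adj_def u v x y\<close>)
  ultimately have "(a - a') * (c - c') = 0" by auto
  then consider "a = a'" | "c = c'" by auto
  then show ?thesis
  proof cases
    case 1
    then have "b = b'" using eq by (metis add_right_cancel)
    then show ?thesis using 1 assms(5) u v by simp
  next
    case 2
    then have "d = d'" using eq by (metis add_left_cancel add_right_cancel)
    then show ?thesis using 2 x y by simp
  qed
qed

definition layered_cycles :: "(nat \<Rightarrow> 'a \<times> 'a) set" where
  "layered_cycles = {g \<in> {..<t} \<rightarrow>\<^sub>E K \<times> K. (\<forall>i<t. lay (fst (g i)) = i) \<and> (\<forall>i<t. adj (g i) (g (Suc i mod t)))}"

lemma finite_layered_cycles: "finite layered_cycles"
  by (rule finite_subset[of _ "{..<t} \<rightarrow>\<^sub>E K \<times> K"]) (auto simp: layered_cycles_def finite_K finite_PiE)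

text \<open>
  Along an edge with both first coordinates known, either second coordinate determines the other.
  So one known vertex determines all vertices outside layer l0, going around the cycle without crossing l0,
  and the vertex in layer l0 is the common neighbour of its two neighbours.
\<close>

lemma layered_cycle_determined:
  assumes g: "g \<in> layered_cycles" "g' \<in> layered_cycles" and l0: "l0 < t"
    and fst_eq: "\<And>l. l < t \<Longrightarrow> l \<noteq> l0 \<Longrightarrow> fst (g l) = fst (g' l)"
    and l1: "l1 < t" "l1 \<noteq> l0" "g l1 = g' l1"
  shows "g = g'"
proof -
  define P where "P j \<longleftrightarrow> g ((l0 + j) mod t) = g' ((l0 + j) mod t)" for j
  have t0: "t > 0" using t5 by simp
  have lay_g: "lay (fst (g l)) = l" "lay (fst (g' l)) = l" if "l < t" for l
    using g that by (auto simp: layered_cycles_def)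
  have adj_g: "adj (g l) (g (Suc l mod t))" "adj (g' l) (g' (Suc l mod t))" if "l < t" for l
    using g that by (auto simp: layered_cycles_def)
  have ne: "(l0 + j) mod t \<noteq> l0" if "1 \<le> j" "j < t" for j
  proof -
    have "l0 + j < 2 * t" using that l0 by simp
    then show ?thesis using that l0 by (cases "l0 + j < t") (auto simp: mod_if)
  qed
  have step: "P j \<longleftrightarrow> P (Suc j)" if j: "1 \<le> j" "Suc j < t" for j
  proof -
    define l where "l = (l0 + j) mod t"
    define l' where "l' = (l0 + Suc j) mod t"
    have l: "l < t" "l \<noteq> l0" "l' < t" "l' \<noteq> l0" "l' = Suc l mod t"
      using ne[of j] ne[of "Suc j"] j t0 by (auto simp: l_def l'_def mod_Suc_eq)
    have 1: "snd (g l) + snd (g l') + fst (g l) * fst (g l') = shift l l'"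
      using adj_g(1)[OF l(1)] lay_g(1)[OF l(1)] lay_g(1)[OF l(3)] l(5) by (simp add: adj_def)
    have 2: "snd (g' l) + snd (g' l') + fst (g l) * fst (g l') = shift l l'"
      using adj_g(2)[OF l(1)] lay_g(2)[OF l(1)] lay_g(2)[OF l(3)] l(5) fst_eq[OF l(1,2)] fst_eq[OF l(3,4)]
      by (simp add: adj_def)
    have "snd (g l) + snd (g l') = snd (g' l) + snd (g' l')" using 1 2 by (metis add_right_cancel)
    then have "snd (g l) = snd (g' l) \<longleftrightarrow> snd (g l') = snd (g' l')"
      by (metis add_left_cancel add_right_cancel)
    then show ?thesis unfolding P_def l_def[symmetric] l'_def[symmetric]
      using fst_eq[OF l(1,2)] fst_eq[OF l(3,4)] by (simp add: prod_eq_iff)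
  qed
  have all: "P j \<longleftrightarrow> P 1" if "1 \<le> j" "j < t" for j
    using that
  proof (induction j rule: dec_induct)
    case (step j) then show ?case using \<open>\<And>j. 1 \<le> j \<Longrightarrow> Suc j < t \<Longrightarrow> P j \<longleftrightarrow> P (Suc j)\<close>[of j] by simp
  qed simp
  have ex: "\<exists>j. 1 \<le> j \<and> j < t \<and> l = (l0 + j) mod t" if "l < t" "l \<noteq> l0" for l
  proof (cases "l0 < l")
    case True then show ?thesis using that by (intro exI[of _ "l - l0"]) auto
  next
    case False then show ?thesis using that l0 by (intro exI[of _ "l + t - l0"]) auto
  qed
  have "P 1" using ex[OF l1(1,2)] all l1(3) by (auto simp: P_def)
  then have eq: "g l = g' l" if "l < t" "l \<noteq> l0" for l
    using ex[OF that] all by (metis P_def)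
  have "g l0 = g' l0"
  proof -
    define p where "p = (l0 + (t - 1)) mod t"
    define q where "q = Suc l0 mod t"
    have pq: "p < t" "q < t" "p \<noteq> l0" "q \<noteq> l0" "Suc p mod t = l0"
      using ne[of "t - 1"] ne[of 1] t5 l0 by (auto simp: p_def q_def mod_Suc_eq)
    have "Suc p = l0 \<or> (Suc p = t \<and> l0 = 0)" "q = Suc l0 \<or> (Suc l0 = t \<and> q = 0)"
      using pq(5) mod_Suc[of p t] mod_less[OF pq(1)] mod_Suc[of l0 t] mod_less[OF l0] unfolding q_def by metis+
    then have "p \<noteq> q" using t5 by linarith
    then have "g p \<noteq> g q" using lay_g(1)[OF pq(1)] lay_g(1)[OF pq(2)] by metis
    moreover have "adj (g p) (g l0)" "adj (g p) (g' l0)"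
      using adj_g(1)[OF pq(1)] adj_g(2)[OF pq(1)] eq[OF pq(1,3)] pq(5) by auto
    moreover have "adj (g q) (g l0)" "adj (g q) (g' l0)"
      using adj_g(1)[OF l0] adj_g(2)[OF l0] eq[OF pq(2,4)] adj_sym by (auto simp: q_def)
    ultimately show ?thesis using common_neighbour_unique by blast
  qed
  then have "g l = g' l" if "l < t" for l using eq that by metis
  then show ?thesis
    by (intro extensionalityI[of g "{..<t}"]) (use g in \<open>auto simp: layered_cycles_def PiE_def\<close>)
qed

text \<open>
  Three given vertices fix three layers. As t \<ge> 5, there is a further layer l0 that need not be counted
  by \<open>layered_cycle_determined\<close>, and only t - 4 first coordinates are left.
\<close>

lemma card_layered_cycles_through_3:
  assumes "distinct [x1, x2, x3]"
  shows "card {g \<in> layered_cycles. {x1, x2, x3} \<subseteq> g ` {..<t}} \<le> card K ^ (t - 4)"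
proof (cases "{g \<in> layered_cycles. {x1, x2, x3} \<subseteq> g ` {..<t}} = {}")
  case False
  define A where "A = {g \<in> layered_cycles. {x1, x2, x3} \<subseteq> g ` {..<t}}"
  define L where "L = (\<lambda>x. lay (fst x)) ` {x1, x2, x3}"
  have at: "g (lay (fst x)) = x" "lay (fst x) < t" if "g \<in> A" "x \<in> {x1, x2, x3}" for g x
  proof -
    have "x \<in> g ` {..<t}" using that by (auto simp: A_def)
    then obtain i where "i < t" "x = g i" by auto
    then show "g (lay (fst x)) = x" "lay (fst x) < t" using that by (auto simp: A_def layered_cycles_def)
  qed
  obtain h where h: "h \<in> A" using False by (auto simp: A_def)
  have "inj_on (\<lambda>x. lay (fst x)) {x1, x2, x3}" by (rule inj_on_inverseI[of _ h]) (use at[OF h] in auto)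
  then have cL: "card L = 3" using assms by (simp add: L_def card_image)
  have Lt: "L \<subseteq> {..<t}" using at(2)[OF h] by (auto simp: L_def)
  have "\<not> {..<t} \<subseteq> L" using card_mono[of L "{..<t}"] cL t5 by (auto simp: L_def)
  then obtain l0 where l0: "l0 < t" "l0 \<notin> L" by auto
  define D where "D = {..<t} - insert l0 L"
  have "card (insert l0 L) = 4" using l0 cL by (simp add: L_def)
  then have cD: "card D = t - 4" using Lt l0 unfolding D_def by (subst card_Diff_subset) (auto simp: L_def)
  have "card A \<le> card (D \<rightarrow>\<^sub>E K)"
  proof (rule card_inj_on_le)
    show "(\<lambda>g. restrict (fst \<circ> g) D) ` A \<subseteq> D \<rightarrow>\<^sub>E K"
    proof clarify
      fix g assume "g \<in> A"
      then have "g i \<in> K \<times> K" if "i < t" for i using that by (auto simp: A_def layered_cycles_def PiE_def Pi_def)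
      then show "restrict (fst \<circ> g) D \<in> D \<rightarrow>\<^sub>E K" by (auto simp: D_def mem_Times_iff)
    qed
    show "finite (D \<rightarrow>\<^sub>E K)" by (rule finite_PiE) (auto simp: D_def finite_K)
    show "inj_on (\<lambda>g. restrict (fst \<circ> g) D) A"
    proof (rule inj_onI)
      fix g g' assume gg: "g \<in> A" "g' \<in> A" "restrict (fst \<circ> g) D = restrict (fst \<circ> g') D"
      have onL: "g l = g' l" if "l \<in> L" for l
      proof -
        obtain x where "x \<in> {x1, x2, x3}" "l = lay (fst x)" using \<open>l \<in> L\<close> unfolding L_def by blast
        then show ?thesis using at(1)[OF gg(1)] at(1)[OF gg(2)] by metis
      qed
      show "g = g'"
      proof (rule layered_cycle_determined[OF _ _ l0(1)])
        show "g \<in> layered_cycles" "g' \<in> layered_cycles" using gg by (auto simp: A_def)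
        show "fst (g l) = fst (g' l)" if "l < t" "l \<noteq> l0" for l
        proof (cases "l \<in> L")
          case False
          then have "l \<in> D" using that by (simp add: D_def)
          then show ?thesis using fun_cong[OF gg(3), of l] by simp
        qed (simp add: onL)
        have m: "lay (fst x1) \<in> L" by (simp add: L_def)
        then show "lay (fst x1) < t" "lay (fst x1) \<noteq> l0" "g (lay (fst x1)) = g' (lay (fst x1))"
          using l0 Lt onL by auto
      qed
    qed
  qed
  also have "card (D \<rightarrow>\<^sub>E K) = card K ^ (t - 4)" by (simp add: card_PiE D_def flip: cD)
  finally show ?thesis by (simp add: A_def)
next
  case True
  then show ?thesis by (simp only: card.empty le0)
qed

end

text \<open>
  In characteristic 2 the second coordinate grows by a i a (i + 1) along each edge, so this is its total change
  around the cycle, which has to match the constant on the closing edge.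
\<close>

definition closing_sum :: "nat \<Rightarrow> (nat \<Rightarrow> 'a::field) \<Rightarrow> 'a" where
  "closing_sum t a = (\<Sum>j<t - 1. a j * a (Suc j)) + a (t - 1) * a 0"

context layered_host begin

definition host_edges :: "('a \<times> 'a) set set" where
  "host_edges = {{u, v} | u v. adj u v}"

lemma adj_iff_edge: "{u, v} \<in> host_edges \<longleftrightarrow> adj u v"
  unfolding host_edges_def mem_Collect_eq doubleton_eq_iff by (metis adj_sym)

lemma host_edges_sub: "host_edges \<subseteq> [K \<times> K]\<^bsup>2\<^esup>"
  using adj_irrefl by (auto simp: host_edges_def adj_def)

lemma card_host_edges: "card host_edges \<le> card K ^ 3"
proof -
  let ?f = "\<lambda>(a, b, c). {(a, b), (c, shift (lay a) (lay c) - b - a * c)}"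
  have "host_edges \<subseteq> ?f ` (K \<times> K \<times> K)"
  proof
    fix e assume "e \<in> host_edges"
    then obtain u v where e: "e = {u, v}" "adj u v" by (auto simp: host_edges_def)
    obtain a b c d where uv: "u = (a, b)" "v = (c, d)" by fastforce
    have "b + d + a * c = shift (lay a) (lay c)" using e(2) by (auto simp: adj_def uv)
    then have "d = shift (lay a) (lay c) - b - a * c" by (simp add: algebra_simps)
    then have "e = ?f (a, b, c)" by (simp add: e uv)
    moreover have "(a, b, c) \<in> K \<times> K \<times> K" using e(2) by (auto simp: adj_def uv)
    ultimately show "e \<in> ?f ` (K \<times> K \<times> K)" by blast
  qed
  then have "card host_edges \<le> card (K \<times> K \<times> K)" using finite_K by (intro surj_card_le) auto
  then show ?thesis by (simp add: card_cartesian_product power3_eq_cube)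
qed

lemma host_C4_free: "\<not> cyc host_edges 4 h"
proof
  assume h: "cyc host_edges 4 h"
  have adj4: "adj (h i) (h (Suc i mod 4))" if "i < 4" for i
    using h that by (auto simp: cyc_def adj_iff_edge)
  have e: "Suc 0 mod 4 = 1" "Suc 1 mod 4 = 2" "Suc 2 mod 4 = 3" "Suc 3 mod 4 = 0" by simp_all
  have a: "adj (h 0) (h 1)" "adj (h 1) (h 2)" "adj (h 2) (h 3)" "adj (h 3) (h 0)"
    using adj4[of 0, unfolded e] adj4[of 1, unfolded e] adj4[of 2, unfolded e] adj4[of 3, unfolded e]
    by simp_all
  have inj: "inj_on h {..<4}" using h by (simp add: cyc_def)
  have "h 0 \<noteq> h 2" "h 1 \<noteq> h 3"
    using inj_on_eq_iff[OF inj, of 0 2] inj_on_eq_iff[OF inj, of 1 3] by auto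
  then show False
    using common_neighbour_unique[of "h 0" "h 1" "h 2" "h 3"] a(1,3) a(2,4)[THEN adj_sym[THEN iffD1]] by simp
qed

text \<open>
  The second coordinate of the first vertex is free; the first coordinates determine all the others.
\<close>

lemma card_layered_cycles_ge:
  assumes char2: "\<And>x::'a. x + x = 0"
  shows "card {a \<in> (\<Pi>\<^sub>E i\<in>{..<t}. {x \<in> K. lay x = i}). closing_sum t a = lam} * card K \<le> card layered_cycles"
proof -
  let ?A = "{a \<in> (\<Pi>\<^sub>E i\<in>{..<t}. {x \<in> K. lay x = i}). closing_sum t a = lam}"
  define \<beta> where "\<beta> a b i = b + (\<Sum>j<i. a j * a (Suc j))" for a :: "nat \<Rightarrow> 'a" and b i
  define f where "f = (\<lambda>(a, b). restrict (\<lambda>i. (a i, \<beta> a b i)) {..<t})"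
  have finA: "finite ?A" by (rule finite_subset[of _ "\<Pi>\<^sub>E i\<in>{..<t}. {x \<in> K. lay x = i}"]) (auto intro!: finite_PiE simp: finite_K)
  have sum_K: "(\<Sum>j<i. a j * a (Suc j)) \<in> K" if "\<And>j. j < t \<Longrightarrow> a j \<in> K" "i < t" for a :: "nat \<Rightarrow> 'a" and i
    using that(2)
  proof (induction i)
    case (Suc i)
    then show ?case using that(1)[of i] that(1)[of "Suc i"] by (simp add: add_K mult_K)
  qed (simp add: zero_K)
  have "card (?A \<times> K) \<le> card layered_cycles"
  proof (rule card_inj_on_le[OF _ _ finite_layered_cycles])
    show "f ` (?A \<times> K) \<subseteq> layered_cycles"
    proof
      fix g assume "g \<in> f ` (?A \<times> K)"
      then obtain a b where g: "g = f (a, b)" and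
        a: "a \<in> (\<Pi>\<^sub>E i\<in>{..<t}. {x \<in> K. lay x = i})" "closing_sum t a = lam" and b: "b \<in> K" by blast
      have aK: "a i \<in> K" "lay (a i) = i" if "i < t" for i using a that by (auto simp: PiE_def Pi_def)
      have bK: "\<beta> a b i \<in> K" if "i < t" for i
        unfolding \<beta>_def using b sum_K[of a i] aK that by (intro add_K) auto
      have eq: "f (a, b) i = (a i, \<beta> a b i)" if "i < t" for i using that by (simp add: f_def)
      have adj: "adj (f (a, b) i) (f (a, b) (Suc i mod t))" if i: "i < t" for i
      proof (cases "Suc i < t")
        case True
        have "\<beta> a b i + \<beta> a b (Suc i) + a i * a (Suc i) =
          (\<beta> a b i + \<beta> a b i) + (a i * a (Suc i) + a i * a (Suc i))"
          by (simp add: \<beta>_def algebra_simps)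
        then have "\<beta> a b i + \<beta> a b (Suc i) + a i * a (Suc i) = 0" by (simp only: char2 add_0)
        moreover have "shift i (Suc i) = 0" using True t5 by (auto simp: shift_def doubleton_eq_iff)
        ultimately show ?thesis using True i aK bK by (simp add: adj_def eq consecutive_def)
      next
        case False
        then have "Suc i = t" using i by simp
        then have it: "i = t - 1" "Suc i mod t = 0" by auto
        have "\<beta> a b i + \<beta> a b 0 + a i * a 0 = (b + b) + closing_sum t a"
          by (simp add: \<beta>_def closing_sum_def it algebra_simps)
        then have "\<beta> a b i + \<beta> a b 0 + a i * a 0 = lam" using a(2) by (simp only: char2 add_0)
        moreover have "shift i 0 = lam" by (simp add: shift_def it insert_commute)
        moreover have "(0::nat) < t" using t5 by simp
        ultimately show ?thesis using i it(2) aK bK by (simp add: adj_def eq consecutive_def)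
      qed
      have "f (a, b) \<in> {..<t} \<rightarrow>\<^sub>E K \<times> K"
      proof (rule PiE_I)
        show "f (a, b) i \<in> K \<times> K" if "i \<in> {..<t}" for i using that aK bK by (simp add: eq)
        show "f (a, b) i = undefined" if "i \<notin> {..<t}" for i using that by (simp add: f_def)
      qed
      moreover have "lay (fst (f (a, b) i)) = i" if "i < t" for i using that aK(2) by (simp add: eq)
      ultimately show "g \<in> layered_cycles" unfolding layered_cycles_def g using adj by blast
    qed
    show "inj_on f (?A \<times> K)"
    proof (rule inj_onI)
      fix p p' assume p: "p \<in> ?A \<times> K" "p' \<in> ?A \<times> K" and f: "f p = f p'"
      obtain a b a' b' where ab: "p = (a, b)" "p' = (a', b')" by fastforce
      have a: "a \<in> (\<Pi>\<^sub>E i\<in>{..<t}. {x \<in> K. lay x = i})" "a' \<in> (\<Pi>\<^sub>E i\<in>{..<t}. {x \<in> K. lay x = i})"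
        using p by (auto simp: ab)
      have eq: "a i = a' i" "\<beta> a b i = \<beta> a' b' i" if "i < t" for i
        using fun_cong[OF f, of i] that by (auto simp: f_def ab)
      have "b = b'" using eq(2)[of 0] t5 by (simp add: \<beta>_def)
      moreover have "a = a'" by (intro PiE_ext[OF a]) (use eq(1) in auto)
      ultimately show "p = p'" by (simp add: ab)
    qed
  qed
  then show ?thesis by (simp add: card_cartesian_product)
qed

end

lemma cycle_edges_comp: "cycle_edges t (f \<circ> g) = (\<lambda>e. f ` e) ` cycle_edges t g"
  by (auto simp: cycle_edges_def image_image)

lemma cycle_edges_restrict: "t \<ge> 2 \<Longrightarrow> cycle_edges t (restrict g {..<t}) = cycle_edges t g"
  unfolding cycle_edges_def by (rule image_cong) auto

lemma Union_cycle_edges: "\<Union> (cycle_edges t g) \<subseteq> g ` {..<t}"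
proof
  fix x assume "x \<in> \<Union> (cycle_edges t g)"
  then obtain i where "i < t" "x = g i \<or> x = g (Suc i mod t)" by (auto simp: cycle_edges_def)
  moreover have "Suc i mod t < t" using \<open>i < t\<close> by auto
  ultimately show "x \<in> g ` {..<t}" by auto
qed

context layered_host begin

context
  fixes \<iota> :: "'a \<times> 'a \<Rightarrow> nat" and n :: nat
  assumes inj_\<iota>: "inj_on \<iota> (K \<times> K)" and \<iota>_lt: "\<iota> ` (K \<times> K) \<subseteq> {..<n}"
begin

definition board_edges :: "nat set set" where "board_edges = (\<lambda>e. \<iota> ` e) ` host_edges"

lemma board_edges_sub: "board_edges \<subseteq> board n"
proof
  fix e assume "e \<in> board_edges"
  then obtain u v where e: "e = \<iota> ` {u, v}" "adj u v" by (auto simp: board_edges_def host_edges_def)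
  then have "u \<in> K \<times> K" "v \<in> K \<times> K" "u \<noteq> v" using adj_irrefl by (auto simp: adj_def)
  then have "\<iota> u \<noteq> \<iota> v" "\<iota> u < n" "\<iota> v < n" using inj_\<iota> \<iota>_lt by (auto simp: inj_on_eq_iff)
  then show "e \<in> board n" using e by simp
qed

lemma inv_board_edge:
  assumes "{x, y} \<in> board_edges"
  shows "{inv_into (K \<times> K) \<iota> x, inv_into (K \<times> K) \<iota> y} \<in> host_edges" "x \<in> \<iota> ` (K \<times> K)"
proof -
  obtain u v where e: "{x, y} = \<iota> ` {u, v}" "adj u v" using assms by (auto simp: board_edges_def host_edges_def)
  have uv: "u \<in> K \<times> K" "v \<in> K \<times> K" using e(2) by (auto simp: adj_def)
  have "inv_into (K \<times> K) \<iota> ` {x, y} = {u, v}"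
    unfolding e(1) using uv by (simp add: inv_into_f_f[OF inj_\<iota>] del: mem_Sigma_iff)
  then show "{inv_into (K \<times> K) \<iota> x, inv_into (K \<times> K) \<iota> y} \<in> host_edges"
    using e(2) by (simp add: adj_iff_edge)
  have "x \<in> \<iota> ` {u, v}" using e(1) by blast
  then show "x \<in> \<iota> ` (K \<times> K)" using uv by blast
qed

lemma board_C4_free: "free_of (cycle_graph 4) ({..<n}, board_edges)"
proof -
  have "\<not> cyc board_edges 4 h" for h
  proof
    assume h: "cyc board_edges 4 h"
    have "h i \<in> \<iota> ` (K \<times> K)" if "i < 4" for i
      using h that inv_board_edge(2) unfolding cyc_def by blast
    then have "inj_on (inv_into (K \<times> K) \<iota> \<circ> h) {..<4}"
      using h by (intro comp_inj_on inj_on_subset[OF inj_on_inv_into]) (auto simp: cyc_def)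
    then have "cyc host_edges 4 (inv_into (K \<times> K) \<iota> \<circ> h)"
      using h inv_board_edge(1) unfolding cyc_def comp_def by blast
    then show False using host_C4_free by blast
  qed
  then show ?thesis by (subst free_of_cycle_iff) (use board_edges_sub in auto)
qed

lemma layered_cycle_edges: "g \<in> layered_cycles \<Longrightarrow> cycle_edges t g \<subseteq> host_edges"
  by (auto simp: layered_cycles_def cycle_edges_def adj_iff_edge)

lemma layered_cycle_in: "g \<in> layered_cycles \<Longrightarrow> g ` {..<t} \<subseteq> K \<times> K"
  by (auto simp: layered_cycles_def PiE_def Pi_def)

text \<open>
  Two distinct edges cover at least three vertices.
\<close>

lemma card_layered_cycles_through_2_edges:
  assumes "e \<noteq> f"
  shows "card {g \<in> layered_cycles. e \<in> cycle_edges t (\<iota> \<circ> g) \<and> f \<in> cycle_edges t (\<iota> \<circ> g)} \<le> card K ^ (t - 4)"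
proof (cases "{g \<in> layered_cycles. e \<in> cycle_edges t (\<iota> \<circ> g) \<and> f \<in> cycle_edges t (\<iota> \<circ> g)} = {}")
  case False
  define A where "A = {g \<in> layered_cycles. e \<in> cycle_edges t (\<iota> \<circ> g) \<and> f \<in> cycle_edges t (\<iota> \<circ> g)}"
  obtain h where h: "h \<in> A" using False by (auto simp: A_def)
  have E: "e \<in> board_edges" "f \<in> board_edges"
    using h layered_cycle_edges[of h] by (auto simp: A_def cycle_edges_comp board_edges_def)
  then have c: "card e = 2" "card f = 2" "finite e" "finite f"
    using board_edges_sub by (auto simp: nsets_def)
  have "\<not> f \<subseteq> e" using card_subset_eq[of e f] c assms by auto
  then obtain y3 where y3: "y3 \<in> f" "y3 \<notin> e" by auto
  obtain y1 y2 where y12: "e = {y1, y2}" "y1 \<noteq> y2" using c(1) by (auto simp: card_2_iff)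
  have through: "{y1, y2, y3} \<subseteq> \<iota> ` g ` {..<t}" if "g \<in> A" for g
    using Union_cycle_edges[of t "\<iota> \<circ> g"] that y12 y3 by (auto simp: A_def image_comp)
  define j where "j = inv_into (K \<times> K) \<iota>"
  have K: "y \<in> \<iota> ` (K \<times> K)" if "y \<in> {y1, y2, y3}" for y
    using through[OF h] layered_cycle_in[of h] h that by (auto simp: A_def)
  have "j ` {y1, y2, y3} \<subseteq> g ` {..<t}" if g: "g \<in> A" for g
  proof
    fix x assume "x \<in> j ` {y1, y2, y3}"
    then obtain i where i: "i < t" "x = j (\<iota> (g i))" using through[OF g] by auto
    have "g i \<in> K \<times> K" using layered_cycle_in[of g] g i by (auto simp: A_def)
    then have "x = g i" unfolding i j_def by (rule inv_into_f_f[OF inj_\<iota>])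
    then show "x \<in> g ` {..<t}" using i by auto
  qed
  then have "A \<subseteq> {g \<in> layered_cycles. {j y1, j y2, j y3} \<subseteq> g ` {..<t}}" by (auto simp: A_def)
  then have "card A \<le> card {g \<in> layered_cycles. {j y1, j y2, j y3} \<subseteq> g ` {..<t}}"
    using finite_layered_cycles by (intro card_mono) auto
  also have "\<dots> \<le> card K ^ (t - 4)"
  proof (rule card_layered_cycles_through_3)
    have "inj_on j {y1, y2, y3}" unfolding j_def
      by (rule inj_on_subset[OF inj_on_inv_into[OF order_refl]]) (use K in blast)
    then show "distinct [j y1, j y2, j y3]" using y12 y3 by (auto simp: inj_on_def)
  qed
  finally show ?thesis by (simp add: A_def)
next
  case True
  then show ?thesis by (simp only: card.empty le0)
qed

lemma card_layered_cycles_in_le_copies: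
  assumes "C \<subseteq> board_edges"
  shows "card {g \<in> layered_cycles. cycle_edges t (\<iota> \<circ> g) \<subseteq> C} \<le> card (copies (cycle_graph t) ({..<n}, C))"
proof -
  let ?A = "{g \<in> layered_cycles. cycle_edges t (\<iota> \<circ> g) \<subseteq> C}"
  define r where "r g = restrict (\<iota> \<circ> g) {..<t}" for g
  have inj: "inj_on r ?A"
  proof (rule inj_onI)
    fix g g' assume g: "g \<in> ?A" "g' \<in> ?A" "r g = r g'"
    show "g = g'"
    proof (rule extensionalityI[of _ "{..<t}"])
      fix i assume i: "i \<in> {..<t}"
      have "\<iota> (g i) = \<iota> (g' i)" using fun_cong[OF g(3), of i] i by (simp add: r_def)
      moreover have "g i \<in> K \<times> K" "g' i \<in> K \<times> K" using layered_cycle_in g(1,2) i by blast+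
      ultimately show "g i = g' i" using inj_\<iota> by (meson inj_onD)
    qed (use g in \<open>auto simp: layered_cycles_def PiE_def\<close>)
  qed
  have "card (r ` ?A) \<le> card (copies (cycle_graph t) ({..<n}, C))"
  proof (rule card_layered_cycles_le_copies[where layer = "lay \<circ> fst \<circ> inv_into (K \<times> K) \<iota>"])
    fix g assume "g \<in> r ` ?A"
    then obtain h where h: "g = r h" "h \<in> layered_cycles" "cycle_edges t (\<iota> \<circ> h) \<subseteq> C" by auto
    show "g \<in> extensional {..<t}" by (simp add: h r_def)
    show "cycle_edges t g \<subseteq> C" using h t5 by (simp add: r_def cycle_edges_restrict)
    show "(lay \<circ> fst \<circ> inv_into (K \<times> K) \<iota>) (g i) = i" if "i < t" for i
    proof -
      have "h i \<in> K \<times> K" using layered_cycle_in h(2) that by blast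
      then have "inv_into (K \<times> K) \<iota> (g i) = h i" using that by (simp only: h r_def restrict_apply lessThan_iff if_True comp_apply inv_into_f_f[OF inj_\<iota>])
      then show ?thesis using h(2) that by (simp add: layered_cycles_def)
    qed
  qed (use t5 assms board_edges_sub in auto)
  then show ?thesis using card_image[OF inj] by simp
qed

lemma game_number_ge_layered_cycles:
  "card layered_cycles \<le> 2 ^ t * cycle_game n t 4 + 2 ^ t * card K ^ (t - 1)"
proof -
  have "(\<Sum>g | g \<in> layered_cycles \<and> cycle_edges t (\<iota> \<circ> g) \<inter> {} = {}. 2 ^ card (cycle_edges t (\<iota> \<circ> g) \<inter> {}))
    \<le> 2 ^ t * game_value n (cycle_graph t) (cycle_graph 4) Constructor {} {}
      + 2 ^ t * card K ^ (t - 4) * card (board_edges - ({} \<union> {}))"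
  proof (rule game_value_ge_potential[OF board_edges_sub board_C4_free finite_layered_cycles])
    show "cycle_edges t (\<iota> \<circ> g) \<subseteq> board_edges \<and> card (cycle_edges t (\<iota> \<circ> g)) \<le> t" if "g \<in> layered_cycles" for g
    proof
      show "cycle_edges t (\<iota> \<circ> g) \<subseteq> board_edges"
        using layered_cycle_edges[OF that] by (auto simp: cycle_edges_comp board_edges_def)
      show "card (cycle_edges t (\<iota> \<circ> g)) \<le> t"
        unfolding cycle_edges_def using card_image_le[of "{..<t}"] by simp
    qed
  qed (auto intro: card_layered_cycles_through_2_edges card_layered_cycles_in_le_copies)
  then have "card layered_cycles \<le> 2 ^ t * cycle_game n t 4
      + 2 ^ t * card K ^ (t - 4) * card board_edges" by (simp add: game_number_def)
  also have "card board_edges \<le> card K ^ 3"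
  proof -
    have "finite host_edges" by (rule finite_subset[OF host_edges_sub]) (simp add: finite_imp_finite_nsets finite_K)
    then show ?thesis using card_host_edges card_image_le le_trans unfolding board_edges_def by blast
  qed
  also have "2 ^ t * card K ^ (t - 4) * card K ^ 3 = 2 ^ t * card K ^ (t - 1)"
  proof -
    have "t - 4 + 3 = t - 1" using t5 by simp
    then show ?thesis by (simp add: mult.assoc flip: power_add)
  qed
  finally show ?thesis by simp
qed

end

end

section \<open>Lower bound for k = 2\<close>

lemma exists_large_fibre:
  assumes "finite P" "finite K" "K \<noteq> {}" "f ` P \<subseteq> K"
  shows "\<exists>y\<in>K. card P \<le> card K * card {x \<in> P. f x = y}"
proof -
  let ?c = "\<lambda>y. card {x \<in> P. f x = y}"
  have "Max (?c ` K) \<in> ?c ` K" using assms by (intro Max_in) auto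
  then obtain y where y: "y \<in> K" "?c y = Max (?c ` K)" by auto
  have "card P \<le> card (f ` P) * ?c y"
  proof (rule card_le_fibres[OF assms(1)])
    fix z assume "z \<in> f ` P"
    then have "z \<in> K" using assms(4) by auto
    then show "?c z \<le> ?c y" unfolding y(2) using assms(2) by (intro Max_ge) auto
  qed
  also have "\<dots> \<le> card K * ?c y" using assms by (intro mult_right_mono card_mono) auto
  finally show ?thesis using y(1) by blast
qed

text \<open>
  The field elements are numbered and sorted into layers by residues mod t, so every layer has at least
  q div t elements. By the pigeonhole principle some value of \<open>closing_sum\<close> is attained by at least a
  fraction 1/q of all choices of first coordinates, which the q choices for the second coordinate
  of the first vertex make up for.
\<close>

lemma game_number_C4_ge:
  assumes t: "t \<ge> 5" and m: "m \<ge> 1" and n: "(2 ^ m) ^ 2 \<le> n"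
  shows "(2 ^ m div t) ^ t \<le> 2 ^ t * cycle_game n t 4 + 2 ^ t * (2 ^ m) ^ (t - 1)"
proof -
  obtain K :: "bit alg_closure set" where K: "finite K" "card K = 2 ^ m" "0 \<in> K"
    "\<And>x y. x \<in> K \<Longrightarrow> y \<in> K \<Longrightarrow> x + y \<in> K" "\<And>x y. x \<in> K \<Longrightarrow> y \<in> K \<Longrightarrow> x * y \<in> K"
    using exists_field_of_order_power_2[OF m] by blast
  define q where "q = (2::nat) ^ m"
  obtain idx where idx: "bij_betw idx K {0..<q}"
    using ex_bij_betw_finite_nat[OF K(1)] K(2) by (auto simp: q_def)
  define lay where "lay x = idx x mod t" for x
  define P where "P = (\<Pi>\<^sub>E i\<in>{..<t}. {x \<in> K. lay x = i})"
  have fibre: "q div t \<le> card {x \<in> K. lay x = i}" if "i < t" for i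
  proof -
    let ?J = "(\<lambda>j. i + t * j) ` {..<q div t}"
    have J: "?J \<subseteq> idx ` {x \<in> K. lay x = i}"
    proof clarify
      fix j assume "j < q div t"
      then have "Suc j \<le> q div t" by simp
      then have "t * Suc j \<le> t * (q div t)" by (rule mult_le_mono2)
      also have "\<dots> \<le> q" by simp
      finally have "i + t * j < q" using that by simp
      then have "i + t * j \<in> idx ` K" using idx by (simp add: bij_betw_def)
      then obtain x where x: "i + t * j = idx x" "x \<in> K" by (rule imageE)
      have "(i + t * j) mod t = i" using that by simp
      then have "x \<in> {x \<in> K. lay x = i}" using x by (simp add: lay_def)
      then show "i + t * j \<in> idx ` {x \<in> K. lay x = i}" using x(1) by (rule rev_image_eqI)
    qed
    have "card ?J = q div t" using t by (subst card_image) (auto simp: inj_on_def)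
    also have "card ?J \<le> card (idx ` {x \<in> K. lay x = i})" by (rule card_mono[OF _ J]) (use K(1) in auto)
    also have "\<dots> \<le> card {x \<in> K. lay x = i}" by (rule card_image_le) (use K(1) in auto)
    finally show ?thesis using \<open>card ?J = q div t\<close> by simp
  qed
  have finP: "finite P" unfolding P_def by (rule finite_PiE) (use K(1) in auto)
  have cP: "(q div t) ^ t \<le> card P"
  proof -
    have "(q div t) ^ t = (\<Prod>i<t. q div t)" by simp
    also have "\<dots> \<le> (\<Prod>i<t. card {x \<in> K. lay x = i})" by (rule prod_mono) (use fibre in auto)
    finally show ?thesis by (simp add: P_def card_PiE)
  qed
  have "closing_sum t ` P \<subseteq> K"
  proof clarify
    fix a assume "a \<in> P"
    then have a: "a i \<in> K" if "i < t" for i using that by (auto simp: P_def PiE_def Pi_def)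
    have "(\<Sum>j<i. a j * a (Suc j)) \<in> K" if "i < t" for i
      using that
    proof (induction i)
      case (Suc i)
      then show ?case using a[of i] a[of "Suc i"] by (simp add: K(4,5))
    qed (simp add: K(3))
    then show "closing_sum t a \<in> K" unfolding closing_sum_def using t a by (intro K(4,5)) auto
  qed
  then obtain lam where lam: "card P \<le> card K * card {a \<in> P. closing_sum t a = lam}"
    using exists_large_fibre[OF finP K(1)] K(3) by blast
  interpret layered_host K t lay lam
    by standard (use K t in \<open>auto simp: lay_def\<close>)
  have "card (K \<times> K) \<le> card {..<n}" using n K(2) by (simp add: card_cartesian_product power2_eq_square)
  then obtain \<iota> where \<iota>: "inj_on \<iota> (K \<times> K)" "\<iota> ` (K \<times> K) \<subseteq> {..<n}"
    using card_le_inj[of "K \<times> K" "{..<n}"] K(1) by blast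
  have "card {a \<in> P. closing_sum t a = lam} * card K \<le> card layered_cycles"
    unfolding P_def by (rule card_layered_cycles_ge[OF char_2])
  then have "(q div t) ^ t \<le> card layered_cycles" using cP lam by (simp add: mult.commute)
  also have "\<dots> \<le> 2 ^ t * cycle_game n t 4 + 2 ^ t * card K ^ (t - 1)"
    by (rule game_number_ge_layered_cycles[OF \<iota>])
  finally show ?thesis by (simp add: q_def K(2))
qed

text \<open>
  With q the largest power of 2 such that q^2 \<le> n, the loss q^(t-1) is at most half of the main term
  (q/(4t))^t as soon as q \<ge> L.
\<close>

lemma game_number_lower_C4:
  assumes t: "t \<ge> 5"
  shows "\<exists>c>0. \<exists>N. \<forall>n\<ge>N. c * real n powr (real t / 2) \<le> real (cycle_game n t 4)"
proof -
  \<comment> \<open>q^(t-1) \<le> (q/(4t))^t / 2 holds exactly from q = L on\<close>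
  define L where "L = 2 * (4 * real t) ^ t"
  define N where "N = nat \<lceil>(2 * L) ^ 2\<rceil> + 4"
  define c where "c = 1 / (2 * (8 * real t) ^ t)"
  have "c > 0" using t by (simp add: c_def)
  moreover have "c * real n powr (real t / 2) \<le> real (cycle_game n t 4)" if nN: "n \<ge> N" for n
  proof -
    have n4: "n \<ge> 4" using nN by (simp add: N_def)
    define m where "m = (GREATEST m. 4 ^ m \<le> n)"
    have bd: "m \<le> n" if "(4::nat) ^ m \<le> n" for m
    proof -
      have "m < 4 ^ m" by (rule power_gt_expt) simp
      then show ?thesis using that by linarith
    qed
    have m1: "(4::nat) ^ m \<le> n" unfolding m_def by (rule GreatestI_nat[where k = 1, OF _ bd]) (use n4 in auto)
    have m2: "m \<ge> 1" unfolding m_def by (rule Greatest_le_nat[OF _ bd]) (use n4 in auto)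
    have m3: "n < 4 ^ Suc m"
    proof (rule ccontr)
      assume "\<not> n < 4 ^ Suc m"
      then have "4 ^ Suc m \<le> n" by simp
      then have "Suc m \<le> m" unfolding m_def by (rule Greatest_le_nat[OF _ bd])
      then show False by simp
    qed
    define q where "q = (2::nat) ^ m"
    have q4: "(4::nat) ^ m = q ^ 2" by (simp add: q_def power_mult[symmetric] mult.commute[of m] power_mult)
    have qn: "sqrt (real n) \<le> 2 * real q"
    proof -
      have "n \<le> 4 * q ^ 2" using m3 q4 by simp
      then have "real n \<le> real (4 * q ^ 2)" by (simp only: of_nat_le_iff)
      then have "real n \<le> (2 * real q) ^ 2" by (simp add: power_mult_distrib)
      then show ?thesis by (simp add: real_le_lsqrt)
    qed
    have qL: "L \<le> real q"
    proof -
      have "(2 * L) ^ 2 \<le> real n" using nN unfolding N_def by linarith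
      then have "2 * L \<le> sqrt (real n)" by (rule real_le_rsqrt)
      then show ?thesis using qn by linarith
    qed
    have L4: "4 * real t \<le> L"
    proof -
      have "(4 * real t) ^ 1 \<le> (4 * real t) ^ t" using t by (intro power_increasing) auto
      then show ?thesis unfolding L_def power_one_right using t by linarith
    qed
    have L0: "L > 0" using L4 t by simp
    have div: "real q / (2 * real t) \<le> real (q div t)"
    proof -
      have "real q / real t - 1 \<le> real (q div t)"
      proof -
        have "q mod t < t" using t by simp
        then have "q \<le> t * (q div t) + t" using mult_div_mod_eq[of t q] by linarith
        then have "real q \<le> real (t * (q div t) + t)" by (simp only: of_nat_le_iff)
        then show ?thesis using t by (simp add: field_simps)
      qed
      moreover have "1 \<le> real q / (2 * real t)" using L4 qL t by (simp add: le_divide_eq)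
      moreover have "real q / real t = 2 * (real q / (2 * real t))" by simp
      ultimately show ?thesis by linarith
    qed
    define G where "G = real (cycle_game n t 4)"
    have "(q div t) ^ t \<le> 2 ^ t * cycle_game n t 4 + 2 ^ t * q ^ (t - 1)"
      unfolding q_def by (rule game_number_C4_ge[OF t m2]) (use m1 q4 q_def in auto)
    then have "real ((q div t) ^ t) \<le> real (2 ^ t * cycle_game n t 4 + 2 ^ t * q ^ (t - 1))"
      by (simp only: of_nat_le_iff)
    then have 1: "real (q div t) ^ t \<le> 2 ^ t * (G + real q ^ (t - 1))"
      by (simp add: G_def algebra_simps)
    have "(real q / (2 * real t)) ^ t \<le> real (q div t) ^ t"
      using div by (intro power_mono) auto
    then have "2 ^ t * (real q / (4 * real t)) ^ t \<le> 2 ^ t * (G + real q ^ (t - 1))"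
    proof -
      have "real q / (2 * real t) = 2 * (real q / (4 * real t))" by simp
      then have "(real q / (2 * real t)) ^ t = 2 ^ t * (real q / (4 * real t)) ^ t"
        by (metis power_mult_distrib)
      then show ?thesis using 1 \<open>(real q / (2 * real t)) ^ t \<le> real (q div t) ^ t\<close> by linarith
    qed
    then have 2: "(real q / (4 * real t)) ^ t \<le> G + real q ^ (t - 1)" by simp
    have 3: "real q ^ (t - 1) \<le> (real q / (4 * real t)) ^ t / 2"
    proof -
      have "real q ^ t = real q * real q ^ (t - 1)" using t by (cases t) simp_all
      moreover have "L * real q ^ (t - 1) \<le> real q * real q ^ (t - 1)" using qL by (intro mult_right_mono) auto
      ultimately have "L * real q ^ (t - 1) \<le> real q ^ t" by simp
      then have "real q ^ (t - 1) \<le> real q ^ t / L" using L0 by (simp add: le_divide_eq mult.commute)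
      also have "\<dots> = (real q / (4 * real t)) ^ t / 2" unfolding L_def power_divide by simp
      finally show ?thesis .
    qed
    have "c * real n powr (real t / 2) = (sqrt (real n) / (8 * real t)) ^ t / 2"
    proof -
      have "real n powr (real t / 2) = sqrt (real n) ^ t"

      proof -
        have "sqrt (real n) ^ t = (real n powr (1/2)) powr real t"
          using n4 by (subst powr_realpow) (simp_all add: powr_half_sqrt)
        then show ?thesis by (simp add: powr_powr)
      qed
      then show ?thesis unfolding c_def power_divide by simp
    qed
    also have "\<dots> \<le> (real q / (4 * real t)) ^ t / 2"
      using qn t by (intro divide_right_mono power_mono) (auto simp: field_simps)
    also have "\<dots> \<le> G" using 2 3 by linarith
    finally show ?thesis by (simp add: G_def)
  qed
  ultimately show ?thesis by blast
qed

section \<open>Blow-ups of a cycle\<close>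

text \<open>
  The class of a vertex is its residue mod t. Odd classes are blown up; in an even class only the hub has
  edges, and a hub that has not been chosen yet is \<open>None\<close>.
\<close>

definition blowup :: "nat \<Rightarrow> nat \<Rightarrow> (nat \<Rightarrow> nat option) \<Rightarrow> nat set set" where
  "blowup n t hub = {{u, v} | u v. u < n \<and> v < n \<and> v mod t = Suc (u mod t) mod t \<and>
     (even (u mod t) \<longrightarrow> hub (u mod t) = Some u) \<and> (even (v mod t) \<longrightarrow> hub (v mod t) = Some v)}"

lemma blowup_edge:
  assumes "{u, v} \<in> blowup n t hub"
  shows "consecutive t (u mod t) (v mod t)" "even (u mod t) \<Longrightarrow> hub (u mod t) = Some u"
  using assms by (auto simp: blowup_def doubleton_eq_iff consecutive_def)

lemma blowup_mono: "hub \<subseteq>\<^sub>m hub' \<Longrightarrow> blowup n t hub \<subseteq> blowup n t hub'"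
proof
  fix e assume h: "hub \<subseteq>\<^sub>m hub'" and "e \<in> blowup n t hub"
  then obtain u v where uv: "e = {u, v}" "u < n" "v < n" "v mod t = Suc (u mod t) mod t"
     "even (u mod t) \<longrightarrow> hub (u mod t) = Some u" "even (v mod t) \<longrightarrow> hub (v mod t) = Some v"
    by (auto simp: blowup_def)
  have "even (x mod t) \<longrightarrow> hub' (x mod t) = Some x" if "even (x mod t) \<longrightarrow> hub (x mod t) = Some x" for x
    using that h by (auto simp: map_le_def dom_def)
  then show "e \<in> blowup n t hub'" using uv unfolding blowup_def by blast
qed

lemma blowup_sub: "t \<ge> 2 \<Longrightarrow> blowup n t hub \<subseteq> board n"
proof
  fix e assume t: "t \<ge> 2" and "e \<in> blowup n t hub"
  then obtain u v where uv: "e = {u, v}" "u < n" "v < n" "v mod t = Suc (u mod t) mod t"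
    by (auto simp: blowup_def)
  have "u mod t < t" using t by simp
  then have "v mod t \<noteq> u mod t" using uv(4) Suc_mod_neq(1)[OF t, of "u mod t"] by simp
  then show "e \<in> board n" using uv by auto
qed

lemma consecutive_iff:
  assumes "i < t" "j < t"
  shows "consecutive t i j \<longleftrightarrow> j = Suc i \<or> (Suc i = t \<and> j = 0) \<or> i = Suc j \<or> (Suc j = t \<and> i = 0)"
  using assms by (auto simp: consecutive_def mod_Suc)

text \<open>
  Project a cycle of length l \<ge> 6 to residues mod t, which gives a closed walk w of length l on the
  cycle of length t. The walk cannot turn back at an odd residue, because both neighbours there would
  be the same hub. If it turned back at an even residue, the two vertices next to that hub would have
  the same residue m, and their other neighbours would both be the hub on the other side of m, although
  they are four steps apart on the cycle and thus distinct. Hence w runs around monotonically, t divides l, and since a hub is visited only once, l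
  divides t.
\<close>

lemma blowup_cycle_length:
  assumes t: "t \<ge> 4" and l: "l \<ge> 6" and g: "cyc (blowup n t hub) l g"
  shows "l = t"
proof -
  define G where "G i = g (i mod l)" for i
  define w where "w i = G i mod t" for i
  have wt: "w i < t" for i using t by (simp add: w_def)
  have edge: "{G i, G (Suc i)} \<in> blowup n t hub" for i
  proof -
    have "{g (i mod l), g (Suc (i mod l) mod l)} \<in> blowup n t hub"
      using g l by (simp add: cyc_def)
    then show ?thesis by (simp add: G_def mod_Suc_eq)
  qed
  have con: "consecutive t (w i) (w (Suc i))" for i
    using blowup_edge(1)[OF edge] by (simp add: w_def)
  have hub: "i mod l = j mod l" if "even (w i)" "w i = w j" for i j
  proof -
    have "hub (w x) = Some (G x)" if "even (w x)" for x
      using blowup_edge(2)[OF edge[of x]] that by (simp add: w_def)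
    from this[of i] this[of j] that have "hub (w i) = Some (G i)" "hub (w j) = Some (G j)"
      by simp_all
    then have "G i = G j" using that(2) by (metis option.inject)
    moreover have "i mod l < l" "j mod l < l" using l by auto
    ultimately show ?thesis using g by (auto simp: cyc_def G_def inj_on_def)
  qed
  have w_l: "w (i + l) = w i" for i by (simp add: w_def G_def)
  have dvd_if: "m dvd d" if "x mod m = (x + d) mod m" for x d m :: nat
  proof -
    have "(x + d) mod m = x mod m \<longleftrightarrow> m dvd (x + d) - x" by (rule mod_eq_dvd_iff_nat) simp
    then show ?thesis using that[symmetric] by simp
  qed
  have no_shift: "(i + d) mod l \<noteq> i mod l" if "0 < d" "d < l" for i d
  proof
    assume "(i + d) mod l = i mod l"
    then have "l dvd d" using dvd_if[of i l d] by metis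
    then show False using that by (auto dest: dvd_imp_le)
  qed
  have oddeven: "even (w (Suc i))" if "odd (w i)" for i
  proof -
    have "w (Suc i) = Suc (w i) \<or> w (Suc i) = 0 \<or> w i = Suc (w (Suc i)) \<or> w i = 0"
      using con[of i] unfolding consecutive_iff[OF wt[of i] wt[of "Suc i"]] by metis
    then show ?thesis using that by auto
  qed
  have oddeven': "even (w i)" if "odd (w (Suc i))" for i
    using oddeven[of i] that by metis
  have hub_turn: "w i \<noteq> w (Suc (Suc i))" if "even (w i)" for i
  proof
    assume "w i = w (Suc (Suc i))"
    then have "i mod l = Suc (Suc i) mod l" by (rule hub[OF that])
    moreover have "(i + 2) mod l \<noteq> i mod l" using l by (intro no_shift) auto
    ultimately show False by simp
  qed
  have turn: "w i \<noteq> w (Suc (Suc i))" for i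
  proof
    assume eq: "w i = w (Suc (Suc i))"
    then have od: "odd (w i)" using hub_turn by blast
    \<comment> \<open>the predecessor of i, shifted by a full turn to avoid subtraction\<close>
    define j where "j = i + l - 1"
    have j: "Suc j = i + l" using l by (simp add: j_def)
    have s1: "w (Suc j) = w i" "w (Suc (Suc j)) = w (Suc i)" "w (Suc (Suc (Suc j))) = w i"
      using w_l[of i] w_l[of "Suc i"] w_l[of "Suc (Suc i)"] j eq by (simp_all add: j)
    define a where "a = w j"
    define b where "b = w (Suc i)"
    define c where "c = w (Suc (Suc (Suc (Suc j))))"
    define m where "m = w i"
    have ev: "even a" "even b" using oddeven'[of j] oddeven[of i] od s1 by (auto simp: a_def b_def)
    have ne: "a \<noteq> b" using hub_turn[of j] ev s1 by (auto simp: a_def b_def)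
    have ne2: "b \<noteq> c" using hub_turn[of "Suc (Suc j)"] ev s1 by (auto simp: c_def b_def)
    have "consecutive t a m" "consecutive t m b" "consecutive t m c"
      using con[of j] con[of i] con[of "Suc (Suc (Suc j))"] s1 by (auto simp: a_def b_def c_def m_def)
    moreover have lt: "a < t" "b < t" "c < t" "m < t" using wt by (auto simp: a_def b_def c_def m_def)
    ultimately have "a = c" using ne ne2 t
      unfolding consecutive_iff[OF lt(1,4)] consecutive_iff[OF lt(4,2)] consecutive_iff[OF lt(4,3)]
      by linarith
    then have "w j = w (j + 4)" by (simp add: a_def c_def numeral_eq_Suc)
    then have "j mod l = (j + 4) mod l" using ev(1) hub[of j "j + 4"] by (simp add: a_def)
    then show False using no_shift[of 4 j] l by simp
  qed
  have inj: "x = y" if "Suc x mod t = Suc y mod t" "x < t" "y < t" for x y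
  proof -
    have "Suc z mod t = (if Suc z = t then 0 else Suc z)" if "z < t" for z using that by (simp add: mod_Suc)
    from this[OF that(2)] this[OF that(3)] show ?thesis using that(1) by (simp split: if_splits)
  qed
  have per: "w (i + t) = w i \<and> t dvd l" for i
  proof (cases "w 1 = Suc (w 0) mod t")
    case True
    have up: "w (Suc i) = Suc (w i) mod t" for i
    proof (induction i)
      case (Suc i)
      have "w (Suc i) \<noteq> Suc (w (Suc (Suc i))) mod t"
        using turn[of i] inj[of "w i" "w (Suc (Suc i))"] wt[of i] wt[of "Suc (Suc i)"] Suc by metis
      then show ?case using con[of "Suc i"] unfolding consecutive_def by blast
    qed (use True in simp)
    have w: "w i = (w 0 + i) mod t" for i
    proof (induction i)
      case (Suc i)
      have "w (Suc i) = Suc ((w 0 + i) mod t) mod t" using up[of i] Suc by metis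
      then show ?case by (simp add: mod_Suc_eq)
    qed (use wt in simp)
    have "w 0 = (w 0 + l) mod t" using w[of l] w_l[of 0] by (metis add_0)
    then have "t dvd l" using wt[of 0] dvd_if[of "w 0" t l] by (metis mod_less)
    moreover have "w (i + t) = w i" using w[of "i + t"] w[of i] by (metis add.assoc mod_add_self2)
    ultimately show ?thesis by simp
  next
    case False
    then have F: "w 0 = Suc (w 1) mod t" using con[of 0] unfolding consecutive_def by simp
    have down: "w i = Suc (w (Suc i)) mod t" for i
    proof (induction i)
      case (Suc i)
      have "w (Suc (Suc i)) \<noteq> Suc (w (Suc i)) mod t" using turn[of i] Suc by metis
      then show ?case using con[of "Suc i"] unfolding consecutive_def by blast
    qed (use F in simp)
    have w: "w 0 = (w i + i) mod t" for i
    proof (induction i)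
      case (Suc i)
      have "(w i + i) mod t = (Suc (w (Suc i)) mod t + i) mod t" using down[of i] by simp
      then show ?case using Suc by (simp add: mod_add_left_eq)
    qed (use wt in simp)
    have "w 0 = (w 0 + l) mod t" using w[of l] w_l[of 0] by (metis add_0)
    then have "t dvd l" using wt[of 0] dvd_if[of "w 0" t l] by (metis mod_less)
    moreover have "w (i + t) = w i"
    proof -
      have "(w (i + t) + i) mod t = (w i + i) mod t" using w[of i] w[of "i + t"] by (metis add.assoc mod_add_self2)
      then have "w (i + t) mod t = w i mod t" by (simp add: nat_mod_eq_iff)
      then show ?thesis using wt by simp
    qed
    ultimately show ?thesis by simp
  qed
  obtain i where "even (w i)" using oddeven[of 0] by blast
  then have "i mod l = (i + t) mod l" using hub[of i "i + t"] per[of i] by metis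
  then have "l dvd t" by (rule dvd_if)
  moreover have "t dvd l" using per by simp
  ultimately show ?thesis by (rule dvd_antisym)
qed

lemma blowup_free:
  assumes "t \<ge> 4" "k \<ge> 3" "t \<noteq> 2 * k"
  shows "free_of (cycle_graph (2 * k)) ({..<n}, blowup n t hub)"
proof (subst free_of_cycle_iff)
  show "\<nexists>g. cyc (blowup n t hub) (2 * k) g"
    using blowup_cycle_length[OF assms(1), of "2 * k" n hub] assms(2,3) by auto
qed (use assms blowup_sub[of t n hub] in auto)

text \<open>
  Two disjoint edges of a cycle cannot both contain the centre of the star.
\<close>

lemma star_free:
  assumes "l \<ge> 4" "(\<lambda>a. {h, a}) ` A \<subseteq> board n"
  shows "free_of (cycle_graph l) ({..<n}, (\<lambda>a. {h, a}) ` A)"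
proof -
  have "\<not> cyc ((\<lambda>a. {h, a}) ` A) l g" for g
  proof
    assume g: "cyc ((\<lambda>a. {h, a}) ` A) l g"
    have "h \<in> {g i, g (Suc i mod l)}" if "i < l" for i using g that by (auto simp: cyc_def)
    from this[of 0] this[of 2] have "h \<in> {g 0, g (Suc 0 mod l)}" "h \<in> {g 2, g (Suc 2 mod l)}"
      using assms(1) by simp_all
    moreover have "Suc 0 mod l = 1" "Suc 2 mod l = 3" using assms(1) by simp_all
    ultimately have "h = g 0 \<or> h = g 1" "h = g 2 \<or> h = g 3" by simp_all
    moreover have inj: "g i \<noteq> g j" if "i < l" "j < l" "i \<noteq> j" for i j
      using g that by (auto simp: cyc_def inj_on_def)
    have "g 0 \<noteq> g 2" "g 0 \<noteq> g 3" "g 1 \<noteq> g 2" "g 1 \<noteq> g 3"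
      using assms(1) inj[of 0 2] inj[of 0 3] inj[of 1 2] inj[of 1 3] by simp_all
    ultimately show False by metis
  qed
  then show ?thesis using assms by (subst free_of_cycle_iff) auto
qed

section \<open>Building a blow-up against Blocker\<close>

text \<open>
  Each round uses up one edge of Constructor and spoils at most one for her. More than 2 m available edges
  also ensure that the game does not end before the m-th answer of Blocker.
\<close>

lemma force_star_unclaimed:
  assumes CB: "C \<subseteq> board n" "B \<subseteq> board n" and A: "finite A" "card A > 2 * m"
    and un: "\<And>a. a \<in> A \<Longrightarrow> {h, a} \<in> unclaimed n C B"
    and free: "free_of F ({..<n}, C \<union> (\<lambda>a. {h, a}) ` A)"
    and goal: "\<And>A' B'. A' \<subseteq> A \<Longrightarrow> card A' = m \<Longrightarrow> B \<subseteq> B' \<Longrightarrow> B' \<subseteq> board n \<Longrightarrow> card B' \<le> card B + m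
      \<Longrightarrow> v \<le> game_value n H F Constructor (C \<union> (\<lambda>a. {h, a}) ` A') B'"
  shows "v \<le> game_value n H F Constructor C B"
  using assms
proof (induction m arbitrary: A C B)
  case 0
  show ?case using "0.prems"(7)[of "{}" B] "0.prems"(2) by simp
next
  case (Suc m)
  have "A \<noteq> {}" using Suc.prems by auto
  then obtain a where a: "a \<in> A" by auto
  have inj: "{h, x} = {h, y} \<longleftrightarrow> x = y" for x y by (auto simp: doubleton_eq_iff)
  have mv: "{h, b} \<in> constructor_moves n F C B" if "b \<in> A" for b
    unfolding constructor_moves_def using that Suc.prems(5)[OF that]
    by (auto intro!: free_of_mono[OF Suc.prems(6)])
  show ?case
  proof (rule game_value_Constructor_ge[OF mv[OF a]], rule game_value_Blocker_ge)
    have "card (A - {a}) > 0" using Suc.prems a by (simp add: card_Diff_singleton)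
    then obtain b where b: "b \<in> A" "b \<noteq> a" by (metis Diff_iff card_gt_0_iff ex_in_conv singletonI)
    then have "{h, b} \<in> constructor_moves n F (insert {h, a} C) B"
      using Suc.prems(5)[OF b(1)] a unfolding constructor_moves_def
      by (auto simp: unclaimed_def inj intro!: free_of_mono[OF Suc.prems(6)])
    then show "\<not> game_over n F (insert {h, a} C) B"
      by (auto simp: game_over_def constructor_moves_def)
  next
    fix e assume e: "e \<in> unclaimed n (insert {h, a} C) B"
    \<comment> \<open>what is left after Blocker has answered with e\<close>
    define A1 where "A1 = {x \<in> A - {a}. {h, x} \<noteq> e}"
    have "card (A - {a}) \<le> card A1 + 1"
    proof (cases "\<exists>x. e = {h, x}")
      case True
      then obtain x where "e = {h, x}" by auto
      then have "A1 = A - {a} - {x}" by (auto simp: A1_def inj)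
      then show ?thesis using card_Diff1_le[of "A - {a}" x]
        by (metis Suc_eq_plus1 Suc_pred card_Diff_singleton_if card_gt_0_iff diff_le_self le_SucI not_less_eq_eq Suc.prems(3) finite_Diff empty_iff insert_Diff_if One_nat_def order_refl)
    next
      case False
      then have "A1 = A - {a}" by (auto simp: A1_def)
      then show ?thesis by simp
    qed
    then have c1: "card A1 > 2 * m" using Suc.prems(4) a Suc.prems(3) by (simp add: card_Diff_singleton)
    show "v \<le> game_value n H F Constructor (insert {h, a} C) (insert e B)"
    proof (rule Suc.IH[of _ _ A1])
      show "insert {h, a} C \<subseteq> board n" using Suc.prems(1) Suc.prems(5)[OF a] by (auto simp: unclaimed_def)
      show "insert e B \<subseteq> board n" using Suc.prems(2) e by (auto simp: unclaimed_def)
      show "finite A1" using Suc.prems by (simp add: A1_def)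
      show "2 * m < card A1" by (rule c1)
      show "{h, x} \<in> unclaimed n (insert {h, a} C) (insert e B)" if "x \<in> A1" for x
        using that Suc.prems(5)[of x] by (auto simp: A1_def unclaimed_def inj)
      show "free_of F ({..<n}, insert {h, a} C \<union> (\<lambda>a. {h, a}) ` A1)"
        by (rule free_of_mono[OF Suc.prems(6)]) (use a in \<open>auto simp: A1_def\<close>)
      fix A' B' assume A': "A' \<subseteq> A1" "card A' = m" "insert e B \<subseteq> B'" "B' \<subseteq> board n"
        "card B' \<le> card (insert e B) + m"
      have fA': "finite A'" using A'(1) Suc.prems(3) by (auto simp: A1_def intro: finite_subset)
      have "v \<le> game_value n H F Constructor (C \<union> (\<lambda>a. {h, a}) ` insert a A') B'"
      proof (rule Suc.prems(7))
        show "card (insert a A') = Suc m" using A' fA' by (subst card_insert_disjoint) (auto simp: A1_def)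
        have "finite B" using Suc.prems(2) by (rule finite_subset) (simp add: finite_imp_finite_nsets)
        then show "card B' \<le> card B + Suc m" using A'(5)
          by (simp add: card_insert_if split: if_splits)
      qed (use A' a in \<open>auto simp: A1_def\<close>)
      then show "v \<le> game_value n H F Constructor (insert {h, a} C \<union> (\<lambda>a. {h, a}) ` A') B'"
        by simp
    qed
  qed
qed


text \<open>
  Edges at h that Blocker owns are set aside first.
\<close>

lemma force_star:
  assumes C: "C \<subseteq> board n" and B: "B \<subseteq> board n" and A: "finite A"
    and m: "card A > 2 * m + card {e \<in> B. h \<in> e}"
    and un: "\<And>a. a \<in> A \<Longrightarrow> {h, a} \<in> board n \<and> {h, a} \<notin> C"
    and free: "free_of F ({..<n}, C \<union> (\<lambda>a. {h, a}) ` A)"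
    and goal: "\<And>A' B'. A' \<subseteq> A \<Longrightarrow> card A' = m \<Longrightarrow> B \<subseteq> B' \<Longrightarrow> B' \<subseteq> board n \<Longrightarrow> card B' \<le> card B + m
      \<Longrightarrow> v \<le> game_value n H F Constructor (C \<union> (\<lambda>a. {h, a}) ` A') B'"
  shows "v \<le> game_value n H F Constructor C B"
proof (rule force_star_unclaimed[OF C B, where A = "{a \<in> A. {h, a} \<notin> B}" and m = m and h = h])
  let ?A = "{a \<in> A. {h, a} \<notin> B}"
  show "finite ?A" using A by simp
  have finB: "finite B" using B finite_subset finite_imp_finite_nsets by blast
  have "card (A - ?A) \<le> card {e \<in> B. h \<in> e}"
    by (rule card_inj_on_le[of "\<lambda>a. {h, a}"]) (use finB in \<open>auto simp: inj_on_def doubleton_eq_iff\<close>)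
  moreover have "card A = card ?A + card (A - ?A)"
    using A by (metis (no_types, lifting) card_Diff_subset card_mono finite_subset le_add_diff_inverse mem_Collect_eq subsetI)
  ultimately show "2 * m < card ?A" using m by linarith
  show "{h, a} \<in> unclaimed n C B" if "a \<in> ?A" for a using that un[of a] by (auto simp: unclaimed_def)
  show "free_of F ({..<n}, C \<union> (\<lambda>a. {h, a}) ` ?A)" by (rule free_of_mono[OF free]) auto
  fix A' B' assume "A' \<subseteq> ?A" "card A' = m" "B \<subseteq> B'" "B' \<subseteq> board n" "card B' \<le> card B + m"
  then show "v \<le> game_value n H F Constructor (C \<union> (\<lambda>a. {h, a}) ` A') B'"
    by (intro goal) auto
qed

text \<open>
  All edges of Blocker at a vertex that was untouched before have been claimed since.
\<close>

lemma card_incident_new: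
  assumes "B \<subseteq> B'" "finite B'" "card B' \<le> card B + m" "h \<notin> \<Union> B"
  shows "card {e \<in> B'. h \<in> e} \<le> m"
proof -
  have "{e \<in> B'. h \<in> e} \<subseteq> B' - B" using assms(4) by auto
  then have "card {e \<in> B'. h \<in> e} \<le> card (B' - B)" using assms(2) by (intro card_mono) auto
  also have "\<dots> \<le> m" using assms by (subst card_Diff_subset) (auto intro: finite_subset)
  finally show ?thesis .
qed

lemma card_residue_class:
  assumes "r < t" shows "n div t \<le> card {v. v < n \<and> v mod t = (r::nat)}"
proof -
  have "(\<lambda>j. r + t * j) ` {..<n div t} \<subseteq> {v. v < n \<and> v mod t = r}"
  proof clarify
    fix j assume "j < n div t"
    then have "t * Suc j \<le> t * (n div t)" by (intro mult_le_mono2) simp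
    also have "\<dots> \<le> n" by simp
    finally show "r + t * j < n \<and> (r + t * j) mod t = r" using assms by simp
  qed
  then have "card ((\<lambda>j. r + t * j) ` {..<n div t}) \<le> card {v. v < n \<and> v mod t = r}"
    by (intro card_mono) auto
  then show ?thesis using assms by (subst (asm) card_image) (auto simp: inj_on_def)
qed

locale blowup_game =
  fixes n t k w v :: nat and s :: nat
  defines "s \<equiv> t div 2"
  assumes t4: "t \<ge> 4" and k3: "k \<ge> 3" and tk: "t \<noteq> 2 * k" and w1: "w \<ge> 1"
    and room: "n div t \<ge> 4 * (w * 6 ^ (s - 1)) * s + 4"
    and win: "\<And>C Y. C \<subseteq> board n \<Longrightarrow>
      (\<And>p. p < t \<Longrightarrow> finite (Y p) \<and> Y p \<subseteq> {u. u < n \<and> u mod t = p} \<and> card (Y p) \<ge> (if odd p then w else 1)) \<Longrightarrow>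
      (\<And>p a b. p < t \<Longrightarrow> a \<in> Y p \<Longrightarrow> b \<in> Y (Suc p mod t) \<Longrightarrow> {a, b} \<in> C) \<Longrightarrow>
      v \<le> card (copies (cycle_graph t) ({..<n}, C))"
begin

abbreviation "val C B \<equiv> game_value n (cycle_graph t) (cycle_graph (2 * k)) Constructor C B"
abbreviation "M \<equiv> w * 6 ^ (s - 1)"
abbreviation "cls p \<equiv> {u. u < n \<and> u mod t = p}"

text \<open>
  The position before the hub in class 2j is chosen. The sets Y p contain the candidates for the vertex in class p
  of a copy. All edges between consecutive candidate sets are present up to class 2j - 1 and from class
  2s - 1 on. The candidates in class 2j - 1 are joined to the previous hub only, those in
  class 2s - 1 so far only to the next even class, which is the class of the first hub if t is even and a second hub adjacent to it if t is odd. Candidate sets that have yet to be thinned out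
  are larger by a factor of 6 per remaining stage; Blocker gains at most 2 M edges per stage.
\<close>

definition stage :: "nat \<Rightarrow> nat set set \<Rightarrow> nat set set \<Rightarrow> (nat \<Rightarrow> nat option) \<Rightarrow> (nat \<Rightarrow> nat set) \<Rightarrow> bool" where
  "stage j C B hub Y \<longleftrightarrow> C \<subseteq> blowup n t hub \<and> B \<subseteq> board n \<and> card B \<le> 2 * M * j + 1 \<and>
     (\<forall>p. even p \<and> 2 * j \<le> p \<and> p < 2 * s \<longrightarrow> hub p = None) \<and>
     (\<forall>p<t. Y p \<subseteq> cls p) \<and>
     (\<forall>p<t. p < 2 * j - 1 \<or> 2 * s \<le> Suc p \<longrightarrow> (\<forall>a\<in>Y p. \<forall>b\<in>Y (Suc p mod t). {a, b} \<in> C)) \<and>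
     (\<forall>p<t. even p \<and> (p < 2 * j \<or> 2 * s \<le> p) \<longrightarrow> (\<exists>h. Y p = {h})) \<and>
     (\<forall>p<t. odd p \<longrightarrow> (if p < 2 * j - 1 then w else w * 6 ^ (s - j)) \<le> card (Y p))"

lemma s_bounds: "s \<ge> 2" "2 * s \<le> t" "t \<le> 2 * s + 1" using t4 by (auto simp: s_def)

lemma finite_edges: "B \<subseteq> board n \<Longrightarrow> finite B"
  using finite_subset finite_imp_finite_nsets by blast

lemma stageD:
  assumes "stage j C B hub Y"
  shows "C \<subseteq> blowup n t hub" "B \<subseteq> board n" "card B \<le> 2 * M * j + 1"
    and "even p \<Longrightarrow> 2 * j \<le> p \<Longrightarrow> p < 2 * s \<Longrightarrow> hub p = None"
    and "p < t \<Longrightarrow> Y p \<subseteq> cls p"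
    and "p < t \<Longrightarrow> p < 2 * j - 1 \<or> 2 * s \<le> Suc p \<Longrightarrow> a \<in> Y p \<Longrightarrow> b \<in> Y (Suc p mod t) \<Longrightarrow> {a, b} \<in> C"
    and "p < t \<Longrightarrow> even p \<Longrightarrow> p < 2 * j \<or> 2 * s \<le> p \<Longrightarrow> \<exists>h. Y p = {h}"
    and "p < t \<Longrightarrow> odd p \<Longrightarrow> (if p < 2 * j - 1 then w else w * 6 ^ (s - j)) \<le> card (Y p)"
proof -
  note st = assms[unfolded stage_def]
  show "C \<subseteq> blowup n t hub" using st by (rule conjunct1)
  note st = st[THEN conjunct2]
  show "B \<subseteq> board n" using st by (rule conjunct1)
  note st = st[THEN conjunct2]
  show "card B \<le> 2 * M * j + 1" using st by (rule conjunct1)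
  note st = st[THEN conjunct2]
  show "even p \<Longrightarrow> 2 * j \<le> p \<Longrightarrow> p < 2 * s \<Longrightarrow> hub p = None" using st[THEN conjunct1] by simp
  note st = st[THEN conjunct2]
  show "p < t \<Longrightarrow> Y p \<subseteq> cls p" using st[THEN conjunct1] by simp
  note st = st[THEN conjunct2]
  show "p < t \<Longrightarrow> p < 2 * j - 1 \<or> 2 * s \<le> Suc p \<Longrightarrow> a \<in> Y p \<Longrightarrow> b \<in> Y (Suc p mod t) \<Longrightarrow> {a, b} \<in> C"
    using st[THEN conjunct1] by blast
  note st = st[THEN conjunct2]
  show "p < t \<Longrightarrow> even p \<Longrightarrow> p < 2 * j \<or> 2 * s \<le> p \<Longrightarrow> \<exists>h. Y p = {h}"
    using st[THEN conjunct1] by simp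
  note st = st[THEN conjunct2]
  show "p < t \<Longrightarrow> odd p \<Longrightarrow> (if p < 2 * j - 1 then w else w * 6 ^ (s - j)) \<le> card (Y p)"
    using st by simp
qed

lemma stage_final:
  assumes "stage s C B hub Y" shows "v \<le> val C B"
proof -
  note st = stageD[OF assms]
  have C: "C \<subseteq> board n" using st(1) subset_trans[OF _ blowup_sub[of t n hub]] t4 by simp
  have "v \<le> card (copies (cycle_graph t) ({..<n}, C))"
  proof (rule win[OF C, of Y])
    fix p assume p: "p < t"
    have "finite (Y p)" using st(5)[OF p] by (rule finite_subset) simp
    moreover have "(if odd p then w else 1) \<le> card (Y p)"
    proof (cases "odd p")
      case True
      then show ?thesis using st(8)[OF p True] by (simp split: if_splits)
    next
      case False
      then obtain h where "Y p = {h}" using st(7)[OF p] by (meson not_le)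
      then show ?thesis using False by simp
    qed
    ultimately show "finite (Y p) \<and> Y p \<subseteq> cls p \<and> (if odd p then w else 1) \<le> card (Y p)"
      using st(5)[OF p] by blast
  next
    fix p a b assume p: "p < t" "a \<in> Y p" "b \<in> Y (Suc p mod t)"
    have "p < 2 * s - 1 \<or> 2 * s \<le> Suc p" by linarith
    then show "{a, b} \<in> C" by (rule st(6)[OF p(1) _ p(2,3)])
  qed
  then show ?thesis using game_value_ge_copies[OF C] le_trans by blast
qed

text \<open>
  Blocker's edges cover at most twice as many vertices as there are edges.
\<close>

lemma untouched_vertex:
  assumes "p < t" "B \<subseteq> board n" "2 * card B < n div t"
  shows "\<exists>h. h \<in> cls p \<and> h \<notin> \<Union> B"
proof -
  have "card (\<Union> B) \<le> sum card B" by (rule card_Union_le_sum_card)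
  also have "sum card B = (\<Sum>e\<in>B. 2)" by (rule sum.cong) (use assms(2) in \<open>auto simp: nsets_def\<close>)
  also have "\<dots> = 2 * card B" by simp
  finally have "card (\<Union> B) < card (cls p)" using assms(3) card_residue_class[OF assms(1), of n] by linarith
  moreover have "finite (\<Union> B)" using assms(2) by (auto simp: nsets_def intro!: finite_Union finite_edges[OF assms(2)])
  ultimately have "\<not> cls p \<subseteq> \<Union> B" using card_mono leD by blast
  then show ?thesis by blast
qed

text \<open>
  An untouched vertex h of class 2j becomes a hub. First W candidates of class 2j - 1 and then W
  candidates of class 2j + 1 are joined to h and replace these candidate sets. Of 6 W candidates, the
  second star loses at most W to Blocker's answers to the first one, which leaves more than the 2 W that are needed.
  In the last step class 2j + 1 is class 2s - 1 and the cycle of classes closes.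
\<close>

lemma stage_step:
  assumes st: "stage j C B hub Y" and j: "1 \<le> j" "j < s"
    and goal: "\<And>C B hub Y. stage (Suc j) C B hub Y \<Longrightarrow> v \<le> val C B"
  shows "v \<le> val C B"
proof -
  define W where "W = w * 6 ^ (s - Suc j)"
  have W6: "w * 6 ^ (s - j) = 6 * W" using j by (simp add: W_def Suc_diff_Suc[symmetric])
  have W1: "W \<ge> 1" "W \<ge> w" using w1 by (auto simp: W_def)
  have WM: "W \<le> M" unfolding W_def by (intro mult_le_mono2 power_increasing) (use j in auto)
  have lt: "2 * j - 1 < t" "2 * j < t" "2 * j + 1 < t" using j s_bounds by auto
  note st = stageD[OF st, unfolded W6]
  have "2 * card B < n div t"
  proof -
    have "2 * M * j \<le> 2 * M * s" using j by (intro mult_le_mono2) simp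
    then show ?thesis using st(3) room by linarith
  qed
  then obtain h where h: "h < n" "h mod t = 2 * j" "h \<notin> \<Union> B"
    using untouched_vertex[OF lt(2) st(2)] by blast
  define hub' where "hub' = hub(2 * j \<mapsto> h)"
  have "hub (2 * j) = None" using st(4)[of "2 * j"] j by simp
  then have "hub \<subseteq>\<^sub>m hub'" by (auto simp: hub'_def map_le_def)
  then have C': "C \<subseteq> blowup n t hub'" using st(1) blowup_mono by blast
  have notC: "{h, a} \<notin> C" for a
    using st(1) blowup_edge(2)[of h a n t hub] \<open>hub (2 * j) = None\<close> h(2) by auto
  have in1: "{h, a} \<in> blowup n t hub'" if "a \<in> cls (2 * j - 1)" for a
  proof -
    have "Suc (2 * j - 1) = 2 * j" using j by simp
    then have "{a, h} \<in> blowup n t hub'" unfolding blowup_def mem_Collect_eq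
      using that h(1,2) lt j by (intro exI[of _ a] exI[of _ h]) (auto simp: hub'_def)
    then show ?thesis by (simp add: insert_commute)
  qed
  have in2: "{h, a} \<in> blowup n t hub'" if "a \<in> cls (2 * j + 1)" for a
    unfolding blowup_def mem_Collect_eq
    using that h(1,2) lt j by (intro exI[of _ h] exI[of _ a]) (auto simp: hub'_def)
  have bsub: "blowup n t hub' \<subseteq> board n" using t4 by (intro blowup_sub) simp
  have free: "free_of (cycle_graph (2 * k)) ({..<n}, Y)" if "Y \<subseteq> blowup n t hub'" for Y
    by (rule free_of_mono[OF blowup_free[OF t4 k3 tk] that])
  have X1: "Y (2 * j - 1) \<subseteq> cls (2 * j - 1)" "6 * W \<le> card (Y (2 * j - 1))"
    and X2: "Y (2 * j + 1) \<subseteq> cls (2 * j + 1)" "6 * W \<le> card (Y (2 * j + 1))"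
    using st(5)[OF lt(1)] st(5)[OF lt(3)] st(8)[OF lt(1)] st(8)[OF lt(3)] j
    by (auto split: if_splits)
  have fin: "finite (Y (2 * j - 1))" "finite (Y (2 * j + 1))"
    using X1(1) X2(1) by (auto intro: finite_subset)
  show ?thesis
  proof (rule force_star[where h = h and m = W and A = "Y (2 * j - 1)"])
    show "C \<subseteq> board n" using C' bsub by blast
    have "{e \<in> B. h \<in> e} = {}" using h(3) by auto
    then have "card {e \<in> B. h \<in> e} = 0" by (simp only: card.empty)
    then show "2 * W + card {e \<in> B. h \<in> e} < card (Y (2 * j - 1))" using X1(2) W1 by linarith
    show "{h, a} \<in> board n \<and> {h, a} \<notin> C" if "a \<in> Y (2 * j - 1)" for a
      using in1[of a] that X1(1) bsub notC by blast
    show "free_of (cycle_graph (2 * k)) ({..<n}, C \<union> (\<lambda>a. {h, a}) ` Y (2 * j - 1))"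
      by (rule free) (use C' in1 X1(1) in blast)
    fix A1 B1 assume A1: "A1 \<subseteq> Y (2 * j - 1)" "card A1 = W"
      and B1: "B \<subseteq> B1" "B1 \<subseteq> board n" "card B1 \<le> card B + W"
    define C1 where "C1 = C \<union> (\<lambda>a. {h, a}) ` A1"
    have C1: "C1 \<subseteq> blowup n t hub'" using C' in1 X1(1) A1(1) unfolding C1_def by blast
    show "v \<le> val (C \<union> (\<lambda>a. {h, a}) ` A1) B1"
      unfolding C1_def[symmetric]
    proof (rule force_star[where h = h and m = W and A = "Y (2 * j + 1)"])
      show "C1 \<subseteq> board n" using C1 bsub by blast
      have "card {e \<in> B1. h \<in> e} \<le> W"
        by (rule card_incident_new[OF B1(1) finite_edges[OF B1(2)] B1(3) h(3)])
      then show "2 * W + card {e \<in> B1. h \<in> e} < card (Y (2 * j + 1))" using X2(2) W1 by linarith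
      show "{h, a} \<in> board n \<and> {h, a} \<notin> C1" if a: "a \<in> Y (2 * j + 1)" for a
      proof
        have am: "a \<in> cls (2 * j + 1)" using a X2(1) by blast
        then show "{h, a} \<in> board n" using in2 bsub by blast
        have "a \<notin> A1" using am A1(1) X1(1) j by auto
        then show "{h, a} \<notin> C1" using notC by (auto simp: C1_def doubleton_eq_iff)
      qed
      show "free_of (cycle_graph (2 * k)) ({..<n}, C1 \<union> (\<lambda>a. {h, a}) ` Y (2 * j + 1))"
        by (rule free) (use C1 in2 X2(1) in blast)
      fix A2 B2 assume A2: "A2 \<subseteq> Y (2 * j + 1)" "card A2 = W"
        and B2: "B1 \<subseteq> B2" "B2 \<subseteq> board n" "card B2 \<le> card B1 + W"
      define C2 where "C2 = C1 \<union> (\<lambda>a. {h, a}) ` A2"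
      define X' where "X' = Y(2 * j - 1 := A1, 2 * j := {h}, 2 * j + 1 := A2)"
      have X'_at: "X' (2 * j - 1) = A1" "X' (2 * j) = {h}" "X' (2 * j + 1) = A2"
        using j by (auto simp: X'_def)
      have X'_else: "X' p = Y p" if "p \<noteq> 2 * j - 1" "p \<noteq> 2 * j" "p \<noteq> 2 * j + 1" for p
        using that by (simp add: X'_def)
      have X'_sub: "X' p \<subseteq> Y p" if "p \<noteq> 2 * j" for p
        using that A1(1) A2(1) X'_at X'_else[of p] by (cases "p = 2 * j - 1"; cases "p = 2 * j + 1") auto
      have "stage (Suc j) C2 B2 hub' X'"
        unfolding stage_def
      proof (intro conjI allI impI)
        show "C2 \<subseteq> blowup n t hub'" using C1 in2 X2(1) A2(1) unfolding C2_def by blast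
        show "B2 \<subseteq> board n" by fact
        have "card B2 \<le> 2 * M * j + 1 + 2 * W" using st(3) B1(3) B2(3) by linarith
        also have "\<dots> \<le> 2 * M * Suc j + 1" using WM by simp
        finally show "card B2 \<le> 2 * M * Suc j + 1" .
        show "hub' p = None" if "even p \<and> 2 * Suc j \<le> p \<and> p < 2 * s" for p
          using that st(4)[of p] by (simp add: hub'_def)
        show "X' p \<subseteq> cls p" if "p < t" for p
          using st(5)[OF that] X'_sub[of p] X'_at(2) h by (cases "p = 2 * j") auto
        show "\<forall>a\<in>X' p. \<forall>b\<in>X' (Suc p mod t). {a, b} \<in> C2"
          if p: "p < t" and cond: "p < 2 * Suc j - 1 \<or> 2 * s \<le> Suc p" for p
        proof -
          have sm: "Suc p mod t = (if Suc p = t then 0 else Suc p)" using p by (simp add: mod_Suc)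
          consider "p = 2 * j - 1" | "p = 2 * j" | "p < 2 * j - 1 \<or> 2 * s \<le> Suc p" "p \<noteq> 2 * j - 1" "p \<noteq> 2 * j"
            using cond by fastforce
          then show ?thesis
          proof cases
            case 1
            then have "Suc p mod t = 2 * j" using lt j sm by simp
            then show ?thesis using X'_at 1 by (auto simp: C2_def C1_def insert_commute)
          next
            case 2
            then have "Suc p mod t = 2 * j + 1" using lt j sm by simp
            then show ?thesis using X'_at 2 by (auto simp: C2_def)
          next
            case 3
            have "Suc p mod t \<noteq> 2 * j" using 3 sm j by auto
            have "{a, b} \<in> C" if "a \<in> X' p" "b \<in> X' (Suc p mod t)" for a b
              using st(6)[OF p 3(1)] X'_sub[OF 3(3)] X'_sub[OF \<open>Suc p mod t \<noteq> 2 * j\<close>] that by blast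
            then show ?thesis unfolding C2_def C1_def by blast
          qed
        qed
        show "\<exists>h. X' p = {h}" if "p < t" "even p \<and> (p < 2 * Suc j \<or> 2 * s \<le> p)" for p
        proof (cases "p = 2 * j")
          case False
          then have "p < 2 * j \<or> 2 * s \<le> p" using that(2) by (auto elim!: evenE)
          moreover have "X' p = Y p" using False that(2) j by (intro X'_else) auto
          ultimately show ?thesis using st(7)[of p] that by simp
        qed (simp add: X'_at)
        show "(if p < 2 * Suc j - 1 then w else w * 6 ^ (s - Suc j)) \<le> card (X' p)" if "p < t" "odd p" for p
        proof -
          consider "p = 2 * j - 1" | "p = 2 * j + 1" | "p \<noteq> 2 * j - 1" "p \<noteq> 2 * j + 1" "p \<noteq> 2 * j"
            using \<open>odd p\<close> by (metis dvd_triv_left)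
          then show ?thesis
          proof cases
            case 1 then show ?thesis using X'_at(1) A1(2) W1 by (simp add: W_def)
          next
            case 2 then show ?thesis using X'_at(3) A2(2) W1 by (simp add: W_def)
          next
            case 3
            then have "X' p = Y p" by (intro X'_else)
            moreover have "p < 2 * Suc j - 1 \<Longrightarrow> p < 2 * j - 1" using 3 j by arith
            ultimately show ?thesis using st(8)[OF that] W1 unfolding W_def[symmetric]
              by (auto split: if_splits)
          qed
        qed
      qed
      then show "v \<le> val (C1 \<union> (\<lambda>a. {h, a}) ` A2) B2" unfolding C2_def[symmetric] by (rule goal)
    qed (use fin B1 in auto)
  qed (use fin st in auto)
qed

lemma stage_wins:
  assumes "1 \<le> j" "j \<le> s" "stage j C B hub Y" shows "v \<le> val C B"
  using assms(2,1,3)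
proof (induction j arbitrary: C B hub Y rule: inc_induct)
  case base then show ?case by (intro stage_final)
next
  case (step m)
  show ?case by (rule stage_step[OF step.prems(2)]) (use step in auto)
qed

text \<open>
  The ends of the chain of classes are the hub 0 and a', the hub of class 2s mod t. For even t they
  coincide, for odd t they are joined by the edge in C0. Both receive a star with M leaves, into class 1 and class 2s - 1.
\<close>

lemma stage_1_wins:
  assumes a': "a' < n" "a' mod t = 2 * s mod t"
    and hub: "hub 0 = Some 0" "hub (2 * s mod t) = Some a'" "\<And>p. even p \<Longrightarrow> 2 \<le> p \<Longrightarrow> p < 2 * s \<Longrightarrow> hub p = None"
    and C0: "C0 \<subseteq> blowup n t hub" "C0 \<subseteq> {{0, a'}}" "odd t \<Longrightarrow> {0, a'} \<in> C0"
    and B: "B \<subseteq> board n" "card B \<le> 1"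
  shows "v \<le> val C0 B"
proof -
  have M1: "M \<ge> 1" using w1 by simp
  have room': "8 * M + 4 \<le> n div t"
  proof -
    have "4 * M * 2 \<le> 4 * M * s" using s_bounds(1) by (intro mult_le_mono2)
    then show ?thesis using room by linarith
  qed
  have big: "8 * M + 4 \<le> card (cls p)" if "p < t" for p
    using room' card_residue_class[OF that, of n] by linarith
  have n0: "n > 0" using room' by (cases n) auto
  have lt: "1 < t" "2 * s - 1 < t" "0 < t" using s_bounds t4 by auto
  have ev: "even (2 * s mod t)" using s_bounds by (cases "2 * s = t") auto
  have s3: "2 * s - 1 \<noteq> 1" "odd (2 * s - 1)" "Suc (2 * s - 1) = 2 * s" using s_bounds(1) by auto
  have bsub: "blowup n t hub \<subseteq> board n" using t4 by (intro blowup_sub) simp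
  have free: "free_of (cycle_graph (2 * k)) ({..<n}, Y)" if "Y \<subseteq> blowup n t hub" for Y
    by (rule free_of_mono[OF blowup_free[OF t4 k3 tk] that])
  have in1: "{0, a} \<in> blowup n t hub" if "a \<in> cls 1" for a
    unfolding blowup_def mem_Collect_eq
    using that n0 lt hub(1) by (intro exI[of _ 0] exI[of _ a]) auto
  have in2: "{a', a} \<in> blowup n t hub" if "a \<in> cls (2 * s - 1)" for a
  proof -
    have "{a, a'} \<in> blowup n t hub"
      unfolding blowup_def mem_Collect_eq
      using that a' hub(2) s3 by (intro exI[of _ a] exI[of _ a']) auto
    then show ?thesis by (simp add: insert_commute)
  qed
  have finB: "finite B" by (rule finite_edges[OF B(1)])
  show ?thesis
  proof (rule force_star[where h = 0 and m = M and A = "cls 1"])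
    show "C0 \<subseteq> board n" using C0(1) bsub by blast
    have "card {e \<in> B. 0 \<in> e} \<le> card B" using finB by (intro card_mono) auto
    then show "2 * M + card {e \<in> B. 0 \<in> e} < card (cls 1)" using big[OF lt(1)] B(2) by linarith
    show "{0, a} \<in> board n \<and> {0, a} \<notin> C0" if a: "a \<in> cls 1" for a
    proof
      show "{0, a} \<in> board n" using in1[OF a] bsub by blast
      have "a \<noteq> a'" using a a'(2) ev by auto
      then show "{0, a} \<notin> C0" using C0(2) by (auto simp: doubleton_eq_iff)
    qed
    show "free_of (cycle_graph (2 * k)) ({..<n}, C0 \<union> (\<lambda>a. {0, a}) ` cls 1)"
      by (rule free) (use C0(1) in1 in blast)
    fix A1 B1 assume A1: "A1 \<subseteq> cls 1" "card A1 = M"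
      and B1: "B \<subseteq> B1" "B1 \<subseteq> board n" "card B1 \<le> card B + M"
    define C1 where "C1 = C0 \<union> (\<lambda>a. {0, a}) ` A1"
    have C1: "C1 \<subseteq> blowup n t hub" using C0(1) in1 A1(1) unfolding C1_def by blast
    show "v \<le> val (C0 \<union> (\<lambda>a. {0, a}) ` A1) B1"
      unfolding C1_def[symmetric]
    proof (rule force_star[where h = a' and m = M and A = "cls (2 * s - 1)"])
      show "C1 \<subseteq> board n" using C1 bsub by blast
      have "card {e \<in> B1. a' \<in> e} \<le> card B1" using finite_edges[OF B1(2)] by (intro card_mono) auto
      then show "2 * M + card {e \<in> B1. a' \<in> e} < card (cls (2 * s - 1))"
        using big[OF lt(2)] B(2) B1(3) M1 by linarith
      show "{a', a} \<in> board n \<and> {a', a} \<notin> C1" if a: "a \<in> cls (2 * s - 1)" for a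
      proof
        show "{a', a} \<in> board n" using in2[OF a] bsub by blast
        have "a \<noteq> 0" using a s3(2) by (cases "a = 0") auto
        moreover have "a \<notin> A1" using a A1(1) s3(1) by auto
        ultimately show "{a', a} \<notin> C1" using C0(2) by (auto simp: C1_def doubleton_eq_iff)
      qed
      show "free_of (cycle_graph (2 * k)) ({..<n}, C1 \<union> (\<lambda>a. {a', a}) ` cls (2 * s - 1))"
        by (rule free) (use C1 in2 in blast)
      fix A2 B2 assume A2: "A2 \<subseteq> cls (2 * s - 1)" "card A2 = M"
        and B2: "B1 \<subseteq> B2" "B2 \<subseteq> board n" "card B2 \<le> card B1 + M"
      define C2 where "C2 = C1 \<union> (\<lambda>a. {a', a}) ` A2"
      define Y where "Y = cls(0 := {0}, 2 * s mod t := {a'}, 1 := A1, 2 * s - 1 := A2)"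
      have n1: "2 * s mod t \<noteq> 1" "2 * s mod t \<noteq> 2 * s - 1" using ev s3(2) by auto
      have a'0: "a' = 0" if "2 * s mod t = 0" using hub(1,2) that by simp
      have Y_at: "Y 0 = {0}" "Y 1 = A1" "Y (2 * s - 1) = A2" "Y (2 * s mod t) = {a'}"
        using n1 s3 a'0 lt by (auto simp: Y_def)
      have Y_else: "Y p = cls p" if "p \<noteq> 0" "p \<noteq> 1" "p \<noteq> 2 * s - 1" "p \<noteq> 2 * s mod t" for p
        using that by (simp add: Y_def)
      have "stage 1 C2 B2 hub Y"
        unfolding stage_def
      proof (intro conjI allI impI)
        show "C2 \<subseteq> blowup n t hub" using C1 in2 A2(1) unfolding C2_def by blast
        show "B2 \<subseteq> board n" by fact
        show "card B2 \<le> 2 * M * 1 + 1" using B(2) B1(3) B2(3) by linarith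
        show "hub p = None" if "even p \<and> 2 * 1 \<le> p \<and> p < 2 * s" for p using that hub(3) by simp
        show "Y p \<subseteq> cls p" if "p < t" for p
        proof -
          consider "p = 0" | "p = 1" | "p = 2 * s - 1" | "p = 2 * s mod t"
            | "p \<noteq> 0" "p \<noteq> 1" "p \<noteq> 2 * s - 1" "p \<noteq> 2 * s mod t" by blast
          then show ?thesis
          proof cases
            case 1 then show ?thesis using Y_at(1) n0 by simp
          next
            case 2 then show ?thesis using Y_at(2) A1(1) by simp
          next
            case 3 then show ?thesis using Y_at(3) A2(1) by simp
          next
            case 4 then show ?thesis using Y_at(4) a' by simp
          next
            case 5 then show ?thesis using Y_else by simp
          qed
        qed
        show "\<forall>a\<in>Y p. \<forall>b\<in>Y (Suc p mod t). {a, b} \<in> C2"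
          if p: "p < t" and cond: "p < 2 * 1 - 1 \<or> 2 * s \<le> Suc p" for p
        proof -
          consider "p = 0" | "p = 2 * s - 1" | "p = 2 * s" using cond p s_bounds by linarith
          then show ?thesis
          proof cases
            case 1
            then have "Suc p mod t = 1" using lt by simp
            then show ?thesis using 1 Y_at by (auto simp: C2_def C1_def)
          next
            case 2
            then have "Suc p mod t = 2 * s mod t" using s3 by simp
            then show ?thesis using 2 Y_at by (auto simp: C2_def insert_commute)
          next
            case 3
            then have "Suc p = t" "2 * s mod t = p" using p s_bounds by auto
            then show ?thesis using 3 Y_at C0(3) by (auto simp: C2_def C1_def insert_commute)
          qed
        qed
        show "\<exists>h. Y p = {h}" if "p < t" "even p \<and> (p < 2 * 1 \<or> 2 * s \<le> p)" for p
        proof -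
          have "p = 0 \<or> p = 2 * s" using that s_bounds by (auto elim!: evenE)
          then show ?thesis
          proof
            assume "p = 0" then show ?thesis using Y_at(1) by simp
          next
            assume "p = 2 * s"
            then have "2 * s mod t = p" using that by simp
            then show ?thesis using Y_at(4) by simp
          qed
        qed
        show "(if p < 2 * 1 - 1 then w else M) \<le> card (Y p)" if p: "p < t" "odd p" for p
        proof -
          consider "p = 1" | "p = 2 * s - 1" | "p \<noteq> 0" "p \<noteq> 1" "p \<noteq> 2 * s - 1" "p \<noteq> 2 * s mod t"
            using p(2) ev by (metis even_zero)
          then show ?thesis
          proof cases
            case 1 then show ?thesis using Y_at(2) A1(2) by simp
          next
            case 2 then show ?thesis using Y_at(3) A2(2) s3 by simp
          next
            case 3
            have "M \<le> card (Y p)" unfolding Y_else[OF 3] using big[OF p(1)] by linarith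
            then show ?thesis using p by (cases p) auto
          qed
        qed
      qed
      then show "v \<le> val (C1 \<union> (\<lambda>a. {a', a}) ` A2) B2"
        unfolding C2_def[symmetric] by (intro stage_wins[of 1]) (use s_bounds in auto)
    qed (use B1 in auto)
  qed (use B in auto)
qed

text \<open>
  For odd t the first move joins 0 to some vertex a' of class t - 1.
\<close>

lemma game_number_ge: "v \<le> cycle_game n t (2 * k)"
proof -
  have "4 \<le> n div t" using room by linarith
  then have n0: "n > 0" by (cases n) auto
  show ?thesis
  proof (cases "even t")
    case True
    then have "2 * s mod t = 0" by (simp add: s_def)
    then show ?thesis unfolding game_number_def
      by (intro stage_1_wins[of 0 "[0 \<mapsto> 0]"]) (use n0 True in auto)
  next
    case False
    then have ts: "2 * s mod t = t - 1" "2 * s = t - 1" "even (t - 1)" "Suc (t - 1) = t" using s_bounds t4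
      by (auto simp: s_def)
    have sub: "(\<lambda>a. {0, a}) ` cls (t - 1) \<subseteq> board n"
    proof clarify
      fix a assume "a < n" "a mod t = t - 1"
      moreover from this have "a \<noteq> 0" using t4 by (cases "a = 0") simp_all
      ultimately show "{0, a} \<in> board n" using n0 by simp
    qed
    show ?thesis unfolding game_number_def
    proof (rule force_star[where h = 0 and m = 1 and A = "cls (t - 1)"])
      have "n div t \<le> card (cls (t - 1))" using t4 by (intro card_residue_class) simp
      then show "2 * 1 + card {e \<in> {}. (0::nat) \<in> e} < card (cls (t - 1))"
        using \<open>4 \<le> n div t\<close> by simp
      show "free_of (cycle_graph (2 * k)) ({..<n}, {} \<union> (\<lambda>a. {0, a}) ` cls (t - 1))"
        using star_free[OF _ sub, of "2 * k"] k3 by simp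
      show "{0, a} \<in> board n \<and> {0, a} \<notin> {}" if "a \<in> cls (t - 1)" for a
        using sub that by blast
      fix A' B' assume A': "A' \<subseteq> cls (t - 1)" "card A' = 1"
        and B': "{} \<subseteq> B'" "B' \<subseteq> board n" "card B' \<le> card {} + 1"
      obtain a' where a': "A' = {a'}" using A'(2) by (auto simp: card_1_singleton_iff)
      then have a'n: "a' < n" "a' mod t = t - 1" using A'(1) by auto
      have "v \<le> val {{0, a'}} B'"
      proof (rule stage_1_wins[of a' "[0 \<mapsto> 0, t - 1 \<mapsto> a']"])
        have "{a', 0} \<in> blowup n t [0 \<mapsto> 0, t - 1 \<mapsto> a']"
          unfolding blowup_def mem_Collect_eq
          by (intro exI[of _ a'] exI[of _ 0]) (use a'n n0 ts t4 in auto)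
        then show "{{0, a'}} \<subseteq> blowup n t [0 \<mapsto> 0, t - 1 \<mapsto> a']" by (simp add: insert_commute)
      qed (use a'n ts t4 B' in auto)
      then show "v \<le> val ({} \<union> (\<lambda>a. {0, a}) ` A') B'" by (simp add: a')
    qed auto
  qed
qed

end

section \<open>Lower bound for k at least 3 and the theorem\<close>

lemma prod_odd: "(\<Prod>p<t. if odd p then w else 1) = (w::nat) ^ (t div 2)"
proof (induction t)
  case (Suc t)
  then show ?case by (cases "even t") (auto elim!: evenE oddE)
qed simp

lemma card_copies_ge_blowup:
  assumes "t \<ge> 3" "C \<subseteq> board n"
    and Y: "\<And>p. p < t \<Longrightarrow> finite (Y p) \<and> Y p \<subseteq> {u. u < n \<and> u mod t = p} \<and> card (Y p) \<ge> (if odd p then w else 1)"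
    and edge: "\<And>p a b. p < t \<Longrightarrow> a \<in> Y p \<Longrightarrow> b \<in> Y (Suc p mod t) \<Longrightarrow> {a, b} \<in> C"
  shows "w ^ (t div 2) \<le> card (copies (cycle_graph t) ({..<n}, C))"
proof -
  have "w ^ (t div 2) \<le> (\<Prod>p<t. card (Y p))"
    unfolding prod_odd[symmetric] by (rule prod_mono) (use Y in auto)
  also have "\<dots> = card (\<Pi>\<^sub>E p\<in>{..<t}. Y p)" by (simp add: card_PiE)
  also have "\<dots> \<le> card (copies (cycle_graph t) ({..<n}, C))"
  proof (rule card_layered_cycles_le_copies[where layer = "\<lambda>u. u mod t"])
    fix g assume g: "g \<in> (\<Pi>\<^sub>E p\<in>{..<t}. Y p)"
    then have gX: "g p \<in> Y p" if "p < t" for p using that by auto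
    show "g \<in> extensional {..<t}" using g by (simp add: PiE_def)
    show "g p mod t = p" if "p < t" for p using Y[OF that] gX[OF that] by auto
    show "cycle_edges t g \<subseteq> C"
    proof
      fix e assume "e \<in> cycle_edges t g"
      then obtain p where p: "p < t" "e = {g p, g (Suc p mod t)}" by (auto simp: cycle_edges_def)
      have "Suc p mod t < t" using p(1) by simp
      then show "e \<in> C" unfolding p(2) using edge[OF p(1)] gX p(1) by blast
    qed
  qed (use assms in auto)
  finally show ?thesis .
qed

lemma game_number_lower_blowup:
  assumes "t \<ge> 4" "k \<ge> 3" "t \<noteq> 2 * k"
  shows "\<exists>c>0. \<exists>N. \<forall>n\<ge>N. c * real n ^ (t div 2) \<le> real (cycle_game n t (2 * k))"
proof -
  define s where "s = t div 2"
  \<comment> \<open>the smallest n for which w = 1 leaves enough room in every class\<close>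
  define Z where "Z = t * (4 * 6 ^ (s - 1) * s + 4)"
  have Z: "Z > 0" using assms by (simp add: Z_def)
  define c where "c = 1 / (2 * real Z) ^ s"
  have "c > 0" using Z by (simp add: c_def)
  moreover have "c * real n ^ (t div 2) \<le> real (cycle_game n t (2 * k))"
    if n: "n \<ge> Z" for n
  proof -
    define w where "w = n div Z"
    have w1: "w \<ge> 1" using n Z by (simp add: w_def div_greater_zero_iff Suc_leI)
    have "w ^ s \<le> cycle_game n t (2 * k)"
    proof -
      have "w * (4 * 6 ^ (s - 1) * s + 4) * t \<le> n"
        unfolding w_def Z_def using div_times_less_eq_dividend[of n Z] by (simp add: Z_def algebra_simps)
      then have "w * (4 * 6 ^ (s - 1) * s + 4) \<le> n div t"
        using assms(1) by (simp add: less_eq_div_iff_mult_less_eq)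
      then have "4 * (w * 6 ^ (s - 1)) * s + 4 * w \<le> n div t" by (simp add: algebra_simps)
      then have "4 * (w * 6 ^ (s - 1)) * s + 4 \<le> n div t" using w1 by linarith
      then have "blowup_game n t k w (w ^ s)"
      proof unfold_locales
        show "4 * (w * 6 ^ (t div 2 - 1)) * (t div 2) + 4 \<le> n div t"
          using \<open>4 * (w * 6 ^ (s - 1)) * s + 4 \<le> n div t\<close> unfolding s_def .
        fix C Y assume *: "C \<subseteq> board n"
          "\<And>p. p < t \<Longrightarrow> finite (Y p) \<and> Y p \<subseteq> {u. u < n \<and> u mod t = p} \<and> card (Y p) \<ge> (if odd p then w else 1)"
          "\<And>p a b. p < t \<Longrightarrow> a \<in> Y p \<Longrightarrow> b \<in> Y (Suc p mod t) \<Longrightarrow> {a, b} \<in> C"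
        have "3 \<le> t" using assms(1) by simp
        then show "w ^ s \<le> card (copies (cycle_graph t) ({..<n}, C))"
          unfolding s_def using * by (rule card_copies_ge_blowup)
      qed (use assms w1 in auto)
      then show ?thesis by (rule blowup_game.game_number_ge)
    qed
    then have "real (w ^ s) \<le> real (cycle_game n t (2 * k))"
      by (simp only: of_nat_le_iff)
    moreover have "c * real n ^ s \<le> real (w ^ s)"
    proof -
      have "n \<le> Z * w + Z" using mod_less_divisor[OF Z, of n] mult_div_mod_eq[of Z n] unfolding w_def by linarith
      also have "\<dots> \<le> 2 * Z * w" using w1 by (cases w) auto
      finally have "real n \<le> real (2 * Z * w)" by (simp only: of_nat_le_iff)
      then have "real n / (2 * real Z) \<le> real w" using Z by (simp add: divide_le_eq mult.commute)
      then have "(real n / (2 * real Z)) ^ s \<le> real w ^ s" by (intro power_mono) auto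
      then show ?thesis by (simp add: c_def power_divide)
    qed
    ultimately have "c * real n ^ s \<le> real (cycle_game n t (2 * k))" by linarith
    then show ?thesis by (simp add: s_def)
  qed
  ultimately show ?thesis by blast
qed

lemma bigthetaI_nat:
  fixes f g :: "nat \<Rightarrow> real"
  assumes "\<And>n. 0 \<le> f n" "\<And>n. 0 \<le> g n" "c > 0" "\<And>n. n \<ge> N \<Longrightarrow> c * g n \<le> f n" "\<And>n. n \<ge> 1 \<Longrightarrow> f n \<le> K * g n"
  shows "f \<in> \<Theta>(g)"
proof
  show "f \<in> O(g)"
    by (rule bigoI[of _ K], rule eventually_sequentiallyI[of 1]) (use assms in simp)
  show "f \<in> \<Omega>(g)"
    by (rule landau_omega.bigI[OF assms(3)], rule eventually_sequentiallyI[of N]) (use assms in simp)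
qed

theorem theorem1p6:
  fixes k t :: nat
  assumes "k \<ge> 2" and "t \<ge> 4" and "t \<noteq> 2 * k"
  shows "(k = 2 \<longrightarrow>
            (\<lambda>n. real (game_number n (cycle_graph t) (cycle_graph (2 * k))))
              \<in> \<Theta>(\<lambda>n. real n powr (real t / 2)))
       \<and> (k \<ge> 3 \<longrightarrow>
            (\<lambda>n. real (game_number n (cycle_graph t) (cycle_graph (2 * k))))
              \<in> \<Theta>(\<lambda>n. real n ^ (t div 2)))"
proof (intro conjI impI)
  assume k: "k = 2"
  then have t: "t \<ge> 5" using assms by simp
  define s where "s = t div 2"
  have s: "s \<ge> 2" using t by (simp add: s_def)
  have "\<exists>K. \<forall>n\<ge>1. real (cycle_game n t 4) \<le> K * real n powr (real t / 2)"
  proof (cases "even t")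
    case True
    then have ts: "t = 2 * s" by (simp add: s_def)
    obtain K where K: "\<forall>n\<ge>1. cycle_game n t 4 \<le> K * n ^ s"
      using game_number_upper_even[of 2 s] s ts by auto
    have "real (cycle_game n t 4) \<le> real K * real n powr (real t / 2)" if n: "n \<ge> 1" for n
    proof -
      have "real (cycle_game n t 4) \<le> real (K * n ^ s)"
        using K n by (simp only: of_nat_le_iff)
      also have "\<dots> = real K * real n powr (real t / 2)"
        using n by (simp add: ts powr_realpow)
      finally show ?thesis .
    qed
    then show ?thesis by blast
  next
    case False
    then have ts: "t = 2 * s + 1" by (simp add: s_def)
    show ?thesis using game_number_upper_odd_C4[of s] s unfolding ts by simp
  qed
  then obtain K where K: "\<And>n. n \<ge> 1 \<Longrightarrow> real (cycle_game n t 4) \<le> K * real n powr (real t / 2)"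
    by blast
  obtain c N where c: "c > 0" "\<And>n. n \<ge> N \<Longrightarrow> c * real n powr (real t / 2) \<le> real (cycle_game n t 4)"
    using game_number_lower_C4[OF t] by blast
  show "(\<lambda>n. real (cycle_game n t (2 * k))) \<in> \<Theta>(\<lambda>n. real n powr (real t / 2))"
    by (rule bigthetaI_nat[OF _ _ c(1), of _ _ N K]) (use c K k in auto)
next
  assume k: "k \<ge> 3"
  define s where "s = t div 2"
  have s: "s \<ge> 2" using assms by (simp add: s_def)
  have "\<exists>K. \<forall>n\<ge>1. cycle_game n t (2 * k) \<le> K * n ^ s"
  proof (cases "even t")
    case True
    then have ts: "t = 2 * s" by (simp add: s_def)
    show ?thesis using game_number_upper_even[OF assms(1) s] unfolding ts .
  next
    case False
    then have ts: "t = 2 * s + 1" by (simp add: s_def)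
    show ?thesis using game_number_upper_odd[OF k s] unfolding ts .
  qed
  then obtain K where K: "\<And>n. n \<ge> 1 \<Longrightarrow> cycle_game n t (2 * k) \<le> K * n ^ s" by blast
  have K': "real (cycle_game n t (2 * k)) \<le> real K * real n ^ s" if "n \<ge> 1" for n
    using K[OF that] by (simp flip: of_nat_power of_nat_mult)
  obtain c N where c: "c > 0" "\<And>n. n \<ge> N \<Longrightarrow> c * real n ^ (t div 2) \<le> real (cycle_game n t (2 * k))"
    using game_number_lower_blowup[OF assms(2) k assms(3)] by blast
  show "(\<lambda>n. real (cycle_game n t (2 * k))) \<in> \<Theta>(\<lambda>n. real n ^ (t div 2))"
    by (rule bigthetaI_nat[OF _ _ c(1), of _ _ N "real K"]) (use c K' s_def in auto)
qed

end
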